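(* The Fourier transform of the scattering operator is given by $$[T_+^\vee\circ(T_-^\vee)^{-1}h](q^{is},\omega)=\frac{q^{-is}-q^{-1}q^{is}}{q^{is}-q^{-1}q^{-is}}\;\mathcal{I}_{q^{is}}\big(h(q^{is},\cdot)\big)(\omega).$$
   Context: Let $\mathcal{T}$ be the $(q+1)$-regular tree with path metric $d$ and base vertex $o$, $A$ its adjacency operator on functions on vertices, $[Af](v)=\sum_{w\sim v}f(w)$. $\Omega$ is the set of infinite non-backtracking paths modulo $\gamma_1\sim\gamma_2$ iff $\lim_n d(\gamma_1(n),\gamma_2(n))<\infty$; $\gamma_{o,\omega}$ is the representative of $\omega$ starting at $o$; $\Omega(v)$ is the set of $\omega$ with $\gamma_{o,\omega}$ passing through $v$ (a basis of the topology); $\nu$ is the probability measure with $\nu(\Omega(v))=\frac1{(q+1)q^{d(o,v)-1}}$ for $v\neq o$; $h_\omega(v)=\lim_n(n-d(\gamma_{o,\omega}(n),v))$. $\mathcal{K}(\Omega)$ is the space of continuous functions on $\Omega$ with finitely many values and $\mathcal{K}'(\Omega)$ its dual; functions $g$ on $\Omega$ are identified with $g\,d\nu$. Poisson transform: $\mathcal{P}_{q^{is}}(m)(v)=\int_\Omega q^{(\frac12+is)h_\omega(v)}\,dm(\omega)$ for $m\in\mathcal{K}'(\Omega)$; for $q^{is}\ne\pm\frac1{\sqrt q}$ every $F$ with $\frac{A}{2\sqrt q}F=\frac{q^{is}+q^{-is}}2F$ is $\mathcal{P}_{q^{is}}(m)$ for a unique $m$. The intertwining operator $\mathcal{I}_{q^{is}}:\mathcal{K}(\Omega)\to\mathcal{K}(\Omega)$,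 for $q^{is}\neq\pm\frac1{\sqrt q}$, is the operator with $\mathcal{P}_{q^{is}}(\mathcal{I}_{q^{is}}g\,d\nu)=\mathcal{P}_{q^{-is}}(g\,d\nu)$ for all $g\in\mathcal{K}(\Omega)$; for $|q^{is}|=1$ it extends to a unitary operator on $L^2(\Omega,\nu)$. $S^1$ is the unit circle, with points written $q^{is}=e^{i\theta}$ and arclength measure $d\theta$. Wave equation: $\frac{A_v}{2\sqrt q}u(v,t)=\frac{u(v,t+1)+u(v,t-1)}{2}$ for $u:\mathcal{T}\times\mathbb{Z}\to\mathbb{C}$. $\mathcal{H}$ is the Hilbert completion of the space of pairs of compactly supported functions for $[(g_1,g_2),(f_1,f_2)]=\langle(1-\frac{A^2}{4q})g_1,f_1\rangle+\langle g_2,f_2\rangle$; for $f=(f_1,f_2)$, $u^f$ is the solution with $u(v,0)=f_1(v)$, $\frac{u(v,1)-u(v,-1)}2=f_2(v)$. Put $\hat u^f(v,q^{is})=\sum_{t\in\mathbb{Z}}u^f(v,t)(q^{is})^t$ and $$[R_+f](q^{is},\cdot)=\mathcal{P}_{q^{is}}^{-1}(\hat u^f(\cdot,q^{is})),\qquad [R_-f](q^{is},\cdot)=\mathcal{P}_{q^{-is}}^{-1}(\hat u^f(\cdot,q^{is})),$$ $$T_+=\frac{q^{is}-q^{-1}q^{-is}}{1+q^{-1}}R_+,\qquad T_-=\frac{q^{-is}-q^{-1}q^{is}}{1+q^{-1}}R_-,$$ all extended by continuity to maps $\mathcal{H}\to L^2(S^1\times\Omega,d\theta\times d\nu)$. Set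 $[T_\pm^\vee f](q^{is},\omega)=[T_\pm f](q^{-is},\omega)$. $D_+$ is the space of data whose solution at each time $t\ge0$ is supported outside the ball of radius $t$ centered at $o$, and $D_-$ the space of data whose solution at each time $t\le0$ is supported outside the ball of radius $|t|+1$ centered at $o$. With $\mathcal{V}$ the unitary time-one wave propagator on $\mathcal{H}$, the outgoing (resp. incoming) translation representation is an isometry $W_+$ (resp. $W_-$) from $\mathcal{H}$ to $\ell^2(\mathbb{Z};L^2(\Omega,\nu))$ carrying $\mathcal{V}$ to the right shift and $D_+$ to sequences supported on $\mathbb{Z}_{\ge0}$ (resp. $D_-$ to sequences supported on $\mathbb{Z}_{\le-1}$). With $[Fh](e^{i\theta})=\sum_nh(n)e^{in\theta}$, one has $T_\pm^\vee=F\circ W_\pm$. The scattering operator is $W_+\circ W_-^{-1}$, and its Fourier transform is $F\circ W_+\circ W_-^{-1}\circ F^{-1}=T_+^\vee\circ(T_-^\vee)^{-1}$.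
   Formalization: The intertwining operator is I_{q^{-is}}, not the printed I_{q^{is}}: with the stated definitions the printed formula fails already for mean-zero functions on the sets Ω(v), v a neighbour of o. W_± are taken isometric only up to a constant factor, as T_±^∨ = F∘W_± forces. *)

theory Defs
  imports "HOL-Probability.Probability"
begin

section \<open>Complex square-integrable functions\<close>

definition L2_space :: "'a measure \<Rightarrow> ('a \<Rightarrow> complex) set" where
  "L2_space M = {f \<in> borel_measurable M. integrable M (\<lambda>x. (cmod (f x))\<^sup>2)}"

definition L2_norm :: "'a measure \<Rightarrow> ('a \<Rightarrow> complex) \<Rightarrow> real" where
  "L2_norm M f = sqrt (\<integral>x. (cmod (f x))\<^sup>2 \<partial>M)"

definition L2_class :: "'a measure \<Rightarrow> ('a \<Rightarrow> complex) \<Rightarrow> ('a \<Rightarrow> complex) set" where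
  "L2_class M f = {g \<in> L2_space M. AE x in M. g x = f x}"

definition L2 :: "'a measure \<Rightarrow> ('a \<Rightarrow> complex) set set" where
  "L2 M = L2_class M ` L2_space M"

definition L2_class_norm :: "'a measure \<Rightarrow> ('a \<Rightarrow> complex) set \<Rightarrow> real" where
  "L2_class_norm M y = (THE r. \<forall>g\<in>y. L2_norm M g = r)"

definition L2_tendsto :: "'a measure \<Rightarrow> (nat \<Rightarrow> 'a \<Rightarrow> complex) \<Rightarrow> ('a \<Rightarrow> complex) \<Rightarrow> bool" where
  "L2_tendsto M X g \<longleftrightarrow> (\<forall>n. X n \<in> L2_space M) \<and> g \<in> L2_space M \<and>
     (\<lambda>n. L2_norm M (\<lambda>x. X n x - g x)) \<longlonglongrightarrow> 0"

text \<open>Arclength measure on the unit circle; its space is the circle itself, not the whole plane.\<close>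
definition circle :: "complex measure" where
  "circle = distr (restrict_space lborel {0..<2 * pi}) (restrict_space borel (sphere 0 1)) cis"


section \<open>The regular tree and its boundary\<close>

type_synonym 'v bdry = "(nat \<Rightarrow> 'v) set"
type_synonym 'v data = "('v \<Rightarrow> complex) \<times> ('v \<Rightarrow> complex)"

locale regular_tree =
  fixes E :: "'v \<Rightarrow> 'v \<Rightarrow> bool" and q :: nat and org :: 'v
  assumes q_ge_2: "q \<ge> 2"
    and adj_sym: "E v w \<Longrightarrow> E w v"
    and adj_irrefl: "\<not> E v v"
    and tree_connected: "E\<^sup>*\<^sup>* v w"
    and tree_acyclic: "distinct xs \<Longrightarrow> length xs \<ge> 3 \<Longrightarrow> successively E xs \<Longrightarrow> \<not> E (last xs) (hd xs)"
    and degree: "card {w. E v w} = q + 1"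
begin

definition tdist :: "'v \<Rightarrow> 'v \<Rightarrow> nat" where
  "tdist v w = (LEAST n. (E ^^ n) v w)"

definition adj :: "('v \<Rightarrow> complex) \<Rightarrow> 'v \<Rightarrow> complex" where
  "adj f v = (\<Sum>w | E v w. f w)"

definition rays :: "(nat \<Rightarrow> 'v) set" where
  "rays = {\<gamma>. (\<forall>n. E (\<gamma> n) (\<gamma> (n + 1))) \<and> (\<forall>n. \<gamma> (n + 2) \<noteq> \<gamma> n)}"

definition end_rel :: "((nat \<Rightarrow> 'v) \<times> (nat \<Rightarrow> 'v)) set" where
  "end_rel = {(\<gamma>, \<gamma>'). \<gamma> \<in> rays \<and> \<gamma>' \<in> rays \<and> convergent (\<lambda>n. real (tdist (\<gamma> n) (\<gamma>' n)))}"

definition \<Omega> :: "'v bdry set" where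
  "\<Omega> = rays // end_rel"

definition ray :: "'v bdry \<Rightarrow> nat \<Rightarrow> 'v" where
  "ray \<omega> = (THE \<gamma>. \<gamma> \<in> \<omega> \<and> \<gamma> 0 = org)"

definition cyl :: "'v \<Rightarrow> 'v bdry set" where
  "cyl v = {\<omega> \<in> \<Omega>. \<exists>n. ray \<omega> n = v}"

definition bdry_top :: "'v bdry topology" where
  "bdry_top = topology_generated_by (range cyl)"

definition horo :: "'v bdry \<Rightarrow> 'v \<Rightarrow> int" where
  "horo \<omega> v = lim (\<lambda>n. int n - int (tdist (ray \<omega> n) v))"

text \<open>Functions on the boundary are represented by functions vanishing off \<open>\<Omega>\<close>, and functionals on
  \<open>K\<close> by maps vanishing off \<open>K\<close>, so that equality of representatives is equality of the objects.
  \<open>K_dual\<close> is the full algebraic dual.\<close>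

definition K :: "('v bdry \<Rightarrow> complex) set" where
  "K = {g. continuous_map bdry_top euclidean g \<and> finite (g ` \<Omega>) \<and> (\<forall>\<omega>. \<omega> \<notin> \<Omega> \<longrightarrow> g \<omega> = 0)}"

definition K_dual :: "(('v bdry \<Rightarrow> complex) \<Rightarrow> complex) set" where
  "K_dual = {m. (\<forall>g\<in>K. \<forall>g'\<in>K. m (\<lambda>\<omega>. g \<omega> + g' \<omega>) = m g + m g') \<and>
                (\<forall>c. \<forall>g\<in>K. m (\<lambda>\<omega>. c * g \<omega>) = c * m g) \<and> (\<forall>g. g \<notin> K \<longrightarrow> m g = 0)}"

text \<open>From here on the spectral parameter is the nonzero complex number \<open>z = q\<^bsup>is\<^esup>\<close>, so that
  \<open>q\<^bsup>-is\<^esup>\<close> is \<open>inverse z\<close> and \<open>q\<^bsup>(1/2 + is) h\<^esup> = (sqrt q * z) powi h\<close> for an integer \<open>h\<close>.\<close>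

definition poisson :: "complex \<Rightarrow> (('v bdry \<Rightarrow> complex) \<Rightarrow> complex) \<Rightarrow> 'v \<Rightarrow> complex" where
  "poisson z m v = m (\<lambda>\<omega>. if \<omega> \<in> \<Omega> then (of_real (sqrt q) * z) powi (horo \<omega> v) else 0)"

definition poisson_inv :: "complex \<Rightarrow> ('v \<Rightarrow> complex) \<Rightarrow> ('v bdry \<Rightarrow> complex) \<Rightarrow> complex" where
  "poisson_inv z F = (THE m. m \<in> K_dual \<and> poisson z m = F)"


section \<open>The wave equation\<close>

definition wave_sol :: "'v data \<Rightarrow> 'v \<Rightarrow> int \<Rightarrow> complex" where
  "wave_sol f = (THE u.
     (\<forall>v t. adj (\<lambda>w. u w t) v / of_real (2 * sqrt q) = (u v (t + 1) + u v (t - 1)) / 2) \<and>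
     (\<forall>v. u v 0 = fst f v) \<and> (\<forall>v. (u v 1 - u v (-1)) / 2 = snd f v))"

definition wave_hat :: "'v data \<Rightarrow> complex \<Rightarrow> 'v \<Rightarrow> complex" where
  "wave_hat f z v = (\<Sum>\<^sub>\<infinity>t. wave_sol f v t * z powi t)"

definition data :: "'v data set" where
  "data = {f. finite {v. fst f v \<noteq> 0} \<and> finite {v. snd f v \<noteq> 0}}"

definition energy :: "'v data \<Rightarrow> 'v data \<Rightarrow> complex" where
  "energy g f =
     (\<Sum>\<^sub>\<infinity>v. (fst g v - adj (adj (fst g)) v / of_nat (4 * q)) * cnj (fst f v)) +
     (\<Sum>\<^sub>\<infinity>v. snd g v * cnj (snd f v))"

definition energy_norm :: "'v data \<Rightarrow> real" where
  "energy_norm f = sqrt (Re (energy f f))"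

definition data_diff :: "'v data \<Rightarrow> 'v data \<Rightarrow> 'v data" where
  "data_diff f g = (\<lambda>v. fst f v - fst g v, \<lambda>v. snd f v - snd g v)"

definition cauchy_data :: "(nat \<Rightarrow> 'v data) set" where
  "cauchy_data = {X. (\<forall>n. X n \<in> data) \<and>
     (\<forall>e>0. \<exists>N. \<forall>m\<ge>N. \<forall>n\<ge>N. energy_norm (data_diff (X m) (X n)) < e)}"

definition null_rel :: "((nat \<Rightarrow> 'v data) \<times> (nat \<Rightarrow> 'v data)) set" where
  "null_rel = {(X, Y). X \<in> cauchy_data \<and> Y \<in> cauchy_data \<and>
     (\<lambda>n. energy_norm (data_diff (X n) (Y n))) \<longlonglongrightarrow> 0}"

text \<open>The completion \<open>\<H>\<close>, as Cauchy sequences modulo null sequences.\<close>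
definition \<H> :: "(nat \<Rightarrow> 'v data) set set" where
  "\<H> = cauchy_data // null_rel"

definition \<H>_norm :: "(nat \<Rightarrow> 'v data) set \<Rightarrow> real" where
  "\<H>_norm x = (THE r. \<forall>X\<in>x. (\<lambda>n. energy_norm (X n)) \<longlonglongrightarrow> r)"

definition propagate :: "'v data \<Rightarrow> 'v data" where
  "propagate f = (\<lambda>v. wave_sol f v 1, \<lambda>v. (wave_sol f v 2 - wave_sol f v 0) / 2)"

definition \<V> :: "(nat \<Rightarrow> 'v data) set \<Rightarrow> (nat \<Rightarrow> 'v data) set" where
  "\<V> x = null_rel `` ((\<lambda>X n. propagate (X n)) ` x)"

text \<open>Point evaluations of solutions are continuous in the energy norm; the solution belonging to an
  element of \<open>\<H>\<close> is therefore the pointwise limit of the solutions along a representing sequence.\<close>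

definition D_plus :: "(nat \<Rightarrow> 'v data) set set" where
  "D_plus = {x \<in> \<H>. \<forall>X\<in>x. \<forall>t\<ge>0. \<forall>v. int (tdist org v) \<le> t \<longrightarrow>
     (\<lambda>n. wave_sol (X n) v t) \<longlonglongrightarrow> 0}"

definition D_minus :: "(nat \<Rightarrow> 'v data) set set" where
  "D_minus = {x \<in> \<H>. \<forall>X\<in>x. \<forall>t\<le>0. \<forall>v. int (tdist org v) \<le> \<bar>t\<bar> + 1 \<longrightarrow>
     (\<lambda>n. wave_sol (X n) v t) \<longlonglongrightarrow> 0}"

end


section \<open>Spectral and translation representations\<close>

locale tree_boundary = regular_tree E q org
  for E :: "'v \<Rightarrow> 'v \<Rightarrow> bool" and q :: nat and org :: 'v +
  fixes \<nu> :: "'v bdry measure"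
  assumes prob: "prob_space \<nu>"
    and sets_nu: "sets \<nu> = sets (sigma \<Omega> {U. openin bdry_top U})"
    and measure_cyl: "v \<noteq> org \<Longrightarrow> measure \<nu> (cyl v) = 1 / ((q + 1) * q ^ (tdist org v - 1))"
begin

text \<open>\<open>density_fnl g\<close> is \<open>g d\<nu>\<close>, and \<open>fun_of\<close> undoes this identification.  For finitely supported data
  the functionals in question do have densities in \<open>K\<close>.\<close>

definition density_fnl :: "('v bdry \<Rightarrow> complex) \<Rightarrow> ('v bdry \<Rightarrow> complex) \<Rightarrow> complex" where
  "density_fnl g \<phi> = (if \<phi> \<in> K then \<integral>\<omega>. \<phi> \<omega> * g \<omega> \<partial>\<nu> else 0)"

definition fun_of :: "(('v bdry \<Rightarrow> complex) \<Rightarrow> complex) \<Rightarrow> 'v bdry \<Rightarrow> complex" where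
  "fun_of m = (THE g. g \<in> K \<and> density_fnl g = m)"

definition intertwiner :: "complex \<Rightarrow> ('v bdry \<Rightarrow> complex) \<Rightarrow> 'v bdry \<Rightarrow> complex" where
  "intertwiner z g =
     (THE g'. g' \<in> K \<and> poisson z (density_fnl g') = poisson (inverse z) (density_fnl g))"

text \<open>With these definitions \<open>intertwiner z\<close> is \<open>poisson z\<close> inverse after \<open>poisson (inverse z)\<close>.  On the
  circle it is unitary and \<open>intertwiner (inverse z)\<close> is its inverse.  The operator taking \<open>T_minus\<close> to
  \<open>T_plus\<close> at \<open>z\<close> is a multiple of \<open>intertwiner z\<close>; passing to \<open>T_minus_check\<close> and \<open>T_plus_check\<close>
  replaces \<open>z\<close> by \<open>inverse z\<close> throughout, in the scalar factor and in the index of the intertwiner.\<close>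

definition intertwiner_L2 :: "complex \<Rightarrow> ('v bdry \<Rightarrow> complex) set \<Rightarrow> ('v bdry \<Rightarrow> complex) set" where
  "intertwiner_L2 z y = {\<psi> \<in> L2_space \<nu>. \<forall>X. (\<forall>n. X n \<in> K) \<longrightarrow> (\<forall>\<phi>\<in>y. L2_tendsto \<nu> X \<phi>) \<longrightarrow>
     L2_tendsto \<nu> (\<lambda>n. intertwiner z (X n)) \<psi>}"

definition R_plus :: "'v data \<Rightarrow> complex \<Rightarrow> 'v bdry \<Rightarrow> complex" where
  "R_plus f z = fun_of (poisson_inv z (wave_hat f z))"

definition R_minus :: "'v data \<Rightarrow> complex \<Rightarrow> 'v bdry \<Rightarrow> complex" where
  "R_minus f z = fun_of (poisson_inv (inverse z) (wave_hat f z))"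

definition T_plus_data :: "'v data \<Rightarrow> complex \<times> 'v bdry \<Rightarrow> complex" where
  "T_plus_data f = (\<lambda>(z, \<omega>). (z - inverse z / of_nat q) / (1 + 1 / of_nat q) * R_plus f z \<omega>)"

definition T_minus_data :: "'v data \<Rightarrow> complex \<times> 'v bdry \<Rightarrow> complex" where
  "T_minus_data f = (\<lambda>(z, \<omega>). (inverse z - z / of_nat q) / (1 + 1 / of_nat q) * R_minus f z \<omega>)"

definition extend ::
  "('v data \<Rightarrow> complex \<times> 'v bdry \<Rightarrow> complex) \<Rightarrow> (nat \<Rightarrow> 'v data) set \<Rightarrow>
   (complex \<times> 'v bdry \<Rightarrow> complex) set" where
  "extend T x = {g \<in> L2_space (circle \<Otimes>\<^sub>M \<nu>). \<forall>X\<in>x. L2_tendsto (circle \<Otimes>\<^sub>M \<nu>) (\<lambda>n. T (X n)) g}"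

definition T_plus :: "(nat \<Rightarrow> 'v data) set \<Rightarrow> (complex \<times> 'v bdry \<Rightarrow> complex) set" where
  "T_plus = extend T_plus_data"

definition T_minus :: "(nat \<Rightarrow> 'v data) set \<Rightarrow> (complex \<times> 'v bdry \<Rightarrow> complex) set" where
  "T_minus = extend T_minus_data"

definition T_plus_check :: "(nat \<Rightarrow> 'v data) set \<Rightarrow> (complex \<times> 'v bdry \<Rightarrow> complex) set" where
  "T_plus_check x = (\<lambda>g (z, \<omega>). g (inverse z, \<omega>)) ` T_plus x"

definition T_minus_check :: "(nat \<Rightarrow> 'v data) set \<Rightarrow> (complex \<times> 'v bdry \<Rightarrow> complex) set" where
  "T_minus_check x = (\<lambda>g (z, \<omega>). g (inverse z, \<omega>)) ` T_minus x"

definition ell2 :: "(int \<Rightarrow> ('v bdry \<Rightarrow> complex) set) set" where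
  "ell2 = {a. (\<forall>n. a n \<in> L2 \<nu>) \<and> (\<lambda>n. (L2_class_norm \<nu> (a n))\<^sup>2) summable_on UNIV}"

definition ell2_norm :: "(int \<Rightarrow> ('v bdry \<Rightarrow> complex) set) \<Rightarrow> real" where
  "ell2_norm a = sqrt (\<Sum>\<^sub>\<infinity>n. (L2_class_norm \<nu> (a n))\<^sup>2)"

text \<open>The series converges in \<open>L\<^sup>2\<close>; \<open>r\<close> runs over the choices of representatives of the \<open>a n\<close>.\<close>
definition fourier ::
  "(int \<Rightarrow> ('v bdry \<Rightarrow> complex) set) \<Rightarrow> (complex \<times> 'v bdry \<Rightarrow> complex) set" where
  "fourier a = {k \<in> L2_space (circle \<Otimes>\<^sub>M \<nu>). \<forall>r. (\<forall>n. r n \<in> a n) \<longrightarrow>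
     L2_tendsto (circle \<Otimes>\<^sub>M \<nu>) (\<lambda>N (z, \<omega>). \<Sum>n\<in>{- int N..int N}. r n \<omega> * z powi n) k}"

text \<open>Translation representations.  The condition involving \<open>fourier\<close> fixes the unitary freedom that
  the others leave.  In the normalisations used here \<open>T_plus\<close> and \<open>T_minus\<close> multiply norms by
  \<open>sqrt (4 * pi * q / (q + 1))\<close> and \<open>fourier\<close> multiplies them by \<open>sqrt (2 * pi)\<close>; so \<open>W\<close> preserves
  norms up to a constant factor only, and a literal norm equality would be unsatisfiable.\<close>

definition outgoing_rep ::
  "((nat \<Rightarrow> 'v data) set \<Rightarrow> int \<Rightarrow> ('v bdry \<Rightarrow> complex) set) \<Rightarrow> bool" where
  "outgoing_rep W \<longleftrightarrow>
     bij_betw W \<H> ell2 \<and> (\<exists>c>0. \<forall>x\<in>\<H>. ell2_norm (W x) = c * \<H>_norm x) \<and>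
     (\<forall>x\<in>\<H>. W (\<V> x) = (\<lambda>n. W x (n - 1))) \<and>
     W ` D_plus = {a \<in> ell2. \<forall>n<0. a n = L2_class \<nu> (\<lambda>_. 0)} \<and>
     (\<forall>x\<in>\<H>. T_plus_check x = fourier (W x))"

definition incoming_rep ::
  "((nat \<Rightarrow> 'v data) set \<Rightarrow> int \<Rightarrow> ('v bdry \<Rightarrow> complex) set) \<Rightarrow> bool" where
  "incoming_rep W \<longleftrightarrow>
     bij_betw W \<H> ell2 \<and> (\<exists>c>0. \<forall>x\<in>\<H>. ell2_norm (W x) = c * \<H>_norm x) \<and>
     (\<forall>x\<in>\<H>. W (\<V> x) = (\<lambda>n. W x (n - 1))) \<and>
     W ` D_minus = {a \<in> ell2. \<forall>n>-1. a n = L2_class \<nu> (\<lambda>_. 0)} \<and>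
     (\<forall>x\<in>\<H>. T_minus_check x = fourier (W x))"

definition scattering ::
  "((nat \<Rightarrow> 'v data) set \<Rightarrow> int \<Rightarrow> ('v bdry \<Rightarrow> complex) set) \<Rightarrow>
   ((nat \<Rightarrow> 'v data) set \<Rightarrow> int \<Rightarrow> ('v bdry \<Rightarrow> complex) set) \<Rightarrow>
   (int \<Rightarrow> ('v bdry \<Rightarrow> complex) set) \<Rightarrow> int \<Rightarrow> ('v bdry \<Rightarrow> complex) set" where
  "scattering W_plus W_minus a = W_plus (the_inv_into \<H> W_minus a)"

end

end

theory Submission
  imports Defs
begin

text \<open>
  Write \<open>a = sqrt q * z\<close> and \<open>b = sqrt q * inverse z\<close> for a point \<open>z\<close> of the unit circle, so that \<open>a * b = q\<close>
  and \<open>b\<close> is the conjugate of \<open>a\<close>. The Poisson kernel with parameter \<open>a\<close> at a vertex \<open>v\<close> is \<open>a\<close> to the power of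
  the height of \<open>v\<close>. Passing from a vertex to its parent changes heights by one, with the sign telling
  whether the end lies beyond the vertex. So the indicator of a cylinder is a combination of two kernels,
  kernels span the locally constant functions, and Poisson transforms are injective (\<open>poisson_inj\<close>).

  Everything rests on one computation, \<open>kernel_pairing_eq\<close>: the integral of the product of the kernel
  with parameter \<open>a\<close> at \<open>v\<close> and the kernel with parameter \<open>b\<close> at \<open>w\<close> depends on the distance of \<open>v\<close> and \<open>w\<close>
  only. Its symmetry in \<open>v\<close> and \<open>w\<close> shows that the intertwining operator maps a combination of kernels
  with parameter \<open>a\<close> to the combination of the kernels with parameter \<open>b\<close> having the same coefficients
  (\<open>intertwiner_kernel_sum\<close>), and that it preserves norms. On the other hand, the solution of the wave
  equation with data \<open>(0, \<delta>)\<close> is a Chebyshev polynomial in the adjacency operator; its kernel is explicit,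
  its Fourier transform in time is a sum of geometric series, and up to a factor it is the pairing just
  computed (\<open>fund_hat_pairing\<close>). This inverts the Poisson transforms in the definitions of \<open>R_plus\<close> and \<open>R_minus\<close>:
  for finitely supported data they are combinations of kernels with the same coefficients and with
  parameters \<open>b\<close> and \<open>a\<close>. Hence \<open>R_plus\<close> is the intertwining operator applied to \<open>R_minus\<close>, and for \<open>T_plus\<close> and
  \<open>T_minus\<close> the quotient of the normalising factors, a number of modulus one, appears as a factor
  (\<open>T_plus_T_minus_fibre\<close>).

  To pass to the completion, \<open>T_minus\<close> has to be a multiple of an isometry with dense range. The norm of
  \<open>T_minus f\<close> is an integral over the circle of pairings of kernels, that is, of transforms of
  fundamental solutions, and the mean value property together with the wave equation turn it
  into the energy (\<open>T_minus_isometry\<close>). The range is invariant under multiplication by \<open>z\<close> and \<open>inverse z\<close>, because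
  these correspond to the wave evolution, and it contains \<open>z - inverse z\<close> times the indicator of each
  cylinder. As \<open>z - inverse z\<close> has zeros at 1 and -1 only, the closure contains all products of trigonometric
  polynomials with indicators of cylinders, hence everything (\<open>T_range_dense\<close>). The elements of the
  completion thus correspond to the classes of square-integrable functions, the value of \<open>T_minus\<close>
  being the class (\<open>H_eq\<close>, \<open>T_minus_class\<close>).

  The relation between \<open>T_plus\<close> and \<open>T_minus\<close> on fibres survives limits: along a fast subsequence,
  convergence in the mean on the product is convergence in the mean on almost every fibre, where the
  intertwining operator is isometric (\<open>scattering_fibre\<close>). Substituting \<open>inverse z\<close> for \<open>z\<close>, which preserves arclength,
  gives the multiplier of the theorem, and the identification with the Fourier transform of the
  scattering operator is formal.
\<close>

section \<open>Square-integrable functions\<close>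

lemma L2_spaceD:
  assumes "f \<in> L2_space M"
  shows "f \<in> borel_measurable M" "integrable M (\<lambda>x. (cmod (f x))\<^sup>2)"
  using assms by (auto simp: L2_space_def)

lemma L2_spaceI_bound:
  assumes "f \<in> borel_measurable M" "integrable M w" "AE x in M. (cmod (f x))\<^sup>2 \<le> w x"
  shows "f \<in> L2_space M"
  unfolding L2_space_def
proof safe
  show "integrable M (\<lambda>x. (cmod (f x))\<^sup>2)"
    by (rule Bochner_Integration.integrable_bound[OF assms(2)])
      (use assms(1,3) in \<open>auto elim: eventually_mono\<close>)
qed (rule assms)

text \<open>The weight \<open>e\<close> distributes the mixed term; with the right weight the integrated inequality is
  already the triangle inequality of the norm.\<close>
lemma cmod_add_squared_le:
  assumes "e > 0"
  shows "(cmod (a + b))\<^sup>2 \<le> (1 + e) * (cmod a)\<^sup>2 + (1 + 1 / e) * (cmod b)\<^sup>2"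
proof -
  have "2 * cmod a * cmod b \<le> e * (cmod a)\<^sup>2 + 1 / e * (cmod b)\<^sup>2"
  proof -
    have "0 \<le> (e * cmod a - cmod b)\<^sup>2 / e" using assms by simp
    also have "\<dots> = e * (cmod a)\<^sup>2 + 1 / e * (cmod b)\<^sup>2 - 2 * cmod a * cmod b"
      using assms by (simp add: power2_eq_square field_simps)
    finally show ?thesis by simp
  qed
  moreover have "(cmod (a + b))\<^sup>2 \<le> (cmod a + cmod b)\<^sup>2"
    by (intro power_mono norm_triangle_ineq) simp
  ultimately show ?thesis by (simp add: power2_sum algebra_simps)
qed

lemma L2_add:
  assumes "f \<in> L2_space M" "g \<in> L2_space M"
  shows "(\<lambda>x. f x + g x) \<in> L2_space M"
proof (rule L2_spaceI_bound)
  show "integrable M (\<lambda>x. (1 + 1) * (cmod (f x))\<^sup>2 + (1 + 1 / 1) * (cmod (g x))\<^sup>2)"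
    by (intro Bochner_Integration.integrable_add integrable_mult_right L2_spaceD assms)
  show "AE x in M. (cmod (f x + g x))\<^sup>2 \<le> (1 + 1) * (cmod (f x))\<^sup>2 + (1 + 1 / 1) * (cmod (g x))\<^sup>2"
    by (intro AE_I2 cmod_add_squared_le) simp
qed (use L2_spaceD(1)[OF assms(1)] L2_spaceD(1)[OF assms(2)] in measurable)

lemma L2_mult_bounded:
  assumes "f \<in> L2_space M" "g \<in> borel_measurable M" "\<And>x. x \<in> space M \<Longrightarrow> cmod (g x) \<le> B"
  shows "(\<lambda>x. g x * f x) \<in> L2_space M"
proof (rule L2_spaceI_bound)
  show "integrable M (\<lambda>x. B\<^sup>2 * (cmod (f x))\<^sup>2)"
    by (intro integrable_mult_right L2_spaceD assms)
  show "AE x in M. (cmod (g x * f x))\<^sup>2 \<le> B\<^sup>2 * (cmod (f x))\<^sup>2"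
    using assms(3) by (intro AE_I2) (simp add: norm_mult power_mult_distrib mult_right_mono power_mono)
qed (use L2_spaceD(1)[OF assms(1)] assms(2) in measurable)

lemma L2_cmult: "f \<in> L2_space M \<Longrightarrow> (\<lambda>x. c * f x) \<in> L2_space M"
  by (rule L2_mult_bounded[where B = "cmod c"]) auto

lemma L2_diff:
  assumes "f \<in> L2_space M" "g \<in> L2_space M"
  shows "(\<lambda>x. f x - g x) \<in> L2_space M"
  using L2_add[OF assms(1) L2_cmult[OF assms(2), of "-1"]] by simp

lemma L2_norm_nonneg [simp]: "L2_norm M f \<ge> 0" by (simp add: L2_norm_def)

lemma L2_norm_squared: "(L2_norm M f)\<^sup>2 = (\<integral>x. (cmod (f x))\<^sup>2 \<partial>M)"
  by (simp add: L2_norm_def)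

lemma L2_norm_cmult: "L2_norm M (\<lambda>x. c * f x) = cmod c * L2_norm M f"
  by (simp add: L2_norm_def norm_mult power_mult_distrib real_sqrt_mult)

lemma L2_norm_minus: "L2_norm M (\<lambda>x. f x - g x) = L2_norm M (\<lambda>x. g x - f x)"
  by (simp add: L2_norm_def norm_minus_commute)

lemma L2_norm_cong_AE:
  assumes "f \<in> borel_measurable M" "g \<in> borel_measurable M" "AE x in M. f x = g x"
  shows "L2_norm M f = L2_norm M g"
proof -
  have "(\<integral>x. (cmod (f x))\<^sup>2 \<partial>M) = (\<integral>x. (cmod (g x))\<^sup>2 \<partial>M)"
    by (rule integral_cong_AE) (use assms in auto)
  then show ?thesis by (simp add: L2_norm_def)
qed

lemma L2_norm_cong: "(\<And>x. x \<in> space M \<Longrightarrow> cmod (f x) = cmod (g x)) \<Longrightarrow> L2_norm M f = L2_norm M g"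
  unfolding L2_norm_def by (intro arg_cong[of _ _ sqrt] Bochner_Integration.integral_cong) auto

text \<open>The pointwise inequality above with the weight \<open>B / A\<close>, where \<open>A\<close> and \<open>B\<close> are the two norms, has
  the right-hand side \<open>(A + B)\<^sup>2\<close>; adding \<open>\<delta> / 2\<close> to both keeps the weight meaningful for norm zero.\<close>
lemma L2_norm_triangle:
  assumes "f \<in> L2_space M" "g \<in> L2_space M"
  shows "L2_norm M (\<lambda>x. f x + g x) \<le> L2_norm M f + L2_norm M g"
proof (rule field_le_epsilon)
  fix \<delta> :: real assume \<delta>: "\<delta> > 0"
  define A where "A = L2_norm M f + \<delta> / 2"
  define B where "B = L2_norm M g + \<delta> / 2"
  have AB: "A > 0" "B > 0" using \<delta> by (simp_all add: A_def B_def add_nonneg_pos)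
  have "(L2_norm M (\<lambda>x. f x + g x))\<^sup>2 = (\<integral>x. (cmod (f x + g x))\<^sup>2 \<partial>M)" by (rule L2_norm_squared)
  also have "\<dots> \<le> (\<integral>x. (1 + B / A) * (cmod (f x))\<^sup>2 + (1 + 1 / (B / A)) * (cmod (g x))\<^sup>2 \<partial>M)"
    by (intro integral_mono Bochner_Integration.integrable_add integrable_mult_right L2_spaceD assms
        L2_add cmod_add_squared_le) (use AB in auto)
  also have "\<dots> = (1 + B / A) * (L2_norm M f)\<^sup>2 + (1 + 1 / (B / A)) * (L2_norm M g)\<^sup>2"
    using L2_spaceD(2)[OF assms(1)] L2_spaceD(2)[OF assms(2)]
    by (subst Bochner_Integration.integral_add) (auto simp: L2_norm_squared)
  also have "\<dots> \<le> (1 + B / A) * A\<^sup>2 + (1 + 1 / (B / A)) * B\<^sup>2"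
    using AB \<delta> by (intro add_mono mult_left_mono power_mono) (auto simp: A_def B_def)
  also have "\<dots> = (A + B)\<^sup>2" using AB by (simp add: power2_eq_square field_simps)
  finally have "L2_norm M (\<lambda>x. f x + g x) \<le> A + B"
    by (rule power2_le_imp_le) (use AB in simp)
  then show "L2_norm M (\<lambda>x. f x + g x) \<le> L2_norm M f + L2_norm M g + \<delta>"
    by (simp add: A_def B_def)
qed

lemma L2_norm_triangle_diff:
  assumes "f \<in> L2_space M" "g \<in> L2_space M" "h \<in> L2_space M"
  shows "L2_norm M (\<lambda>x. f x - h x) \<le> L2_norm M (\<lambda>x. f x - g x) + L2_norm M (\<lambda>x. g x - h x)"
  using L2_norm_triangle[OF L2_diff[OF assms(1,2)] L2_diff[OF assms(2,3)]] by simp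

lemma L2_norm_eq_0D:
  assumes "f \<in> L2_space M" "L2_norm M f = 0"
  shows "AE x in M. f x = 0"
proof -
  have "(\<integral>x. (cmod (f x))\<^sup>2 \<partial>M) = 0" using assms(2) by (simp add: L2_norm_def)
  then have "AE x in M. (cmod (f x))\<^sup>2 = 0"
    using L2_spaceD(2)[OF assms(1)] by (subst (asm) integral_nonneg_eq_0_iff_AE) auto
  then show ?thesis by simp
qed

lemma L2_tendsto_unique:
  assumes "L2_tendsto M X g" "L2_tendsto M X h"
  shows "AE x in M. g x = h x"
proof -
  have m: "X n \<in> L2_space M" "g \<in> L2_space M" "h \<in> L2_space M" for n
    using assms by (auto simp: L2_tendsto_def)
  have "(\<lambda>n. L2_norm M (\<lambda>x. g x - X n x) + L2_norm M (\<lambda>x. X n x - h x)) \<longlonglongrightarrow> 0 + 0"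
    using assms unfolding L2_norm_minus[of M g] by (intro tendsto_add) (auto simp: L2_tendsto_def)
  moreover have "L2_norm M (\<lambda>x. g x - h x) \<le> L2_norm M (\<lambda>x. g x - X n x) + L2_norm M (\<lambda>x. X n x - h x)" for n
    by (rule L2_norm_triangle_diff) (rule m)+
  ultimately have "L2_norm M (\<lambda>x. g x - h x) \<le> 0"
    using LIMSEQ_le_const by (metis (lifting) add.right_neutral)
  then have "L2_norm M (\<lambda>x. g x - h x) = 0" using L2_norm_nonneg by (metis order_antisym)
  from L2_norm_eq_0D[OF L2_diff[OF m(2,3)] this] show ?thesis by simp
qed

text \<open>Two sequences whose difference tends to zero have the same limit.\<close>
lemma L2_tendsto_shadow:
  assumes "L2_tendsto M X g" "\<And>n. Y n \<in> L2_space M" "(\<lambda>n. L2_norm M (\<lambda>x. X n x - Y n x)) \<longlonglongrightarrow> 0"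
  shows "L2_tendsto M Y g"
proof -
  have m: "X n \<in> L2_space M" "g \<in> L2_space M" for n
    using assms by (auto simp: L2_tendsto_def)
  have "(\<lambda>n. L2_norm M (\<lambda>x. Y n x - X n x) + L2_norm M (\<lambda>x. X n x - g x)) \<longlonglongrightarrow> 0 + 0"
    using assms unfolding L2_norm_minus[of M "Y _"] by (intro tendsto_add) (auto simp: L2_tendsto_def)
  moreover have "L2_norm M (\<lambda>x. Y n x - g x) \<le> L2_norm M (\<lambda>x. Y n x - X n x) + L2_norm M (\<lambda>x. X n x - g x)" for n
    by (intro L2_norm_triangle_diff m assms)
  ultimately have "(\<lambda>n. L2_norm M (\<lambda>x. Y n x - g x)) \<longlonglongrightarrow> 0"
    by (intro Lim_null_comparison[of "\<lambda>n. L2_norm M (\<lambda>x. Y n x - g x)"]) auto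
  then show ?thesis using m assms by (simp add: L2_tendsto_def)
qed

lemma L2_tendsto_limit_cong:
  assumes "L2_tendsto M X g" "h \<in> L2_space M" "AE x in M. h x = g x"
  shows "L2_tendsto M X h"
proof -
  have m: "X n \<in> L2_space M" "g \<in> L2_space M" for n
    using assms by (auto simp: L2_tendsto_def)
  have "L2_norm M (\<lambda>x. X n x - h x) = L2_norm M (\<lambda>x. X n x - g x)" for n
    by (rule L2_norm_cong_AE)
      (use L2_spaceD(1)[OF m(1)] L2_spaceD(1)[OF m(2)] L2_spaceD(1)[OF assms(2)] assms(3) in
        \<open>auto elim: eventually_mono\<close>)
  then show ?thesis using assms by (simp add: L2_tendsto_def)
qed

lemma L2_tendsto_diff:
  assumes "L2_tendsto M X g" "L2_tendsto M Y g"
  shows "(\<lambda>n. L2_norm M (\<lambda>x. X n x - Y n x)) \<longlonglongrightarrow> 0"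
proof -
  have "(\<lambda>n. L2_norm M (\<lambda>x. X n x - g x) + L2_norm M (\<lambda>x. g x - Y n x)) \<longlonglongrightarrow> 0 + 0"
    using assms unfolding L2_norm_minus[of M g] by (intro tendsto_add) (auto simp: L2_tendsto_def)
  moreover have "L2_norm M (\<lambda>x. X n x - Y n x) \<le>
      L2_norm M (\<lambda>x. X n x - g x) + L2_norm M (\<lambda>x. g x - Y n x)" for n
    by (rule L2_norm_triangle_diff) (use assms in \<open>auto simp: L2_tendsto_def\<close>)
  ultimately show ?thesis
    by (intro Lim_null_comparison[of "\<lambda>n. L2_norm M (\<lambda>x. X n x - Y n x)"]) auto
qed

lemma L2_tendsto_Cauchy:
  assumes "L2_tendsto M X g" "e > 0"
  shows "\<exists>N. \<forall>m\<ge>N. \<forall>n\<ge>N. L2_norm M (\<lambda>x. X m x - X n x) < e"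
proof -
  have "(\<lambda>n. L2_norm M (\<lambda>x. X n x - g x)) \<longlonglongrightarrow> 0" using assms(1) by (simp add: L2_tendsto_def)
  then have "\<forall>\<^sub>F n in sequentially. L2_norm M (\<lambda>x. X n x - g x) < e / 2"
    by (rule order_tendstoD) (use assms(2) in simp)
  then obtain N where N: "\<And>n. n \<ge> N \<Longrightarrow> L2_norm M (\<lambda>x. X n x - g x) < e / 2"
    unfolding eventually_at_top_linorder by blast
  have "L2_norm M (\<lambda>x. X m x - X n x) < e" if mn: "m \<ge> N" "n \<ge> N" for m n
  proof -
    have "L2_norm M (\<lambda>x. X m x - X n x) \<le>
        L2_norm M (\<lambda>x. X m x - g x) + L2_norm M (\<lambda>x. g x - X n x)"
      by (rule L2_norm_triangle_diff) (use assms(1) in \<open>auto simp: L2_tendsto_def\<close>)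
    then show ?thesis using N[OF mn(1)] N[OF mn(2)] by (simp add: L2_norm_minus[of M g])
  qed
  then show ?thesis by blast
qed

lemma L2_class_eq_iff:
  assumes "f \<in> L2_space M" "g \<in> L2_space M"
  shows "L2_class M f = L2_class M g \<longleftrightarrow> (AE x in M. f x = g x)"
proof
  assume "L2_class M f = L2_class M g"
  moreover have "f \<in> L2_class M f" using assms by (simp add: L2_class_def)
  ultimately have "f \<in> L2_class M g" by simp
  then show "AE x in M. f x = g x" by (simp add: L2_class_def)
next
  assume e: "AE x in M. f x = g x"
  have "(AE x in M. k x = f x) \<longleftrightarrow> (AE x in M. k x = g x)" for k
    using e by (auto elim: eventually_elim2)
  then show "L2_class M f = L2_class M g" by (simp add: L2_class_def)
qed

lemma L2_class_self: "f \<in> L2_space M \<Longrightarrow> f \<in> L2_class M f"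
  by (simp add: L2_class_def)

text \<open>Monotone convergence: the integral of the pointwise sum is the finite sum of the integrals, and a
  function with finite integral is finite almost everywhere.\<close>
lemma AE_summable:
  fixes F :: "nat \<Rightarrow> 'a \<Rightarrow> real"
  assumes "\<And>k. integrable M (F k)" "\<And>k x. F k x \<ge> 0" "summable (\<lambda>k. \<integral>x. F k x \<partial>M)"
  shows "AE x in M. summable (\<lambda>k. F k x)"
proof -
  have [measurable]: "F k \<in> borel_measurable M" for k using assms(1) by auto
  have "(\<integral>\<^sup>+x. (\<Sum>k. ennreal (F k x)) \<partial>M) = (\<Sum>k. \<integral>\<^sup>+x. ennreal (F k x) \<partial>M)"
    by (rule nn_integral_suminf) measurable
  also have "\<dots> = (\<Sum>k. ennreal (\<integral>x. F k x \<partial>M))"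
    by (intro suminf_cong nn_integral_eq_integral assms AE_I2)
  also have "\<dots> = ennreal (\<Sum>k. \<integral>x. F k x \<partial>M)"
    by (rule suminf_ennreal2) (auto intro: assms Bochner_Integration.integral_nonneg)
  finally have "(\<integral>\<^sup>+x. (\<Sum>k. ennreal (F k x)) \<partial>M) \<noteq> \<infinity>" by simp
  then have "AE x in M. (\<Sum>k. ennreal (F k x)) \<noteq> \<infinity>"
    by (intro nn_integral_PInf_AE) measurable
  then show ?thesis
    by eventually_elim (auto intro: summable_suminf_not_top assms(2))
qed

lemma fast_subsequence:
  fixes a :: "nat \<Rightarrow> real"
  assumes "a \<longlonglongrightarrow> 0" "\<And>n. e n > 0"
  obtains r :: "nat \<Rightarrow> nat" where "strict_mono r" "\<And>k. \<bar>a (r k)\<bar> < e k"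
proof -
  have ex: "\<exists>n>m. \<bar>a n\<bar> < e k" for m k
  proof -
    have "\<forall>\<^sub>F n in sequentially. \<bar>a n\<bar> < e k"
      using assms(1) assms(2)[of k] unfolding tendsto_iff dist_real_def by simp
    then obtain N where "\<And>n. n \<ge> N \<Longrightarrow> \<bar>a n\<bar> < e k" unfolding eventually_at_top_linorder by blast
    then show ?thesis by (intro exI[of _ "max N (Suc m)"]) simp
  qed
  define r where "r = rec_nat (SOME n. \<bar>a n\<bar> < e 0) (\<lambda>k m. SOME n. n > m \<and> \<bar>a n\<bar> < e (Suc k))"
  have S: "r (Suc k) > r k \<and> \<bar>a (r (Suc k))\<bar> < e (Suc k)" for k
    using someI_ex[OF ex[of "r k" "Suc k"]] by (simp add: r_def)
  have "\<bar>a (r 0)\<bar> < e 0" using someI_ex[of "\<lambda>n. \<bar>a n\<bar> < e 0"] ex[of 0 0] by (auto simp: r_def)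
  then have "\<bar>a (r k)\<bar> < e k" for k using S by (cases k) auto
  moreover have "strict_mono r" using S by (simp add: strict_mono_Suc_iff)
  ultimately show thesis using that by blast
qed

text \<open>Along a subsequence whose increments satisfy \<open>\<parallel>d k\<parallel>\<^sup>2 < 1 / 8 ^ k\<close> the
  series of the \<open>4 ^ k |d k|\<^sup>2\<close> converges almost everywhere, hence so does the sequence; Fatou's lemma
  turns the pointwise limit into a limit in norm.\<close>
lemma L2_complete:
  assumes X: "\<And>n. X n \<in> L2_space M"
    and cauchy: "\<And>e. e > 0 \<Longrightarrow> \<exists>N. \<forall>m\<ge>N. \<forall>n\<ge>N. L2_norm M (\<lambda>x. X m x - X n x) < e"
  obtains g where "L2_tendsto M X g"
proof -
  have [measurable]: "X n \<in> borel_measurable M" for n using X by (rule L2_spaceD)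
  have "\<exists>N. \<forall>m\<ge>N. \<forall>n\<ge>N. L2_norm M (\<lambda>x. X m x - X n x) < sqrt (1 / 8 ^ k)" for k
    by (rule cauchy) simp
  then obtain N where N: "\<And>k m n. m \<ge> N k \<Longrightarrow> n \<ge> N k \<Longrightarrow> L2_norm M (\<lambda>x. X m x - X n x) < sqrt (1 / 8 ^ k)"
    by metis
  \<comment> \<open>The partial sums make \<open>r\<close> increasing and at least \<open>N\<close>; the summand \<open>k\<close> makes it unbounded.\<close>
  define r where "r k = (\<Sum>j\<le>k. N j) + k" for k
  have rN: "r k \<ge> N k" "r (Suc k) \<ge> N k" for k
  proof -
    have "N k \<le> (\<Sum>j\<le>k. N j)" by (rule member_le_sum) auto
    then show "r k \<ge> N k" "r (Suc k) \<ge> N k" by (simp_all add: r_def)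
  qed
  define d where "d k x = X (r (Suc k)) x - X (r k) x" for k x
  have dL: "d k \<in> L2_space M" for k unfolding d_def[abs_def] by (rule L2_diff[OF X X])
  have dn: "(\<integral>x. (cmod (d k x))\<^sup>2 \<partial>M) \<le> 1 / 8 ^ k" for k
  proof -
    have "L2_norm M (d k) < sqrt (1 / 8 ^ k)" unfolding d_def[abs_def] by (rule N) (rule rN)+
    then have "(L2_norm M (d k))\<^sup>2 \<le> (sqrt (1 / 8 ^ k))\<^sup>2" by (intro power_mono) auto
    then show ?thesis by (simp add: L2_norm_squared)
  qed
  have "AE x in M. summable (\<lambda>k. 4 ^ k * (cmod (d k x))\<^sup>2)"
  proof (rule AE_summable)
    show "integrable M (\<lambda>x. 4 ^ k * (cmod (d k x))\<^sup>2)" for k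
      by (intro integrable_mult_right L2_spaceD dL)
    show "summable (\<lambda>k. \<integral>x. 4 ^ k * (cmod (d k x))\<^sup>2 \<partial>M)"
    proof (rule summable_comparison_test')
      show "summable (\<lambda>k. (1 / 2 :: real) ^ k)" by (rule summable_geometric) simp
      fix k
      have "(\<integral>x. 4 ^ k * (cmod (d k x))\<^sup>2 \<partial>M) \<le> 4 ^ k * (1 / 8 ^ k)"
        using mult_left_mono[OF dn[of k], of "4 ^ k"] by simp
      also have "\<dots> = (1 / 2) ^ k" by (simp add: power_divide flip: power_mult_distrib)
        (simp add: field_simps flip: power_mult_distrib)
      finally show "norm (\<integral>x. 4 ^ k * (cmod (d k x))\<^sup>2 \<partial>M) \<le> (1 / 2) ^ k" by simp
    qed
  qed simp
  then have conv: "AE x in M. convergent (\<lambda>k. X (r k) x)"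
  proof eventually_elim
    fix x assume "summable (\<lambda>k. 4 ^ k * (cmod (d k x))\<^sup>2)"
    then have "(\<lambda>k. 4 ^ k * (cmod (d k x))\<^sup>2) \<longlonglongrightarrow> 0" by (rule summable_LIMSEQ_zero)
    then have "\<forall>\<^sub>F k in sequentially. 4 ^ k * (cmod (d k x))\<^sup>2 < 1"
      by (rule order_tendstoD) simp
    then have ev: "\<forall>\<^sub>F k in sequentially. cmod (d k x) \<le> (1 / 2) ^ k"
    proof eventually_elim
      case (elim k)
      have "(2 ^ k * cmod (d k x))\<^sup>2 = 4 ^ k * (cmod (d k x))\<^sup>2"
      proof -
        have "(2 ^ k)\<^sup>2 = (4 :: real) ^ k" by (simp add: power2_eq_square flip: power_mult_distrib)
        then show ?thesis by (simp add: power_mult_distrib)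
      qed
      then have "(2 ^ k * cmod (d k x))\<^sup>2 \<le> 1\<^sup>2" using elim by simp
      then have "2 ^ k * cmod (d k x) \<le> 1" by (rule power2_le_imp_le) simp
      then show ?case by (simp add: field_simps power_divide)
    qed
    have "summable (\<lambda>k. d k x)"
      by (rule summable_comparison_test_ev[OF ev]) (rule summable_geometric, simp)
    then have "convergent (\<lambda>n. X (r 0) x + (\<Sum>k<n. d k x))"
      unfolding summable_iff_convergent by (intro convergent_add convergent_const)
    moreover have "X (r 0) x + (\<Sum>k<n. d k x) = X (r n) x" for n
      by (induction n) (simp_all add: d_def add.assoc[symmetric])
    ultimately show "convergent (\<lambda>k. X (r k) x)" by simp
  qed
  define g where "g x = lim (\<lambda>k. X (r k) x)" for x
  have gm [measurable]: "g \<in> borel_measurable M" unfolding g_def[abs_def] by measurable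
  have lim: "AE x in M. (\<lambda>k. X (r k) x) \<longlonglongrightarrow> g x"
    using conv by eventually_elim (simp add: g_def convergent_LIMSEQ_iff)
  have fatou: "(\<integral>\<^sup>+x. ennreal ((cmod (X n x - g x))\<^sup>2) \<partial>M) \<le> ennreal (e\<^sup>2)"
    if e: "e > 0" and n: "\<And>m. m \<ge> K \<Longrightarrow> L2_norm M (\<lambda>x. X n x - X m x) < e" for e n K
  proof -
    have "(\<integral>\<^sup>+x. ennreal ((cmod (X n x - g x))\<^sup>2) \<partial>M) =
        (\<integral>\<^sup>+x. liminf (\<lambda>k. ennreal ((cmod (X n x - X (r k) x))\<^sup>2)) \<partial>M)"
    proof (rule nn_integral_cong_AE)
      show "AE x in M. ennreal ((cmod (X n x - g x))\<^sup>2) = liminf (\<lambda>k. ennreal ((cmod (X n x - X (r k) x))\<^sup>2))"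
        using lim
      proof eventually_elim
        case (elim x)
        then have "(\<lambda>k. ennreal ((cmod (X n x - X (r k) x))\<^sup>2)) \<longlonglongrightarrow> ennreal ((cmod (X n x - g x))\<^sup>2)"
          by (intro tendsto_ennrealI tendsto_intros)
        then show ?case by (rule lim_imp_Liminf[symmetric, rotated]) simp
      qed
    qed
    also have "\<dots> \<le> liminf (\<lambda>k. \<integral>\<^sup>+x. ennreal ((cmod (X n x - X (r k) x))\<^sup>2) \<partial>M)"
      by (rule nn_integral_liminf) measurable
    also have "\<dots> \<le> ennreal (e\<^sup>2)"
    proof (rule Liminf_le)
      show "\<forall>\<^sub>F k in sequentially. (\<integral>\<^sup>+x. ennreal ((cmod (X n x - X (r k) x))\<^sup>2) \<partial>M) \<le> ennreal (e\<^sup>2)"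
        unfolding eventually_at_top_linorder
      proof (intro exI[of _ K] allI impI)
        fix k assume k: "k \<ge> K"
        have "(\<integral>\<^sup>+x. ennreal ((cmod (X n x - X (r k) x))\<^sup>2) \<partial>M) = ennreal ((L2_norm M (\<lambda>x. X n x - X (r k) x))\<^sup>2)"
          unfolding L2_norm_squared
          by (intro nn_integral_eq_integral L2_spaceD L2_diff X) simp
        also have "\<dots> \<le> ennreal (e\<^sup>2)"
          using n[of "r k"] k by (intro ennreal_leI power_mono) (auto simp: r_def)
        finally show "(\<integral>\<^sup>+x. ennreal ((cmod (X n x - X (r k) x))\<^sup>2) \<partial>M) \<le> ennreal (e\<^sup>2)" .
      qed
    qed simp
    finally show ?thesis .
  qed
  have diffL: "(\<lambda>x. X n x - g x) \<in> L2_space M" if "e > 0" "\<And>m. m \<ge> K \<Longrightarrow> L2_norm M (\<lambda>x. X n x - X m x) < e" for e n K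
  proof -
    have "(\<integral>\<^sup>+x. ennreal ((cmod (X n x - g x))\<^sup>2) \<partial>M) < \<infinity>"
    proof (rule le_less_trans)
      show "(\<integral>\<^sup>+x. ennreal ((cmod (X n x - g x))\<^sup>2) \<partial>M) \<le> ennreal (e\<^sup>2)"
        by (rule fatou[of e K n]) (use that in auto)
    qed simp
    then have "integrable M (\<lambda>x. (cmod (X n x - g x))\<^sup>2)"
      by (intro integrableI_nonneg) auto
    then show ?thesis by (simp add: L2_space_def)
  qed
  obtain N0 where N0: "\<forall>m\<ge>N0. \<forall>n\<ge>N0. L2_norm M (\<lambda>x. X m x - X n x) < 1" using cauchy[of 1] by auto
  have "(\<lambda>x. X N0 x - g x) \<in> L2_space M" by (rule diffL[of 1 N0]) (use N0 in auto)
  from L2_diff[OF X[of N0] this] have gL: "g \<in> L2_space M" by simp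
  have "(\<lambda>n. L2_norm M (\<lambda>x. X n x - g x)) \<longlonglongrightarrow> 0"
  proof (rule LIMSEQ_I)
    fix e :: real assume e: "e > 0"
    obtain K where K: "\<And>m n. m \<ge> K \<Longrightarrow> n \<ge> K \<Longrightarrow> L2_norm M (\<lambda>x. X m x - X n x) < e / 2"
      using cauchy[of "e / 2"] e by auto
    have "norm (L2_norm M (\<lambda>x. X n x - g x) - 0) < e" if n: "n \<ge> K" for n
    proof -
      have "(\<integral>\<^sup>+x. ennreal ((cmod (X n x - g x))\<^sup>2) \<partial>M) \<le> ennreal ((e / 2)\<^sup>2)"
        by (rule fatou) (use e K n in auto)
      moreover have "(\<integral>\<^sup>+x. ennreal ((cmod (X n x - g x))\<^sup>2) \<partial>M) = ennreal ((L2_norm M (\<lambda>x. X n x - g x))\<^sup>2)"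
        unfolding L2_norm_squared by (intro nn_integral_eq_integral L2_spaceD L2_diff X gL) simp
      ultimately have "(L2_norm M (\<lambda>x. X n x - g x))\<^sup>2 \<le> (e / 2)\<^sup>2" by (simp add: ennreal_le_iff)
      then have "L2_norm M (\<lambda>x. X n x - g x) \<le> e / 2" by (rule power2_le_imp_le) (use e in simp)
      then show ?thesis using e by simp
    qed
    then show "\<exists>no. \<forall>n\<ge>no. norm (L2_norm M (\<lambda>x. X n x - g x) - 0) < e" by blast
  qed
  then show thesis using that X gL by (simp add: L2_tendsto_def)
qed


section \<open>Density in spaces of square-integrable functions\<close>

definition L2_closure :: "'a measure \<Rightarrow> ('a \<Rightarrow> complex) set \<Rightarrow> ('a \<Rightarrow> complex) set" where
  "L2_closure M V = {g \<in> L2_space M. \<forall>e>0. \<exists>f\<in>V. L2_norm M (\<lambda>x. f x - g x) < e}"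

locale L2_subspace =
  fixes M :: "'a measure" and V :: "('a \<Rightarrow> complex) set"
  assumes V_L2: "V \<subseteq> L2_space M"
    and V_add: "f \<in> V \<Longrightarrow> g \<in> V \<Longrightarrow> (\<lambda>x. f x + g x) \<in> V"
    and V_scale: "f \<in> V \<Longrightarrow> (\<lambda>x. c * f x) \<in> V"
    and V_zero: "(\<lambda>_. 0) \<in> V"
begin

abbreviation cl where "cl \<equiv> L2_closure M V"

lemma cl_L2: "g \<in> cl \<Longrightarrow> g \<in> L2_space M" by (simp add: L2_closure_def)

lemma V_cl: "f \<in> V \<Longrightarrow> f \<in> cl"
  using V_L2 by (auto simp: L2_closure_def L2_norm_def intro!: bexI[of _ f])

lemma cl_limit:
  assumes "g \<in> L2_space M" "\<And>e. e > 0 \<Longrightarrow> \<exists>f\<in>cl. L2_norm M (\<lambda>x. f x - g x) < e"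
  shows "g \<in> cl"
  unfolding L2_closure_def
proof (safe intro!: assms)
  fix e :: real assume "e > 0"
  then obtain f where f: "f \<in> cl" "L2_norm M (\<lambda>x. f x - g x) < e / 2" using assms(2)[of "e / 2"] by auto
  then obtain k where k: "k \<in> V" "L2_norm M (\<lambda>x. k x - f x) < e / 2"
    using \<open>e > 0\<close> unfolding L2_closure_def by (auto dest!: spec[of _ "e / 2"])
  have "L2_norm M (\<lambda>x. k x - g x) \<le> L2_norm M (\<lambda>x. k x - f x) + L2_norm M (\<lambda>x. f x - g x)"
    by (rule L2_norm_triangle_diff) (use k V_L2 f cl_L2 assms in auto)
  then show "\<exists>f\<in>V. L2_norm M (\<lambda>x. f x - g x) < e" using k f by (intro bexI[of _ k]) auto
qed

lemma cl_limit_seq: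
  assumes "g \<in> L2_space M" "\<And>n. f n \<in> cl" "(\<lambda>n. L2_norm M (\<lambda>x. f n x - g x)) \<longlonglongrightarrow> 0"
  shows "g \<in> cl"
proof (rule cl_limit[OF assms(1)])
  fix e :: real assume "e > 0"
  then obtain n where "L2_norm M (\<lambda>x. f n x - g x) < e"
    using order_tendstoD(2)[OF assms(3)] eventually_happens'[OF sequentially_bot] by blast
  then show "\<exists>f\<in>cl. L2_norm M (\<lambda>x. f x - g x) < e" using assms(2) by blast
qed

text \<open>The form in which approximation is used: dominated pointwise limits stay in the closure.\<close>
lemma cl_dominated:
  assumes "\<And>n. f n \<in> cl" "g \<in> borel_measurable M" "integrable M (\<lambda>x. (w x)\<^sup>2)"
    "\<And>n x. x \<in> space M \<Longrightarrow> cmod (f n x) \<le> w x" "\<And>x. x \<in> space M \<Longrightarrow> (\<lambda>n. f n x) \<longlonglongrightarrow> g x"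
  shows "g \<in> cl"
proof (rule cl_limit_seq)
  have [measurable]: "f n \<in> borel_measurable M" for n using assms(1) cl_L2 L2_spaceD(1) by blast
  note [measurable] = assms(2)
  have gw: "cmod (g x) \<le> w x" if "x \<in> space M" for x
    by (rule LIMSEQ_le_const2[OF tendsto_norm[OF assms(5)[OF that]]]) (use assms(4) that in blast)
  show "g \<in> L2_space M"
    by (rule L2_spaceI_bound[OF assms(2,3)]) (use gw in \<open>auto intro!: power_mono\<close>)
  have "(\<lambda>n. \<integral>x. (cmod (f n x - g x))\<^sup>2 \<partial>M) \<longlonglongrightarrow> (\<integral>x. 0 \<partial>M)"
  proof (rule integral_dominated_convergence[where w = "\<lambda>x. 4 * (w x)\<^sup>2"])
    show "integrable M (\<lambda>x. 4 * (w x)\<^sup>2)" using assms(3) by simp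
    show "AE x in M. (\<lambda>n. (cmod (f n x - g x))\<^sup>2) \<longlonglongrightarrow> 0"
    proof (rule AE_I2)
      fix x assume "x \<in> space M"
      then have "(\<lambda>n. (cmod (f n x - g x))\<^sup>2) \<longlonglongrightarrow> (cmod (g x - g x))\<^sup>2"
        by (intro tendsto_intros assms(5))
      then show "(\<lambda>n. (cmod (f n x - g x))\<^sup>2) \<longlonglongrightarrow> 0" by simp
    qed
    show "AE x in M. norm ((cmod (f n x - g x))\<^sup>2) \<le> 4 * (w x)\<^sup>2" for n
    proof (rule AE_I2)
      fix x assume x: "x \<in> space M"
      have "cmod (f n x - g x) \<le> 2 * w x"
        using norm_triangle_ineq4[of "f n x" "g x"] assms(4)[OF x, of n] gw[OF x] by simp
      then have "(cmod (f n x - g x))\<^sup>2 \<le> (2 * w x)\<^sup>2" by (intro power_mono) auto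
      then show "norm ((cmod (f n x - g x))\<^sup>2) \<le> 4 * (w x)\<^sup>2" by (simp add: power_mult_distrib)
    qed
  qed measurable
  then have "(\<lambda>n. sqrt (\<integral>x. (cmod (f n x - g x))\<^sup>2 \<partial>M)) \<longlonglongrightarrow> sqrt 0"
    by (intro tendsto_real_sqrt) simp
  then show "(\<lambda>n. L2_norm M (\<lambda>x. f n x - g x)) \<longlonglongrightarrow> 0" by (simp add: L2_norm_def)
qed (rule assms)

lemma cl_zero: "(\<lambda>_. 0) \<in> cl" by (rule V_cl[OF V_zero])

lemma cl_scale:
  assumes "g \<in> cl"
  shows "(\<lambda>x. c * g x) \<in> cl"
  unfolding L2_closure_def
proof (safe intro!: L2_cmult cl_L2[OF assms])
  fix e :: real assume e: "e > 0"
  \<comment> \<open>The summand 1 covers the scalar \<open>c = 0\<close>.\<close>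
  have "e / (cmod c + 1) > 0" using e by (simp add: add_nonneg_pos)
  then obtain f where f: "f \<in> V" "L2_norm M (\<lambda>x. f x - g x) < e / (cmod c + 1)"
    using assms unfolding L2_closure_def by blast
  have "L2_norm M (\<lambda>x. c * f x - c * g x) = cmod c * L2_norm M (\<lambda>x. f x - g x)"
    by (simp add: L2_norm_cmult flip: right_diff_distrib)
  also have "\<dots> \<le> (cmod c + 1) * L2_norm M (\<lambda>x. f x - g x)" by (simp add: mult_right_mono)
  also have "\<dots> < e"
  proof -
    have "cmod c + 1 > 0" by (simp add: add_nonneg_pos)
    then show ?thesis using f(2) by (simp add: field_simps)
  qed
  finally show "\<exists>f\<in>V. L2_norm M (\<lambda>x. f x - c * g x) < e" by (rule bexI[OF _ V_scale[OF f(1)]])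
qed

lemma cl_add:
  assumes "g \<in> cl" "h \<in> cl"
  shows "(\<lambda>x. g x + h x) \<in> cl"
  unfolding L2_closure_def
proof (safe intro!: L2_add cl_L2[OF assms(1)] cl_L2[OF assms(2)])
  fix e :: real assume e: "e > 0"
  obtain f where f: "f \<in> V" "L2_norm M (\<lambda>x. f x - g x) < e / 2"
    using assms(1) e unfolding L2_closure_def by (auto dest!: spec[of _ "e / 2"])
  obtain k where k: "k \<in> V" "L2_norm M (\<lambda>x. k x - h x) < e / 2"
    using assms(2) e unfolding L2_closure_def by (auto dest!: spec[of _ "e / 2"])
  have "L2_norm M (\<lambda>x. (f x - g x) + (k x - h x)) \<le> L2_norm M (\<lambda>x. f x - g x) + L2_norm M (\<lambda>x. k x - h x)"
    by (intro L2_norm_triangle L2_diff) (use f k V_L2 cl_L2 assms in auto)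
  then have "L2_norm M (\<lambda>x. (f x + k x) - (g x + h x)) < e"
    using f k by (simp add: algebra_simps)
  then show "\<exists>f\<in>V. L2_norm M (\<lambda>x. f x - (g x + h x)) < e"
    using V_add[OF f(1) k(1)] by (intro bexI[of _ "\<lambda>x. f x + k x"])
qed

lemma cl_diff: "g \<in> cl \<Longrightarrow> h \<in> cl \<Longrightarrow> (\<lambda>x. g x - h x) \<in> cl"
  using cl_add[of g "\<lambda>x. (-1) * h x"] cl_scale[of h "-1"] by simp

lemma cl_sum: "(\<And>i. i \<in> S \<Longrightarrow> f i \<in> cl) \<Longrightarrow> (\<lambda>x. \<Sum>i\<in>S. f i x) \<in> cl"
  by (induction S rule: infinite_finite_induct) (auto intro: cl_zero cl_add)

lemma cl_cong:
  assumes "g \<in> cl" "\<And>x. x \<in> space M \<Longrightarrow> h x = g x"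
  shows "h \<in> cl"
proof -
  have "h \<in> borel_measurable M \<longleftrightarrow> g \<in> borel_measurable M" using assms(2) by (intro measurable_cong)
  moreover have "integrable M (\<lambda>x. (cmod (h x))\<^sup>2) \<longleftrightarrow> integrable M (\<lambda>x. (cmod (g x))\<^sup>2)"
    using assms(2) by (intro Bochner_Integration.integrable_cong) auto
  moreover have "L2_norm M (\<lambda>x. f x - h x) = L2_norm M (\<lambda>x. f x - g x)" for f
    using assms(2) by (intro L2_norm_cong) simp
  ultimately show ?thesis using assms(1) by (simp add: L2_closure_def L2_space_def)
qed

text \<open>The sets whose indicators can be approximated form a Dynkin system, hence all measurable sets
  qualify once an intersection-stable generator does; simple functions are dense.\<close>
lemma cl_eq_L2:
  assumes "finite_measure M" "Int_stable G" "G \<subseteq> Pow (space M)" "sets M = sigma_sets (space M) G"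
    and ind: "\<And>A. A \<in> G \<Longrightarrow> indicator A \<in> cl" "indicator (space M) \<in> cl"
  shows "L2_space M \<subseteq> cl"
proof -
  interpret finite_measure M by fact
  have setsG: "A \<in> sigma_sets (space M) G \<Longrightarrow> A \<in> sets M" for A using assms(4) by simp
  have sets: "indicator A \<in> cl" if "A \<in> sets M" for A
    using assms(2,3) that[unfolded assms(4)]
  proof (induction A rule: sigma_sets_induct_disjoint)
    case empty
    have "indicator {} = (\<lambda>_. 0 :: complex)" by auto
    then show ?case using cl_zero by simp
  next
    case (compl A)
    have "(\<lambda>x. indicator (space M) x - indicator A x) \<in> cl" using ind compl by (intro cl_diff)
    then show ?case
      by (rule cl_cong) (use sets.sets_into_space[OF setsG[OF compl(1)]] in \<open>auto simp: indicator_def\<close>)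
  next
    case (union A)
    have [measurable]: "A i \<in> sets M" for i using union setsG by blast
    show ?case
    proof (rule cl_dominated[where f = "\<lambda>n x. \<Sum>i<n. indicator (A i) x" and w = "\<lambda>_. 1"])
      show "(\<lambda>x. \<Sum>i<n. indicator (A i) x) \<in> cl" for n using union by (intro cl_sum)
      have U: "(\<Sum>i<n. indicator (A i) x) = (indicator (\<Union>i<n. A i) x :: complex)" for n x
        using union(1) by (subst indicator_UN_disjoint) (auto simp: disjoint_family_on_def)
      show "cmod (\<Sum>i<n. indicator (A i) x) \<le> 1" for n x unfolding U by (simp add: indicator_def)
      show "(\<lambda>n. \<Sum>i<n. indicator (A i) x :: complex) \<longlonglongrightarrow> indicator (\<Union>i. A i) x" for x
        using LIMSEQ_indicator_UN[of A x, where 'a = complex] by (simp only: U)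
    qed auto
  qed (rule ind)
  show ?thesis
  proof
    fix g assume g: "g \<in> L2_space M"
    then have [measurable]: "g \<in> borel_measurable M" by (rule L2_spaceD)
    obtain F where F: "\<And>i. simple_function M (F i)" "\<And>x. x \<in> space M \<Longrightarrow> (\<lambda>i. F i x) \<longlonglongrightarrow> g x"
      "\<And>i x. x \<in> space M \<Longrightarrow> dist (F i x) 0 \<le> 2 * dist (g x) 0"
      using borel_measurable_implies_sequence_metric[of g M 0, OF \<open>g \<in> borel_measurable M\<close>] by metis
    show "g \<in> cl"
    proof (rule cl_dominated[where f = F and w = "\<lambda>x. 2 * cmod (g x)"])
      show "F i \<in> cl" for i
      proof (rule cl_cong)
        have fin: "finite (F i ` space M)" using F(1) by (rule simple_functionD)
        show "(\<lambda>x. \<Sum>y\<in>F i ` space M. y * indicator (F i -` {y} \<inter> space M) x) \<in> cl"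
          using simple_functionD(2)[OF F(1)] by (intro cl_sum cl_scale sets)
        show "F i x = (\<Sum>y\<in>F i ` space M. y * indicator (F i -` {y} \<inter> space M) x)" if "x \<in> space M" for x
        proof -
          have "(\<Sum>y\<in>F i ` space M. y * indicator (F i -` {y} \<inter> space M) x) =
              (\<Sum>y\<in>F i ` space M. if y = F i x then y else 0)"
            using that by (intro sum.cong) (auto simp: indicator_def)
          then show ?thesis using fin that by simp
        qed
      qed
      show "integrable M (\<lambda>x. (2 * cmod (g x))\<^sup>2)"
        using L2_spaceD(2)[OF g] by (simp add: power_mult_distrib)
    qed (use F in \<open>auto simp: dist_norm\<close>)
  qed
qed

end


section \<open>Arclength measure on the circle\<close>

lemma sphere_sets [measurable]: "sphere 0 1 \<in> sets (borel :: complex measure)"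
  by (rule borel_closed) simp

lemma space_circle [simp]: "space circle = sphere 0 1"
  by (simp add: circle_def space_restrict_space)

lemma sets_circle [measurable_cong]: "sets circle = sets (restrict_space borel (sphere 0 1))"
  by (simp add: circle_def)

lemma cis_measurable [measurable]:
  "cis \<in> measurable (restrict_space lborel {0..<2 * pi}) (restrict_space borel (sphere 0 1))"
proof (rule measurable_restrict_space2)
  have "cis \<in> borel_measurable borel" by (intro borel_measurable_continuous_onI continuous_intros)
  then have "cis \<in> borel_measurable lborel" by simp
  then show "cis \<in> borel_measurable (restrict_space lborel {0..<2 * pi})"
    by (rule measurable_restrict_space1)
qed auto

lemma measurable_circle_iff: "f \<in> measurable circle N \<longleftrightarrow> f \<in> measurable (restrict_space borel (sphere 0 1)) N"
  and measurable_circle_iff2: "g \<in> measurable N circle \<longleftrightarrow> g \<in> measurable N (restrict_space borel (sphere 0 1))"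
  using measurable_cong_sets[OF sets_circle refl, of N] measurable_cong_sets[OF refl sets_circle, of N]
  by blast+

lemma circle_measurable_borel: "f \<in> borel_measurable borel \<Longrightarrow> f \<in> borel_measurable circle"
  unfolding measurable_circle_iff by (rule measurable_restrict_space1)

lemma inverse_measurable_circle [measurable]: "inverse \<in> measurable circle circle"
proof -
  have "(inverse :: complex \<Rightarrow> complex) \<in> borel_measurable borel" by measurable
  then have "(inverse :: complex \<Rightarrow> complex) \<in> borel_measurable circle" by (rule circle_measurable_borel)
  then have "inverse \<in> measurable circle (restrict_space borel (sphere 0 1))"
    by (intro measurable_restrict_space2) (auto simp: norm_inverse)
  then show ?thesis by (simp only: measurable_circle_iff2)
qed

lemma emeasure_circle_space: "emeasure circle (space circle) = ennreal (2 * pi)"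
proof -
  have "emeasure circle (space circle) = emeasure (restrict_space lborel {0..<2 * pi}) ({0..<2 * pi})"
    unfolding circle_def
  proof (subst emeasure_distr[OF cis_measurable])
    have "sphere 0 1 = space (restrict_space borel (sphere 0 1 :: complex set))"
      by (simp add: space_restrict_space)
    then show "space (distr (restrict_space lborel {0..<2 * pi}) (restrict_space borel (sphere 0 1)) cis)
        \<in> sets (restrict_space borel (sphere 0 1))" by (metis sets.top space_distr)
  qed (auto simp: space_restrict_space intro!: arg_cong2[of _ _ _ _ emeasure])
  also have "\<dots> = ennreal (2 * pi)" by (subst emeasure_restrict_space) auto
  finally show ?thesis .
qed

interpretation circle: finite_measure circle
  by standard (use emeasure_circle_space in simp)

lemma nn_integral_circle:
  assumes [measurable]: "F \<in> borel_measurable circle"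
  shows "(\<integral>\<^sup>+z. F z \<partial>circle) = (\<integral>\<^sup>+\<theta>. F (cis \<theta>) * indicator {0..<2 * pi} \<theta> \<partial>lborel)"
proof -
  have "F \<in> borel_measurable (restrict_space borel (sphere 0 1))"
    using assms by (simp only: measurable_circle_iff)
  then show ?thesis
    unfolding circle_def
    by (subst nn_integral_distr[OF cis_measurable]) (auto simp: nn_integral_restrict_space)
qed

lemma integral_circle:
  fixes F :: "complex \<Rightarrow> complex"
  assumes "F \<in> borel_measurable circle"
  shows "(\<integral>z. F z \<partial>circle) = (\<integral>\<theta>. indicator {0..<2 * pi} \<theta> *\<^sub>R F (cis \<theta>) \<partial>lborel)"
proof -
  have "F \<in> borel_measurable (restrict_space borel (sphere 0 1))"
    using assms by (simp only: measurable_circle_iff)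
  then show ?thesis
    unfolding circle_def
    by (subst integral_distr[OF cis_measurable]) (auto simp: integral_restrict_space)
qed

text \<open>In the angle, inversion is the reflection \<open>\<theta> \<mapsto> 2 * pi - \<theta>\<close> of \<open>{0..<2 * pi}\<close>; the two intervals
  differ in an end point only.\<close>
lemma distr_circle_inverse: "distr circle circle inverse = circle"
proof (rule measure_eqI)
  fix A assume "A \<in> sets (distr circle circle inverse)"
  then have A [measurable]: "A \<in> sets circle" by simp
  then obtain B where B: "B \<in> sets borel" "A = sphere 0 1 \<inter> B"
    by (auto simp: sets_circle sets_restrict_space)
  have As: "A \<in> sets borel" using B by simp
  define f where "f \<theta> = indicator A (cis (- \<theta>)) * (indicator {0..<2 * pi} \<theta> :: ennreal)" for \<theta> :: real
  have cis_b [measurable]: "cis \<in> borel_measurable borel"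
    by (intro borel_measurable_continuous_onI continuous_intros)
  have f [measurable]: "f \<in> borel_measurable borel" unfolding f_def[abs_def] using As by measurable
  have "emeasure (distr circle circle inverse) A = (\<integral>\<^sup>+z. indicator A (inverse z) \<partial>circle)"
    by (subst nn_integral_indicator[symmetric], simp, subst nn_integral_distr) auto
  also have "\<dots> = (\<integral>\<^sup>+\<theta>. f \<theta> \<partial>lborel)"
    by (subst nn_integral_circle) (simp_all add: f_def[abs_def] cis_inverse)
  also have "\<dots> = (\<integral>\<^sup>+\<theta>. f (2 * pi + (-1) * \<theta>) \<partial>lborel)"
    by (subst nn_integral_real_affine[OF f, of "-1" "2 * pi"]) auto
  also have "\<dots> = (\<integral>\<^sup>+\<theta>. indicator A (cis \<theta>) * indicator {0..<2 * pi} \<theta> \<partial>lborel)"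
  proof (rule nn_integral_cong_AE)
    have "AE \<theta> in lborel. \<theta> \<noteq> (0 :: real)" "AE \<theta> in lborel. \<theta> \<noteq> 2 * pi"
      by (rule AE_lborel_singleton)+
    then show "AE \<theta> in lborel. f (2 * pi + (-1) * \<theta>) = indicator A (cis \<theta>) * indicator {0..<2 * pi} \<theta>"
    proof eventually_elim
      case (elim \<theta>)
      have "cis (- (2 * pi + (-1) * \<theta>)) = cis \<theta>"
      proof -
        have "- (2 * pi + (-1) * \<theta>) = \<theta> - 2 * pi" by simp
        then have "cis (- (2 * pi + (-1) * \<theta>)) = cis \<theta> / cis (2 * pi)" by (simp only: cis_divide)
        then show ?thesis by (simp only: cis_2pi div_by_1)
      qed
      then show ?case using elim by (auto simp: f_def indicator_def)
    qed
  qed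
  also have "\<dots> = emeasure circle A"
    by (subst nn_integral_circle[symmetric]) auto
  finally show "emeasure (distr circle circle inverse) A = emeasure circle A" .
qed simp

lemma integral_circle_inverse:
  fixes F :: "complex \<Rightarrow> complex"
  assumes "F \<in> borel_measurable circle"
  shows "(\<integral>z. F (inverse z) \<partial>circle) = (\<integral>z. F z \<partial>circle)"
  using integral_distr[OF inverse_measurable_circle assms] distr_circle_inverse by simp

lemma circle_continuous_measurable:
  fixes F :: "complex \<Rightarrow> 'b :: topological_space"
  shows "continuous_on (sphere 0 1) F \<Longrightarrow> F \<in> borel_measurable circle"
  using borel_measurable_continuous_on_restrict[of "sphere 0 1" F]
  by (simp only: measurable_circle_iff)

lemma circle_continuous_integrable:
  fixes F :: "complex \<Rightarrow> complex"
  assumes "continuous_on (sphere 0 1) F"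
  shows "integrable circle F"
proof -
  have "compact (F ` sphere 0 1)" using assms by (intro compact_continuous_image) auto
  then obtain B where "\<And>z. z \<in> sphere 0 1 \<Longrightarrow> cmod (F z) \<le> B"
    using compact_imp_bounded bounded_iff by (metis (no_types, lifting) image_eqI)
  then show ?thesis
    using circle_continuous_measurable[OF assms]
    by (intro circle.integrable_const_bound[of _ B]) auto
qed

text \<open>The primitive \<open>exp (c * \<theta>) / c\<close>, with \<open>c = \<i> * n\<close>, has period \<open>2 * pi\<close>.\<close>
lemma integral_circle_power:
  assumes "n > 0"
  shows "(\<integral>z. z ^ n \<partial>circle) = 0"
proof -
  define c where "c = \<i> * of_nat n"
  have c: "c \<noteq> 0" using assms by (simp add: c_def)
  have cis_n: "cis \<theta> ^ n = exp (c * of_real \<theta>)" for \<theta>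
    by (simp add: cis_conv_exp c_def ac_simps flip: exp_of_nat_mult)
  have "(\<integral>\<theta>. indicator {0..2 * pi} \<theta> *\<^sub>R exp (c * of_real \<theta>) \<partial>lborel) =
      exp (c * of_real (2 * pi)) / c - exp (c * of_real 0) / c"
  proof (rule integral_FTC_Icc)
    show "((\<lambda>\<theta>. exp (c * of_real \<theta>) / c) has_vector_derivative exp (c * of_real x)) (at x within {0..2 * pi})" for x
    proof -
      have "((\<lambda>w. exp (c * w) / c) has_field_derivative exp (c * of_real x)) (at (of_real x))"
        using c by (auto intro!: derivative_eq_intros)
      from has_vector_derivative_real_field[OF this] show ?thesis by simp
    qed
    show "continuous_on {0..2 * pi} (\<lambda>\<theta>. exp (c * of_real \<theta>))" by (intro continuous_intros)
  qed simp
  also have "exp (c * of_real (2 * pi)) = cis (2 * pi) ^ n" by (simp only: cis_n)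
  finally have z: "(\<integral>\<theta>. indicator {0..2 * pi} \<theta> *\<^sub>R cis \<theta> ^ n \<partial>lborel) = 0"
    by (simp add: cis_n)
  have m [measurable]: "(\<lambda>\<theta>. cis \<theta> ^ n) \<in> borel_measurable borel"
    by (intro borel_measurable_continuous_onI continuous_intros)
  have "(\<integral>z. z ^ n \<partial>circle) = (\<integral>\<theta>. indicator {0..<2 * pi} \<theta> *\<^sub>R cis \<theta> ^ n \<partial>lborel)"
    by (rule integral_circle) (intro circle_continuous_measurable continuous_intros)
  also have "\<dots> = (\<integral>\<theta>. indicator {0..2 * pi} \<theta> *\<^sub>R cis \<theta> ^ n \<partial>lborel)"
  proof (rule integral_cong_AE)
    show "AE \<theta> in lborel. indicator {0..<2 * pi} \<theta> *\<^sub>R cis \<theta> ^ n = indicator {0..2 * pi} \<theta> *\<^sub>R cis \<theta> ^ n"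
      using AE_lborel_singleton[of "2 * pi"] by eventually_elim (auto simp: indicator_def)
  qed measurable
  finally show ?thesis using z by simp
qed

lemma integral_circle_powi:
  "(\<integral>z. z powi n \<partial>circle) = (if n = 0 then of_real (2 * pi) else 0)"
proof -
  have one: "(\<integral>z. 1 \<partial>circle) = complex_of_real (2 * pi)"
    using emeasure_circle_space by (simp add: measure_def scaleR_conv_of_real)
  consider "n = 0" | k where "n = int k" "k > 0" | k where "n = - int k" "k > 0"
    by (metis int_cases2 gr0I minus_zero of_nat_0)
  then show ?thesis
  proof cases
    case 1
    then show ?thesis using one by simp
  next
    case (2 k)
    then show ?thesis using integral_circle_power[of k] by simp
  next
    case (3 k)
    have "(\<integral>z. inverse z ^ k \<partial>circle) = (\<integral>z. z ^ k \<partial>circle)"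
      by (intro integral_circle_inverse circle_continuous_measurable continuous_intros)
    moreover have "z powi n = inverse z ^ k" for z :: complex
      unfolding 3 by (simp add: power_int_minus power_inverse)
    ultimately show ?thesis using integral_circle_power[of k] 3 by simp
  qed
qed


section \<open>Geodesics in the tree\<close>

context regular_tree
begin

definition nonbacktracking :: "'v list \<Rightarrow> bool" where
  "nonbacktracking xs \<longleftrightarrow> (\<forall>i. Suc i < length xs \<longrightarrow> E (xs ! i) (xs ! Suc i)) \<and>
     (\<forall>i. Suc (Suc i) < length xs \<longrightarrow> xs ! i \<noteq> xs ! Suc (Suc i))"

text \<open>A repetition \<open>xs ! i = xs ! (i + d)\<close> with the smallest possible \<open>d\<close> encloses pairwise distinct
  vertices. Here \<open>d\<close> is not 1, since there are no loops, and not 2, since the path does not backtrack;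
  so it closes a circuit.\<close>
lemma nonbacktracking_distinct:
  assumes "nonbacktracking xs"
  shows "distinct xs"
proof (rule ccontr)
  assume "\<not> distinct xs"
  then obtain i0 j0 where "i0 < j0" "j0 < length xs" "xs ! i0 = xs ! j0"
    by (metis distinct_conv_nth linorder_neqE_nat)
  then have ex: "\<exists>d i. d > 0 \<and> i + d < length xs \<and> xs ! i = xs ! (i + d)"
    by (intro exI[of _ "j0 - i0"] exI[of _ i0]) auto
  define d where "d = (LEAST d. \<exists>i. d > 0 \<and> i + d < length xs \<and> xs ! i = xs ! (i + d))"
  obtain i where i: "d > 0" "i + d < length xs" "xs ! i = xs ! (i + d)"
    using LeastI_ex[OF ex] unfolding d_def by auto
  have least: "xs ! k \<noteq> xs ! (k + e)" if "e > 0" "e < d" "k + e < length xs" for e k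
    using not_less_Least[of e "\<lambda>d. \<exists>i. d > 0 \<and> i + d < length xs \<and> xs ! i = xs ! (i + d)"] that
    unfolding d_def by blast
  define ys where "ys = take d (drop i xs)"
  have nth: "ys ! k = xs ! (i + k)" if "k < d" for k
    using i that by (auto simp: ys_def)
  have len: "length ys = d" using i by (simp add: ys_def)
  have dist: "distinct ys"
  proof -
    have "ys ! k \<noteq> ys ! l" if "k < l" "l < d" for k l
      using least[of "l - k" "i + k"] that i by (simp add: nth)
    then show ?thesis unfolding distinct_conv_nth len by (metis linorder_neqE_nat)
  qed
  have adj: "E (xs ! k) (xs ! Suc k)" if "Suc k < length xs" for k
    using assms that by (simp add: nonbacktracking_def)
  have "d \<noteq> 1" using adj[of i] i adj_irrefl by auto
  moreover have "d \<noteq> 2" using assms i by (auto simp: nonbacktracking_def numeral_2_eq_2)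
  ultimately have d3: "d \<ge> 3" using i by linarith
  have succ: "successively E ys"
  proof -
    have "successively E ys" if "\<And>k. Suc k < length ys \<Longrightarrow> E (ys ! k) (ys ! Suc k)" for ys
      using that
    proof (induction ys)
      case (Cons y ys)
      have "successively E ys" using Cons.prems[of "Suc _"] by (intro Cons.IH) auto
      then show ?case using Cons.prems[of 0] by (cases ys) auto
    qed simp
    moreover have "E (ys ! k) (ys ! Suc k)" if "Suc k < length ys" for k
      using adj[of "i + k"] i that by (simp add: len nth)
    ultimately show ?thesis by blast
  qed
  have "ys \<noteq> []" using d3 len by auto
  then have "last ys = xs ! (i + (d - 1))" "hd ys = xs ! i"
    using d3 len by (auto simp: last_conv_nth hd_conv_nth nth)
  moreover have "E (xs ! (i + (d - 1))) (xs ! Suc (i + (d - 1)))"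
    by (rule adj) (use i d3 in linarith)
  moreover have "Suc (i + (d - 1)) = i + d" using d3 by simp
  ultimately have "E (last ys) (hd ys)" using i by simp
  then show False using tree_acyclic[OF dist _ succ] d3 len by simp
qed

lemma nonbacktracking_single [simp]: "nonbacktracking [x]"
  by (simp add: nonbacktracking_def)

lemma nonbacktracking_Cons:
  "nonbacktracking (x # y # xs) \<longleftrightarrow> E x y \<and> nonbacktracking (y # xs) \<and> (xs \<noteq> [] \<longrightarrow> x \<noteq> hd xs)"
    (is "?L \<longleftrightarrow> ?R")
proof
  assume L: ?L
  have "E x y" using L by (auto simp: nonbacktracking_def dest: spec[of _ 0])
  moreover have "nonbacktracking (y # xs)"
    unfolding nonbacktracking_def
  proof (intro conjI allI impI)
    fix i
    show "E ((y # xs) ! i) ((y # xs) ! Suc i)" if "Suc i < length (y # xs)"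
      using L that by (auto simp: nonbacktracking_def dest!: spec[of _ "Suc i"])
    show "(y # xs) ! i \<noteq> (y # xs) ! Suc (Suc i)" if "Suc (Suc i) < length (y # xs)"
      using L that unfolding nonbacktracking_def by (auto dest!: spec[of _ "Suc i"])
  qed
  moreover have "xs \<noteq> [] \<longrightarrow> x \<noteq> hd xs"
    using L by (auto simp: nonbacktracking_def hd_conv_nth dest!: spec[of _ 0])
  ultimately show ?R by blast
next
  assume R: ?R
  show ?L unfolding nonbacktracking_def
  proof (intro conjI allI impI)
    fix i
    show "E ((x # y # xs) ! i) ((x # y # xs) ! Suc i)" if "Suc i < length (x # y # xs)"
      using R that by (cases i) (auto simp: nonbacktracking_def)
    show "(x # y # xs) ! i \<noteq> (x # y # xs) ! Suc (Suc i)" if "Suc (Suc i) < length (x # y # xs)"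
      using R that by (cases i) (auto simp: nonbacktracking_def hd_conv_nth)
  qed
qed

lemma nonbacktracking_tl: "nonbacktracking (x # xs) \<Longrightarrow> nonbacktracking xs"
  by (cases xs) (auto simp: nonbacktracking_Cons, simp add: nonbacktracking_def)

lemma nonbacktracking_glue:
  assumes "nonbacktracking (x # xs)" "nonbacktracking (x # ys)"
    "xs \<noteq> []" "ys \<noteq> []" "hd xs \<noteq> hd ys"
  shows "nonbacktracking (rev xs @ x # ys)"
  using assms
proof (induction xs arbitrary: x ys)
  case (Cons z zs)
  show ?case
  proof (cases zs)
    case Nil
    then show ?thesis using Cons.prems adj_sym by (cases ys) (auto simp: nonbacktracking_Cons)
  next
    case (Cons u us)
    have "nonbacktracking (rev zs @ z # (x # ys))"
    proof (rule Cons.IH)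
      show "nonbacktracking (z # zs)" using Cons.prems nonbacktracking_tl by blast
      show "nonbacktracking (z # x # ys)" using Cons.prems adj_sym
        by (cases ys) (auto simp: nonbacktracking_Cons)
      show "hd zs \<noteq> hd (x # ys)" using Cons.prems Cons by (auto simp: nonbacktracking_Cons)
    qed (use Cons in auto)
    then show ?thesis by simp
  qed
qed simp

text \<open>Two different non-backtracking paths with the same ends would, after removing their common
  beginning, close up to a non-backtracking circuit.\<close>
lemma nonbacktracking_unique:
  assumes "nonbacktracking (x # xs)" "nonbacktracking (x # ys)" "last (x # xs) = last (x # ys)"
  shows "xs = ys"
  using assms
proof (induction xs arbitrary: x ys)
  case Nil
  then show ?case using nonbacktracking_distinct[OF Nil(2)] by (metis distinct.simps(2) last.simps last_in_set)
next
  case (Cons z zs)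
  have "ys \<noteq> []"
    using nonbacktracking_distinct[OF Cons.prems(1)] Cons.prems(3)
    by (metis distinct.simps(2) last.simps last_in_set list.distinct(1))
  then obtain u us where ys: "ys = u # us" by (cases ys) auto
  show ?case
  proof (cases "z = u")
    case True
    have "zs = us"
      by (rule Cons.IH[of z])
        (use Cons.prems ys True nonbacktracking_tl in auto)
    then show ?thesis using ys True by simp
  next
    case False
    have "nonbacktracking (rev (z # zs) @ x # ys)"
      by (rule nonbacktracking_glue) (use Cons.prems ys False in auto)
    from nonbacktracking_distinct[OF this] Cons.prems(3) ys show ?thesis
      by (metis disjoint_iff distinct_append last.simps last_in_set list.distinct(1) list.set_intros(2) set_rev)
  qed
qed

text \<open>Geodesics from \<open>v\<close> to \<open>w\<close> are read from their end \<open>w\<close>, which is left out, back to \<open>v\<close>; prolonging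
  them at \<open>w\<close> is then prepending an entry, and their length is the distance.\<close>
definition geodesic :: "'v \<Rightarrow> 'v \<Rightarrow> 'v list" where
  "geodesic v w = (THE xs. nonbacktracking (w # xs) \<and> last (w # xs) = v)"

lemma finite_nbrs: "finite {w. E v w}"
  using degree[of v] by (metis Suc_eq_plus1 card.infinite nat.distinct(1))

lemma geodesic_exists: "\<exists>xs. nonbacktracking (w # xs) \<and> last (w # xs) = v"
proof -
  have "E\<^sup>*\<^sup>* v w" by (rule tree_connected)
  then show ?thesis
  proof (induction rule: rtranclp_induct)
    case base
    show ?case by (intro exI[of _ "[]"]) simp
  next
    case (step y z)
    then obtain xs where xs: "nonbacktracking (y # xs)" "last (y # xs) = v" by blast
    show ?case
    proof (cases "xs \<noteq> [] \<and> hd xs = z")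
      case True
      then show ?thesis using xs nonbacktracking_tl
        by (metis last_ConsR list.collapse)
    next
      case False
      then have "nonbacktracking (z # y # xs)"
        using xs step adj_sym by (auto simp: nonbacktracking_Cons)
      then show ?thesis using xs(2) by (metis last_ConsR list.distinct(1))
    qed
  qed
qed

lemma geodesic: "nonbacktracking (w # geodesic v w)" "last (w # geodesic v w) = v"
proof -
  have "\<exists>!xs. nonbacktracking (w # xs) \<and> last (w # xs) = v"
    using geodesic_exists[of w v] nonbacktracking_unique by metis
  from theI'[OF this] show "nonbacktracking (w # geodesic v w)" "last (w # geodesic v w) = v"
    unfolding geodesic_def by auto
qed

lemma geodesic_eqI: "nonbacktracking (w # xs) \<Longrightarrow> last (w # xs) = v \<Longrightarrow> geodesic v w = xs"
  using nonbacktracking_unique geodesic by metis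

text \<open>Stepping to a neighbour either retraces the last edge of the geodesic or prolongs it.\<close>
lemma geodesic_nbr:
  assumes "E w x"
  shows "geodesic v x = (if geodesic v w \<noteq> [] \<and> x = hd (geodesic v w) then tl (geodesic v w) else w # geodesic v w)"
proof (cases "geodesic v w \<noteq> [] \<and> x = hd (geodesic v w)")
  case True
  then have "x # tl (geodesic v w) = geodesic v w" by auto
  then show ?thesis using True geodesic[of w v] nonbacktracking_tl
    by (intro geodesic_eqI) (auto split: if_splits)
next
  case False
  then have "nonbacktracking (x # w # geodesic v w)"
    using geodesic(1)[of w v] assms adj_sym by (auto simp: nonbacktracking_Cons)
  then show ?thesis using geodesic(2)[of w v] False by (subst if_not_P) (auto intro!: geodesic_eqI)
qed

lemma geodesic_self [simp]: "geodesic v v = []"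
  by (rule geodesic_eqI) auto

lemma relpowp_geodesic: "nonbacktracking (w # xs) \<Longrightarrow> last (w # xs) = v \<Longrightarrow> (E ^^ length xs) v w"
proof (induction xs arbitrary: w)
  case (Cons x xs)
  have "(E ^^ length xs) v x" using Cons nonbacktracking_tl by auto
  then show ?case using Cons.prems adj_sym relpowp_Suc_I[of _ E v x w] by (auto simp: nonbacktracking_Cons)
qed simp

lemma length_geodesic_le: "(E ^^ n) v w \<Longrightarrow> length (geodesic v w) \<le> n"
proof (induction n arbitrary: w)
  case (Suc n)
  then obtain y where y: "(E ^^ n) v y" "E y w" by (metis relpowp_Suc_E)
  have "length (geodesic v w) \<le> length (geodesic v y) + 1"
    unfolding geodesic_nbr[OF y(2)] by auto
  then show ?case using Suc.IH[OF y(1)] by simp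
qed (auto elim: relpowp_0_E)

lemma tdist_geodesic: "tdist v w = length (geodesic v w)"
  unfolding tdist_def
  by (rule Least_equality) (use geodesic relpowp_geodesic length_geodesic_le in auto)

lemma tdist_self [simp]: "tdist v v = 0"
  by (simp add: tdist_geodesic)

lemma tdist_eq_0_iff [simp]: "tdist v w = 0 \<longleftrightarrow> v = w"
  using geodesic(2)[of w v] by (auto simp: tdist_geodesic)

text \<open>Acyclicity turned into a statement about distances: only retracing the last edge of the geodesic
  shortens it.\<close>
lemma tdist_nbr:
  assumes "v \<noteq> w"
  obtains p where "E w p" "tdist v w = Suc (tdist v p)"
    "\<And>x. E w x \<Longrightarrow> x \<noteq> p \<Longrightarrow> tdist v x = Suc (tdist v w)"
proof -
  have ne: "geodesic v w \<noteq> []" using assms geodesic(2)[of w v] by auto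
  define p where "p = hd (geodesic v w)"
  have g: "geodesic v w = p # tl (geodesic v w)" using ne by (simp add: p_def)
  have E: "E w p" using geodesic(1)[of w v] g by (metis nonbacktracking_Cons)
  show thesis
  proof
    show "E w p" by fact
    show "tdist v w = Suc (tdist v p)"
      using ne unfolding tdist_geodesic geodesic_nbr[OF E] by (simp add: p_def)
    show "tdist v x = Suc (tdist v w)" if "E w x" "x \<noteq> p" for x
      using that(2) unfolding tdist_geodesic geodesic_nbr[OF that(1)] by (simp add: p_def)
  qed
qed

lemma relpowp_sym: "(E ^^ n) v w \<Longrightarrow> (E ^^ n) w v"
proof (induction n arbitrary: w)
  case (Suc n)
  then show ?case by (metis adj_sym relpowp_Suc_E relpowp_Suc_I2)
qed (auto elim: relpowp_0_E)

lemma tdist_sym: "tdist v w = tdist w v"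
proof -
  have "(E ^^ n) v w \<longleftrightarrow> (E ^^ n) w v" for n using relpowp_sym by blast
  then show ?thesis by (simp add: tdist_def)
qed

lemma relpowp_tdist: "(E ^^ tdist v w) v w"
  unfolding tdist_geodesic using geodesic relpowp_geodesic by blast

lemma tdist_le: "(E ^^ n) v w \<Longrightarrow> tdist v w \<le> n"
  unfolding tdist_def by (rule Least_le)

lemma tdist_triangle: "tdist u w \<le> tdist u v + tdist v w"
  by (rule tdist_le, rule relpowp_trans[OF relpowp_tdist relpowp_tdist])

lemma tdist_edge: "E v w \<Longrightarrow> tdist v w = 1"
  using tdist_le[of 1 v w] adj_irrefl by (metis One_nat_def le_Suc_eq le_zero_eq relpowp_1 tdist_eq_0_iff)

lemma tdist_nbr_cases:
  assumes "E w x"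
  shows "tdist v x = Suc (tdist v w) \<or> tdist v w = Suc (tdist v x)"
proof (cases "v = w")
  case True
  then show ?thesis using tdist_edge assms by simp
next
  case False
  then show ?thesis using assms by (metis tdist_nbr)
qed

text \<open>A path that has begun to move away from \<open>v\<close> continues to do so.\<close>
lemma tdist_continue:
  assumes "E w p" "tdist v w = Suc (tdist v p)" "E w x" "x \<noteq> p"
  shows "tdist v x = Suc (tdist v w)"
proof -
  have "v \<noteq> w" using assms by auto
  then show ?thesis using assms by (metis tdist_nbr n_not_Suc_n Suc_inject Suc_n_not_n)
qed

definition parent :: "'v \<Rightarrow> 'v" where
  "parent v = (if v = org then org else THE p. E v p \<and> tdist org v = Suc (tdist org p))"

abbreviation level :: "'v \<Rightarrow> nat" where "level v \<equiv> tdist org v"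

lemma
  assumes "v \<noteq> org"
  shows parent_adj: "E v (parent v)" and level_parent: "level v = Suc (level (parent v))"
    and level_child: "E v x \<Longrightarrow> x \<noteq> parent v \<Longrightarrow> level x = Suc (level v)"
proof -
  obtain p where p: "E v p" "level v = Suc (level p)"
    "\<And>x. E v x \<Longrightarrow> x \<noteq> p \<Longrightarrow> level x = Suc (level v)"
    using tdist_nbr[of org v] assms by metis
  have "parent v = p"
    unfolding parent_def if_not_P[OF assms]
  proof (rule the_equality)
    fix x assume x: "E v x \<and> level v = Suc (level x)"
    show "x = p" using p(3)[of x] x by fastforce
  qed (use p in auto)
  then show "E v (parent v)" "level v = Suc (level (parent v))"
    "E v x \<Longrightarrow> x \<noteq> parent v \<Longrightarrow> level x = Suc (level v)"
    using p by auto
qed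

lemma parent_org [simp]: "parent org = org" by (simp add: parent_def)

lemma parent_eqI: "E v p \<Longrightarrow> level v = Suc (level p) \<Longrightarrow> parent v = p"
  using level_child[of v p] by force

text \<open>\<open>below w v\<close>: the vertex \<open>w\<close> lies on the geodesic from \<open>org\<close> to \<open>v\<close>.\<close>
definition below :: "'v \<Rightarrow> 'v \<Rightarrow> bool" where
  "below w v \<longleftrightarrow> level v = level w + tdist w v"

lemma below_self [simp]: "below w w" by (simp add: below_def)
lemma below_org [simp]: "below org w" by (simp add: below_def)

text \<open>Induction on the distance of \<open>v\<close> from \<open>w\<close>: the neighbour \<open>v'\<close> of \<open>v\<close> toward \<open>w\<close> again has \<open>parent w\<close>
  beyond \<open>w\<close>, so it lies below \<open>w\<close>. The one neighbour of \<open>v'\<close> closer to \<open>org\<close> is closer to \<open>w\<close>, or it is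
  \<open>parent w\<close> if \<open>v'\<close> is \<open>w\<close>; as \<open>v\<close> is neither, it is farther from \<open>org\<close> than \<open>v'\<close>.\<close>
lemma belowI_tdist:
  assumes "w \<noteq> org" "tdist v (parent w) = Suc (tdist v w)"
  shows "below w v"
  using assms(2)
proof (induction "tdist w v" arbitrary: v)
  case 0
  then show ?case by simp
next
  case (Suc n)
  then have "w \<noteq> v" by auto
  then obtain v' where v': "E v v'" "tdist w v = Suc (tdist w v')"
    using tdist_nbr[of w v] by metis
  have d': "tdist v' (parent w) = Suc (tdist v' w)"
  proof -
    have "tdist v (parent w) \<le> tdist v v' + tdist v' (parent w)" by (rule tdist_triangle)
    moreover have "tdist v' (parent w) \<le> tdist v' w + tdist w (parent w)" by (rule tdist_triangle)
    ultimately show ?thesis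
      using Suc.prems v' tdist_edge[OF v'(1)] tdist_edge[OF parent_adj[OF assms(1)]]
      by (simp add: tdist_sym)
  qed
  have b: "below w v'" using Suc(1)[of v'] v' Suc(2) d' by simp
  have "level v = Suc (level v')"
  proof (cases "v' = w")
    case True
    have "v \<noteq> parent w" using Suc.prems by auto
    then show ?thesis using level_child[OF assms(1)] True v' adj_sym by auto
  next
    case False
    then obtain u where u: "E v' u" "tdist w v' = Suc (tdist w u)"
      using tdist_nbr[of w v'] by metis
    have "level u \<le> level w + tdist w u" by (rule tdist_triangle)
    then have "level v' = Suc (level u)"
      using b u tdist_nbr_cases[of v' u org] by (auto simp: below_def)
    moreover have "v \<noteq> u" using u v' by auto
    ultimately show ?thesis using tdist_continue[OF u(1), of org v] v' adj_sym by auto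
  qed
  then show ?case using b v' by (simp add: below_def)
qed

lemma below_tdist:
  assumes "w \<noteq> org" "below w v"
  shows "tdist v (parent w) = Suc (tdist v w)"
proof -
  have "level v \<le> level (parent w) + tdist (parent w) v" by (rule tdist_triangle)
  then have "tdist v w < tdist v (parent w)"
    using assms level_parent[OF assms(1)] by (simp add: below_def tdist_sym)
  then show ?thesis using tdist_nbr_cases[OF parent_adj[OF assms(1)], of v] by auto
qed

lemma not_below_tdist:
  assumes "w \<noteq> org" "\<not> below w v"
  shows "tdist v w = Suc (tdist v (parent w))"
  using belowI_tdist[OF assms(1), of v] tdist_nbr_cases[OF parent_adj[OF assms(1)], of v] assms(2)
  by auto

lemma below_level: "below w v \<Longrightarrow> level w \<le> level v"
  by (simp add: below_def)

lemma below_same_level: "below w v \<Longrightarrow> level w = level v \<Longrightarrow> w = v"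
  by (simp add: below_def)

lemma below_parent:
  assumes "below w v" "w \<noteq> v"
  shows "below w (parent v)"
proof -
  have v: "v \<noteq> org" using assms by (auto simp: below_def)
  obtain p where p: "E v p" "tdist w v = Suc (tdist w p)"
    using tdist_nbr[of w v] assms by metis
  have "level p \<le> level w + tdist w p" by (rule tdist_triangle)
  then have l: "level v = Suc (level p)"
    using assms(1) p tdist_nbr_cases[OF p(1), of org] by (auto simp: below_def)
  then have "parent v = p" using p parent_eqI by blast
  then show ?thesis using assms(1) p l by (simp add: below_def)
qed

lemma below_if_parent: "below w (parent v) \<Longrightarrow> below w v"
proof (cases "v = org")
  case False
  assume b: "below w (parent v)"
  have "tdist w v \<le> tdist w (parent v) + tdist (parent v) v" "level v \<le> level w + tdist w v"
    by (rule tdist_triangle)+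
  then show ?thesis
    using b level_parent[OF False] tdist_edge[OF parent_adj[OF False]]
    by (simp add: below_def tdist_sym)
qed simp

lemma below_iff: "below w v \<longleftrightarrow> w = v \<or> below w (parent v)"
  using below_parent below_if_parent below_self by blast

lemma finite_level: "finite {v. level v = n}"
proof (induction n)
  case 0
  have "{v. level v = 0} = {org}" by auto
  then show ?case by simp
next
  case (Suc n)
  have "{v. level v = Suc n} \<subseteq> (\<Union>u\<in>{u. level u = n}. {w. E u w})"
  proof
    fix v assume "v \<in> {v. level v = Suc n}"
    then have "v \<noteq> org" "level v = Suc n" by auto
    then show "v \<in> (\<Union>u\<in>{u. level u = n}. {w. E u w})"
      using parent_adj[of v] level_parent[of v] adj_sym by auto
  qed
  then show ?case using Suc finite_nbrs by (meson finite_UN_I finite_subset)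
qed

lemma vertex_induct [case_names org child]:
  assumes "P org" "\<And>v. v \<noteq> org \<Longrightarrow> P (parent v) \<Longrightarrow> P v"
  shows "P v"
proof (induction "level v" arbitrary: v)
  case 0
  then show ?case using assms by simp
next
  case (Suc n)
  then have "v \<noteq> org" by auto
  then show ?case using assms(2)[of v] Suc(1)[of "parent v"] Suc(2) level_parent[of v] by simp
qed

end


section \<open>The boundary\<close>

context regular_tree
begin

lemma countable_vertices: "countable (UNIV :: 'v set)"
proof -
  have "countable (\<Union>n. {v. level v = n})"
    by (rule countable_UN) (simp_all add: countable_finite finite_level)
  moreover have "(\<Union>n. {v. level v = n}) = UNIV" by blast
  ultimately show ?thesis by simp
qed

lemma rayD:
  assumes "\<gamma> \<in> rays"
  shows "E (\<gamma> n) (\<gamma> (Suc n))" "\<gamma> (Suc (Suc n)) \<noteq> \<gamma> n"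
proof -
  show "E (\<gamma> n) (\<gamma> (Suc n))" using assms by (auto simp: rays_def)
  have "\<gamma> (n + 2) \<noteq> \<gamma> n" using assms unfolding rays_def by blast
  then show "\<gamma> (Suc (Suc n)) \<noteq> \<gamma> n" by simp
qed

lemma raysI: "(\<And>n. E (\<gamma> n) (\<gamma> (Suc n))) \<Longrightarrow> (\<And>n. \<gamma> (Suc (Suc n)) \<noteq> \<gamma> n) \<Longrightarrow> \<gamma> \<in> rays"
  by (auto simp: rays_def)

lemma ray_escapes:
  assumes "\<gamma> \<in> rays" "tdist v (\<gamma> (Suc n)) = Suc (tdist v (\<gamma> n))"
  shows "tdist v (\<gamma> (n + k)) = tdist v (\<gamma> n) + k"
proof -
  have "tdist v (\<gamma> (Suc (n + k))) = Suc (tdist v (\<gamma> (n + k)))" for k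
  proof (induction k)
    case (Suc k)
    show ?case
      using tdist_continue[of "\<gamma> (Suc (n + k))" "\<gamma> (n + k)" v "\<gamma> (Suc (Suc (n + k)))"]
        Suc rayD[OF assms(1)] adj_sym by simp
  qed (use assms in simp)
  then show ?thesis by (induction k) auto
qed

lemma tdist_ray: 
  assumes "\<gamma> \<in> rays" 
  shows "tdist (\<gamma> i) (\<gamma> (i + k)) = k"
  using ray_escapes[OF assms, of "\<gamma> i" i k] tdist_edge rayD(1)[OF assms] by simp

definition org_rays :: "(nat \<Rightarrow> 'v) set" where
  "org_rays = {\<gamma> \<in> rays. \<gamma> 0 = org}"

lemma level_org_ray [simp]: "\<gamma> \<in> org_rays \<Longrightarrow> level (\<gamma> n) = n"
  using tdist_ray[of \<gamma> 0 n] by (simp add: org_rays_def)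

lemma parent_org_ray [simp]: "\<gamma> \<in> org_rays \<Longrightarrow> parent (\<gamma> (Suc n)) = \<gamma> n"
  by (rule parent_eqI) (auto simp: org_rays_def intro: adj_sym rayD(1))

lemma org_raysI:
  assumes "\<gamma> 0 = org" "\<And>n. level (\<gamma> n) = n" "\<And>n. parent (\<gamma> (Suc n)) = \<gamma> n"
  shows "\<gamma> \<in> org_rays"
proof -
  have "\<gamma> (Suc n) \<noteq> org" for n using assms(2)[of "Suc n"] by auto
  then have "E (\<gamma> n) (\<gamma> (Suc n))" for n using parent_adj[of "\<gamma> (Suc n)"] assms(3) adj_sym by simp
  moreover have "\<gamma> (Suc (Suc n)) \<noteq> \<gamma> n" for n
    using assms(2)[of n] assms(2)[of "Suc (Suc n)"] by auto
  ultimately show ?thesis using raysI assms(1) by (simp add: org_rays_def)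
qed

text \<open>The geodesic from \<open>org\<close> to a vertex of the ray is the beginning of the ray.\<close>
lemma below_org_ray_iff:
  assumes "\<gamma> \<in> org_rays" "level w \<le> n"
  shows "below w (\<gamma> n) \<longleftrightarrow> \<gamma> (level w) = w"
  using assms(2)
proof (induction n)
  case 0
  have "\<gamma> 0 = org" using assms(1) by (simp add: org_rays_def)
  moreover have "w = org" using 0 tdist_eq_0_iff[of org w] by simp
  ultimately show ?case by simp
next
  case (Suc n)
  show ?case
  proof (cases "level w = Suc n")
    case True
    then show ?thesis using below_same_level[of w "\<gamma> (Suc n)"] assms(1) by auto
  next
    case False
    then have "w \<noteq> \<gamma> (Suc n)" using level_org_ray[OF assms(1), of "Suc n"] by auto
    then show ?thesis using below_iff[of w "\<gamma> (Suc n)"] Suc False assms(1) by simp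
  qed
qed

text \<open>Two rays from \<open>org\<close> move apart at unit speed once they have separated.\<close>
lemma org_rays_eq:
  assumes "\<gamma> \<in> org_rays" "\<gamma>' \<in> org_rays" "\<And>n. tdist (\<gamma> n) (\<gamma>' n) \<le> B"
  shows "\<gamma> = \<gamma>'"
proof (rule ccontr)
  assume "\<gamma> \<noteq> \<gamma>'"
  then obtain k where k: "\<gamma> k \<noteq> \<gamma>' k" by auto
  then obtain j where j: "k = Suc j" using assms(1,2) by (cases k) (auto simp: org_rays_def)
  have no: "\<gamma>' k \<noteq> org" using level_org_ray[OF assms(2), of k] j by auto
  have "tdist (\<gamma> (k + m)) (\<gamma>' (k + m)) \<ge> m" for m
  proof -
    have "\<not> below (\<gamma>' k) (\<gamma> (k + m))"
      using below_org_ray_iff[OF assms(1), of "\<gamma>' k" "k + m"] k assms(2) by simp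
    then have "tdist (\<gamma> (k + m)) (\<gamma>' (Suc j)) = Suc (tdist (\<gamma> (k + m)) (\<gamma>' j))"
      using not_below_tdist[OF no] assms(2) j by simp
    then have "tdist (\<gamma> (k + m)) (\<gamma>' (j + Suc m)) = tdist (\<gamma> (k + m)) (\<gamma>' j) + Suc m"
      by (intro ray_escapes) (use assms(2) in \<open>auto simp: org_rays_def\<close>)
    then show ?thesis using j by simp
  qed
  from this[of "Suc B"] assms(3)[of "k + Suc B"] show False by simp
qed

text \<open>A ray approaches \<open>org\<close> only for finitely many steps; from the turning point on it is the tail
  of a ray from \<open>org\<close>.\<close>
lemma ray_tail_org_ray:
  assumes "\<gamma> \<in> rays"
  obtains \<rho> N M where "\<rho> \<in> org_rays" "\<And>k. \<gamma> (N + k) = \<rho> (M + k)"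
proof -
  obtain N where N: "level (\<gamma> (Suc N)) = Suc (level (\<gamma> N))"
  proof (rule ccontr)
    assume "\<not> thesis"
    then have "level (\<gamma> n) = Suc (level (\<gamma> (Suc n)))" for n
      using that tdist_nbr_cases[OF rayD(1)[OF assms], of org n] by auto
    then have "level (\<gamma> 0) = level (\<gamma> n) + n" for n
      by (induction n) (metis add.right_neutral, metis add_Suc_shift)
    from this[of "Suc (level (\<gamma> 0))"] show False by simp
  qed
  define M where "M = level (\<gamma> N)"
  have lev: "level (\<gamma> (N + k)) = M + k" for k
    using ray_escapes[OF assms N] by (simp add: M_def)
  have par: "parent (\<gamma> (N + Suc k)) = \<gamma> (N + k)" for k
    by (rule parent_eqI) (use lev[of k] lev[of "Suc k"] adj_sym[OF rayD(1)[OF assms, of "N + k"]] in simp_all)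
  define \<rho> where "\<rho> n = (parent ^^ M) (\<gamma> (N + n))" for n
  have lp: "level ((parent ^^ m) v) = level v - m" for m v
  proof (induction m)
    case (Suc m)
    have "level (parent u) = level u - 1" for u by (cases "u = org") (auto simp: level_parent)
    then show ?case using Suc by simp
  qed simp
  have "\<rho> \<in> org_rays"
  proof (rule org_raysI)
    show "level (\<rho> n) = n" for n by (simp add: \<rho>_def lp lev)
    then have "level (\<rho> 0) = 0" .
    then show "\<rho> 0 = org" by auto
    show "parent (\<rho> (Suc n)) = \<rho> n" for n
      unfolding \<rho>_def funpow_swap1 par ..
  qed
  moreover have "\<gamma> (N + k) = \<rho> (M + k)" for k
  proof -
    have "(parent ^^ m) (\<gamma> (N + (m + k))) = \<gamma> (N + k)" for m
    proof (induction m)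
      case (Suc m)
      then show ?case using par[of "m + k"] by (simp add: funpow_swap1)
    qed simp
    then show ?thesis by (simp add: \<rho>_def)
  qed
  ultimately show thesis using that by blast
qed

text \<open>Two rays with the same tail, traversed with a delay, stay at constant distance \<open>\<bar>M - N\<bar>\<close> in the end.\<close>
lemma ray_equiv_org_ray:
  assumes "\<gamma> \<in> rays"
  obtains \<rho> where "\<rho> \<in> org_rays" "(\<gamma>, \<rho>) \<in> end_rel"
proof -
  obtain \<rho> N M where \<rho>: "\<rho> \<in> org_rays" "\<And>k. \<gamma> (N + k) = \<rho> (M + k)"
    using ray_tail_org_ray[OF assms] by metis
  have r: "\<rho> \<in> rays" using \<rho> by (simp add: org_rays_def)
  have "real (tdist (\<gamma> n) (\<rho> n)) = \<bar>real M - real N\<bar>" if n: "n \<ge> N" for n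
  proof -
    obtain k where k: "n = N + k" using le_Suc_ex[OF n] by blast
    show ?thesis
    proof (cases "M \<le> N")
      case True
      then obtain j where j: "N = M + j" using le_Suc_ex[of M N] by blast
      show ?thesis using tdist_ray[OF r, of "M + k" j] \<rho>(2)[of k] unfolding k j
        by (simp add: ac_simps)
    next
      case False
      then have "N \<le> M" by simp
      then obtain j where j: "M = N + j" using le_Suc_ex[of N M] by blast
      show ?thesis using tdist_ray[OF r, of "N + k" j] \<rho>(2)[of k] unfolding k j
        by (simp add: ac_simps tdist_sym)
    qed
  qed
  then have "(\<lambda>n. real (tdist (\<gamma> n) (\<rho> n))) \<longlonglongrightarrow> \<bar>real M - real N\<bar>"
    by (intro tendsto_eventually) (auto simp: eventually_at_top_linorder)
  then have "(\<gamma>, \<rho>) \<in> end_rel" using assms r by (auto simp: end_rel_def convergent_def)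
  then show thesis using that \<rho> by blast
qed

lemma end_rel_bounded:
  assumes "(\<gamma>, \<gamma>') \<in> end_rel"
  obtains B where "\<And>n. tdist (\<gamma> n) (\<gamma>' n) \<le> B"
proof -
  have "convergent (\<lambda>n. real (tdist (\<gamma> n) (\<gamma>' n)))" using assms by (simp add: end_rel_def)
  then obtain C where C: "\<And>n. norm (real (tdist (\<gamma> n) (\<gamma>' n))) \<le> C"
    using Bseq_def convergent_imp_Bseq by metis
  have "tdist (\<gamma> n) (\<gamma>' n) \<le> nat \<lceil>C\<rceil>" for n
    using C[of n] by (simp add: le_nat_iff) linarith
  then show thesis using that by blast
qed

text \<open>Existence is the construction of the tail above; uniqueness follows from the triangle inequality,
  since convergent distances are bounded.\<close>
lemma ex1_org_ray:
  assumes "\<omega> \<in> \<Omega>"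
  shows "\<exists>!\<gamma>. \<gamma> \<in> \<omega> \<and> \<gamma> 0 = org"
proof -
  obtain \<gamma> where \<gamma>: "\<gamma> \<in> rays" "\<omega> = end_rel `` {\<gamma>}"
    using assms unfolding \<Omega>_def by (auto elim: quotientE)
  obtain \<rho> where \<rho>: "\<rho> \<in> org_rays" "(\<gamma>, \<rho>) \<in> end_rel" using ray_equiv_org_ray[OF \<gamma>(1)] by metis
  show ?thesis
  proof (rule ex1I[of _ \<rho>])
    show "\<rho> \<in> \<omega> \<and> \<rho> 0 = org" using \<rho> \<gamma> by (simp add: org_rays_def)
    fix \<rho>' assume "\<rho>' \<in> \<omega> \<and> \<rho>' 0 = org"
    then have r: "(\<gamma>, \<rho>') \<in> end_rel" "\<rho>' \<in> org_rays"
      using \<gamma> by (auto simp: org_rays_def end_rel_def)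
    obtain B B' where B: "\<And>n. tdist (\<gamma> n) (\<rho> n) \<le> B" "\<And>n. tdist (\<gamma> n) (\<rho>' n) \<le> B'"
      using end_rel_bounded[OF \<rho>(2)] end_rel_bounded[OF r(1)] by metis
    show "\<rho>' = \<rho>"
    proof (rule org_rays_eq[OF r(2) \<rho>(1)])
      show "tdist (\<rho>' n) (\<rho> n) \<le> B' + B" for n
        using tdist_triangle[of "\<rho>' n" "\<rho> n" "\<gamma> n"] B[of n] tdist_sym[of "\<rho>' n" "\<gamma> n"] by simp
    qed
  qed
qed

lemma ray_org_rays: "\<omega> \<in> \<Omega> \<Longrightarrow> ray \<omega> \<in> org_rays"
proof -
  assume o: "\<omega> \<in> \<Omega>"
  have r: "ray \<omega> \<in> \<omega> \<and> ray \<omega> 0 = org" unfolding ray_def by (rule theI'[OF ex1_org_ray[OF o]])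
  obtain \<gamma> where "\<omega> = end_rel `` {\<gamma>}"
    using o unfolding \<Omega>_def by (auto elim: quotientE)
  then show ?thesis using r by (auto simp: org_rays_def end_rel_def)
qed

lemma org_ray_is_ray:
  assumes "\<rho> \<in> org_rays"
  obtains \<omega> where "\<omega> \<in> \<Omega>" "ray \<omega> = \<rho>"
proof -
  have r: "\<rho> \<in> rays" "\<rho> 0 = org" using assms by (auto simp: org_rays_def)
  define \<omega> where "\<omega> = end_rel `` {\<rho>}"
  have o: "\<omega> \<in> \<Omega>" using r unfolding \<omega>_def \<Omega>_def by (intro quotientI)
  have "(\<rho>, \<rho>) \<in> end_rel" using r by (simp add: end_rel_def convergent_const)
  then have "ray \<omega> = \<rho>"
    unfolding ray_def using r by (intro the1_equality[OF ex1_org_ray[OF o]]) (simp add: \<omega>_def)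
  then show thesis using that o by blast
qed

lemma level_ray [simp]: "\<omega> \<in> \<Omega> \<Longrightarrow> level (ray \<omega> n) = n"
  using ray_org_rays by simp

lemma parent_ray [simp]: "\<omega> \<in> \<Omega> \<Longrightarrow> parent (ray \<omega> (Suc n)) = ray \<omega> n"
  using ray_org_rays by simp

lemma ray_0 [simp]: "\<omega> \<in> \<Omega> \<Longrightarrow> ray \<omega> 0 = org"
  using ray_org_rays by (simp add: org_rays_def)

lemma cyl_iff: "\<omega> \<in> cyl v \<longleftrightarrow> \<omega> \<in> \<Omega> \<and> ray \<omega> (level v) = v"
  unfolding cyl_def using level_ray by fastforce

lemma cyl_subset: "cyl v \<subseteq> \<Omega>" by (auto simp: cyl_def)

lemma cyl_org [simp]: "cyl org = \<Omega>" by (auto simp: cyl_iff)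

lemma cyl_ray [simp]: "\<omega> \<in> \<Omega> \<Longrightarrow> \<omega> \<in> cyl (ray \<omega> n)" by (simp add: cyl_iff)

lemma below_ray_iff: "\<omega> \<in> \<Omega> \<Longrightarrow> level w \<le> n \<Longrightarrow> below w (ray \<omega> n) \<longleftrightarrow> \<omega> \<in> cyl w"
  using below_org_ray_iff[OF ray_org_rays] by (simp add: cyl_iff)

lemma cyl_mono: "below w v \<Longrightarrow> cyl v \<subseteq> cyl w"
  using below_ray_iff[of _ w "level v"] below_level by (fastforce simp: cyl_iff)

lemma cyl_disjoint: "\<not> below w v \<Longrightarrow> \<not> below v w \<Longrightarrow> cyl v \<inter> cyl w = {}"
proof (rule ccontr)
  assume b: "\<not> below w v" "\<not> below v w" and "cyl v \<inter> cyl w \<noteq> {}"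
  then obtain \<omega> where o: "\<omega> \<in> \<Omega>" "ray \<omega> (level v) = v" "ray \<omega> (level w) = w" by (auto simp: cyl_iff)
  have "below w v \<or> below v w"
    using below_ray_iff[OF o(1), of w "level v"] below_ray_iff[OF o(1), of v "level w"] o
    by (metis cyl_iff nat_le_linear)
  then show False using b by simp
qed

lemma ray_eq_downwards:
  assumes "\<omega> \<in> \<Omega>" "\<omega>' \<in> \<Omega>" "ray \<omega> N = ray \<omega>' N" "n \<le> N"
  shows "ray \<omega> n = ray \<omega>' n"
  using assms(4,3)
proof (induction N)
  case (Suc N)
  show ?case
  proof (cases "n = Suc N")
    case False
    have "ray \<omega> N = ray \<omega>' N" using Suc.prems(2) parent_ray[OF assms(1)] parent_ray[OF assms(2)] by metis
    then show ?thesis using Suc False by simp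
  qed (use Suc in simp)
qed simp

text \<open>The sequence in the definition of the height is constant from the level of \<open>v\<close> on: as soon as the
  ray has passed the level of \<open>v\<close>, it stays below \<open>v\<close> or it stays outside, and passing from \<open>parent v\<close>
  to \<open>v\<close> changes the distance by a fixed sign.\<close>
lemma horo_eq:
  assumes "\<omega> \<in> \<Omega>" "level v \<le> n"
  shows "horo \<omega> v = int n - int (tdist (ray \<omega> n) v)"
proof -
  define H where "H n v = int n - int (tdist (ray \<omega> n) v)" for n v
  have "\<exists>c. \<forall>n\<ge>level v. H n v = c"
  proof (induction v rule: vertex_induct)
    case org
    then show ?case using assms(1) by (simp add: H_def tdist_sym)
  next
    case (child v)
    then obtain c where c: "\<And>n. n \<ge> level (parent v) \<Longrightarrow> H n (parent v) = c" by blast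
    have "H n v = (if \<omega> \<in> cyl v then c + 1 else c - 1)" if "n \<ge> level v" for n
    proof -
      have "H n (parent v) = c" using c that level_parent[OF child(1)] by simp
      then show ?thesis
        using below_ray_iff[OF assms(1) that] below_tdist[OF child(1), of "ray \<omega> n"]
          not_below_tdist[OF child(1), of "ray \<omega> n"]
        by (auto simp: H_def)
    qed
    then show ?case by blast
  qed
  then obtain c where c: "\<And>n. n \<ge> level v \<Longrightarrow> H n v = c" by blast
  then have "(\<lambda>n. H n v) \<longlonglongrightarrow> c"
    by (intro tendsto_eventually) (auto simp: eventually_at_top_linorder)
  then have "horo \<omega> v = c" unfolding horo_def H_def by (rule limI)
  then show ?thesis using c[OF assms(2)] by (simp add: H_def)
qed

lemma horo_org [simp]: "\<omega> \<in> \<Omega> \<Longrightarrow> horo \<omega> org = 0"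
  using horo_eq[of \<omega> org 0] by simp

lemma horo_parent:
  assumes "\<omega> \<in> \<Omega>" "v \<noteq> org"
  shows "horo \<omega> v = (if \<omega> \<in> cyl v then horo \<omega> (parent v) + 1 else horo \<omega> (parent v) - 1)"
proof -
  have "horo \<omega> (parent v) = int (level v) - int (tdist (ray \<omega> (level v)) (parent v))"
    by (rule horo_eq[OF assms(1)]) (simp add: level_parent[OF assms(2)])
  then show ?thesis
    using horo_eq[OF assms(1), of v "level v"] below_ray_iff[OF assms(1), of v "level v"]
      below_tdist[OF assms(2), of "ray \<omega> (level v)"]
      not_below_tdist[OF assms(2), of "ray \<omega> (level v)"]
    by auto
qed

text \<open>Seen from outside, all ends in the cylinder of \<open>w\<close> are reached through \<open>w\<close>.\<close>
lemma horo_cyl: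
  assumes "\<omega> \<in> cyl w" "w \<noteq> org" "\<not> below w v"
  shows "horo \<omega> v = int (level w) - int (tdist v w)"
proof -
  have o: "\<omega> \<in> \<Omega>" "ray \<omega> (level w) = w" using assms by (auto simp: cyl_iff)
  obtain m where m: "level w = Suc m" using assms(2) by (cases "level w") auto
  have rm: "ray \<omega> (Suc m) = w" "ray \<omega> m = parent w"
    using o m parent_ray[OF o(1), of m] by simp_all
  have "ray \<omega> \<in> rays" using ray_org_rays[OF o(1)] by (simp add: org_rays_def)
  moreover have "tdist v (ray \<omega> (Suc m)) = Suc (tdist v (ray \<omega> m))"
    using not_below_tdist[OF assms(2,3)] rm by simp
  ultimately have "tdist v (ray \<omega> (m + k)) = tdist v (parent w) + k" for k
    using ray_escapes[of "ray \<omega>" v m k] rm by simp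
  from this[of "Suc (level v)"] show ?thesis
    using horo_eq[OF o(1), of v "m + Suc (level v)"] not_below_tdist[OF assms(2,3)] m
    by (simp add: tdist_sym)
qed

lemma horo_on_cyl: "\<omega> \<in> cyl v \<Longrightarrow> horo \<omega> v = int (level v)"
  using horo_eq[of \<omega> v "level v"] by (simp add: cyl_iff)


section \<open>Locally constant functions\<close>

lemma topspace_bdry [simp]: "topspace bdry_top = \<Omega>"
  unfolding bdry_top_def topology_generated_by_topspace using cyl_subset cyl_org by blast

lemma openin_cyl: "openin bdry_top (cyl v)"
  unfolding bdry_top_def by (rule topology_generated_by_Basis) simp

lemma openin_bdry_cyl:
  assumes "openin bdry_top U" "\<omega> \<in> U"
  shows "\<exists>n. cyl (ray \<omega> n) \<subseteq> U"
proof -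
  have "generate_topology_on (range cyl) U"
    using assms(1) unfolding bdry_top_def openin_topology_generated_by_iff .
  then show ?thesis using assms(2)
  proof (induction rule: generate_topology_on.induct)
    case (Int A B)
    then obtain m n where mn: "cyl (ray \<omega> m) \<subseteq> A" "cyl (ray \<omega> n) \<subseteq> B" by blast
    have "generate_topology_on (range cyl) A" using Int by simp
    then have "\<omega> \<in> \<Omega>"
      using Int(5) topspace_bdry openin_subset[of bdry_top A]
      unfolding bdry_top_def openin_topology_generated_by_iff by auto
    then have "cyl (ray \<omega> (max m n)) \<subseteq> cyl (ray \<omega> m)" "cyl (ray \<omega> (max m n)) \<subseteq> cyl (ray \<omega> n)"
      using \<open>\<omega> \<in> \<Omega>\<close> by (intro cyl_mono; simp add: below_ray_iff)+
    then show ?case using mn by blast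
  next
    case (Basis s)
    then obtain v where "s = cyl v" by auto
    then show ?case using Basis(2) by (metis cyl_iff order_refl)
  qed blast+
qed

definition constant_at_level :: "nat \<Rightarrow> ('v bdry \<Rightarrow> complex) \<Rightarrow> bool" where
  "constant_at_level N g \<longleftrightarrow> (\<forall>\<omega>\<in>\<Omega>. \<forall>\<omega>'\<in>\<Omega>. ray \<omega> N = ray \<omega>' N \<longrightarrow> g \<omega> = g \<omega>')"

lemma constant_at_level_mono: "constant_at_level N g \<Longrightarrow> N \<le> M \<Longrightarrow> constant_at_level M g"
  unfolding constant_at_level_def using ray_eq_downwards by blast

text \<open>This is the compactness of the boundary, by the argument of Koenig's lemma: if \<open>g\<close> were not
  constant at any level, some child of each bad vertex would be bad again, and the ray following bad
  vertices would have an end near which \<open>g\<close> is not constant.\<close>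
lemma K_constant_at_level:
  assumes "g \<in> K"
  obtains N where "constant_at_level N g"
proof -
  define const where "const u \<longleftrightarrow> (\<forall>\<omega>\<in>cyl u. \<forall>\<omega>'\<in>cyl u. g \<omega> = g \<omega>')" for u
  define good where "good v \<longleftrightarrow> (\<exists>N. \<forall>u. below v u \<longrightarrow> N \<le> level u \<longrightarrow> const u)" for v
  have step: "good v" if "\<And>w. parent w = v \<Longrightarrow> w \<noteq> org \<Longrightarrow> good w" for v
  proof -
    define C where "C = {w. w \<noteq> org \<and> parent w = v}"
    have "C \<subseteq> {w. E v w}" unfolding C_def using parent_adj adj_sym by blast
    then have fin: "finite C" using finite_nbrs finite_subset by blast
    have "\<forall>w\<in>C. \<exists>N. \<forall>u. below w u \<longrightarrow> N \<le> level u \<longrightarrow> const u"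
      using that unfolding C_def good_def by blast
    then obtain N where N: "\<And>w u. w \<in> C \<Longrightarrow> below w u \<Longrightarrow> N w \<le> level u \<Longrightarrow> const u"
      by metis
    \<comment> \<open>Every vertex strictly below \<open>v\<close> lies below one of the finitely many children of \<open>v\<close>; \<open>level v\<close>
      is exceeded in order to exclude \<open>v\<close> itself.\<close>
    define M where "M = Max (insert (Suc (level v)) (N ` C))"
    have M: "Suc (level v) \<le> M" "w \<in> C \<Longrightarrow> N w \<le> M" for w
      using fin by (auto simp: M_def)
    have sub: "\<exists>w\<in>C. below w u" if "below v u" "v \<noteq> u" for u
      using that
    proof (induction u rule: vertex_induct)
      case org
      then show ?case by (auto simp: below_def)
    next
      case (child u)
      have b: "below v (parent u)" using child below_parent by blast
      show ?case
      proof (cases "v = parent u")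
        case True
        then show ?thesis using child by (auto simp: C_def intro!: bexI[of _ u])
      next
        case False
        then show ?thesis using child(2) b below_if_parent by blast
      qed
    qed
    have "const u" if u: "below v u" "M \<le> level u" for u
    proof -
      have "v \<noteq> u" using u M(1) by auto
      then obtain w where w: "w \<in> C" "below w u" using sub u by blast
      show ?thesis using N[OF w] M(2)[OF w(1)] u(2) by simp
    qed
    then show ?thesis unfolding good_def by blast
  qed
  have "good org"
  proof (rule ccontr)
    assume bad: "\<not> good org"
    have "\<exists>w. parent w = v \<and> w \<noteq> org \<and> \<not> good w" if "\<not> good v" for v
      using step that by blast
    then obtain nxt where nxt: "\<And>v. \<not> good v \<Longrightarrow> parent (nxt v) = v \<and> nxt v \<noteq> org \<and> \<not> good (nxt v)"
      by metis
    define \<rho> where "\<rho> n = (nxt ^^ n) org" for n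
    have b: "\<not> good (\<rho> n)" for n by (induction n) (use bad nxt in \<open>auto simp: \<rho>_def\<close>)
    have \<rho>S: "\<rho> (Suc n) = nxt (\<rho> n)" for n by (simp add: \<rho>_def)
    have "\<rho> \<in> org_rays"
    proof (rule org_raysI)
      show "\<rho> 0 = org" by (simp add: \<rho>_def)
      show "parent (\<rho> (Suc n)) = \<rho> n" for n using nxt[OF b[of n]] \<rho>S by simp
      show "level (\<rho> n) = n" for n
      proof (induction n)
        case (Suc n)
        then show ?case using nxt[OF b[of n]] \<rho>S level_parent[of "\<rho> (Suc n)"] by simp
      qed (simp add: \<rho>_def)
    qed
    then obtain \<omega> where o: "\<omega> \<in> \<Omega>" "ray \<omega> = \<rho>" using org_ray_is_ray by metis
    \<comment> \<open>As \<open>g\<close> has finitely many values, the other values form a closed set, and \<open>g\<close> is constant near \<open>\<omega>\<close>.\<close>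
    have "openin bdry_top {\<omega>' \<in> topspace bdry_top. g \<omega>' \<in> UNIV - (g ` \<Omega> - {g \<omega>})}"
      using assms unfolding K_def
      by (intro openin_continuous_map_preimage[of _ euclidean])
        (auto intro!: open_Diff finite_imp_closed)
    from openin_bdry_cyl[OF this, of \<omega>] obtain n
      where n: "cyl (\<rho> n) \<subseteq> {\<omega>' \<in> \<Omega>. g \<omega>' \<in> UNIV - (g ` \<Omega> - {g \<omega>})}"
      using o by auto
    have c: "g \<omega>' = g \<omega>" if "\<omega>' \<in> cyl (\<rho> n)" for \<omega>'
      using n that by blast
    have "const u" if "below (\<rho> n) u" for u
      using c cyl_mono[OF that] unfolding const_def by (metis subsetD)
    then have "good (\<rho> n)" unfolding good_def by blast
    then show False using b by blast
  qed
  then obtain N where N: "\<And>u. N \<le> level u \<Longrightarrow> const u" unfolding good_def by auto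
  have "constant_at_level N g"
    unfolding constant_at_level_def
  proof (intro ballI impI)
    fix \<omega> \<omega>' assume o: "\<omega> \<in> \<Omega>" "\<omega>' \<in> \<Omega>" "ray \<omega> N = ray \<omega>' N"
    have "const (ray \<omega> N)" using N o by simp
    moreover have "\<omega> \<in> cyl (ray \<omega> N)" "\<omega>' \<in> cyl (ray \<omega> N)"
      using cyl_ray[OF o(1), of N] cyl_ray[OF o(2), of N] unfolding o(3) by auto
    ultimately show "g \<omega> = g \<omega>'" unfolding const_def by blast
  qed
  then show thesis using that by blast
qed

text \<open>Preimages are unions of cylinders, and there are finitely many values because a level has finitely
  many vertices.\<close>
lemma K_I:
  assumes "constant_at_level N g" "\<And>\<omega>. \<omega> \<notin> \<Omega> \<Longrightarrow> g \<omega> = 0"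
  shows "g \<in> K"
proof -
  have "g ` \<Omega> \<subseteq> (\<lambda>v. g (SOME \<omega>. \<omega> \<in> \<Omega> \<and> ray \<omega> N = v)) ` {v. level v = N}"
  proof
    fix y assume "y \<in> g ` \<Omega>"
    then obtain \<omega> where o: "\<omega> \<in> \<Omega>" "y = g \<omega>" by blast
    let ?s = "SOME \<omega>'. \<omega>' \<in> \<Omega> \<and> ray \<omega>' N = ray \<omega> N"
    have "?s \<in> \<Omega> \<and> ray ?s N = ray \<omega> N" by (rule someI[of _ \<omega>]) (use o in simp)
    then have "y = g ?s" using assms(1) o unfolding constant_at_level_def by metis
    then show "y \<in> (\<lambda>v. g (SOME \<omega>. \<omega> \<in> \<Omega> \<and> ray \<omega> N = v)) ` {v. level v = N}"
      using o level_ray by blast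
  qed
  then have "finite (g ` \<Omega>)" using finite_level finite_surj by blast
  moreover have "continuous_map bdry_top euclidean g"
    unfolding continuous_map_def
  proof (intro conjI allI impI)
    fix U :: "complex set"
    have "{x \<in> topspace bdry_top. g x \<in> U} = \<Union> (cyl ` {v. level v = N \<and> (\<exists>\<omega>\<in>cyl v. g \<omega> \<in> U)})"
      (is "?A = ?B")
    proof
      show "?A \<subseteq> ?B"
      proof
        fix \<omega> assume o: "\<omega> \<in> ?A"
        then have "\<omega> \<in> cyl (ray \<omega> N)" "level (ray \<omega> N) = N" by auto
        then show "\<omega> \<in> ?B" using o by blast
      qed
      show "?B \<subseteq> ?A"
      proof
        fix \<omega> assume "\<omega> \<in> ?B"
        then obtain v \<omega>' where "level v = N" "\<omega> \<in> cyl v" "\<omega>' \<in> cyl v" "g \<omega>' \<in> U" by blast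
        then have "\<omega> \<in> \<Omega>" "\<omega>' \<in> \<Omega>" "ray \<omega> N = ray \<omega>' N" unfolding cyl_iff by auto
        then have "g \<omega> = g \<omega>'" using assms(1) unfolding constant_at_level_def by blast
        then show "\<omega> \<in> ?A" using \<open>g \<omega>' \<in> U\<close> \<open>\<omega> \<in> \<Omega>\<close> by simp
      qed
    qed
    moreover have "openin bdry_top ?B" by (rule openin_Union) (auto simp: openin_cyl)
    ultimately show "openin bdry_top {x \<in> topspace bdry_top. g x \<in> U}" by simp
  qed simp
  ultimately show ?thesis using assms(2) by (simp add: K_def)
qed

lemma K_outside: "g \<in> K \<Longrightarrow> \<omega> \<notin> \<Omega> \<Longrightarrow> g \<omega> = 0" by (simp add: K_def)

text \<open>A common level for both arguments; \<open>F 0 0 = 0\<close> keeps the value off the boundary.\<close>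
lemma K_comp2:
  assumes "g \<in> K" "g' \<in> K" "F 0 0 = 0"
  shows "(\<lambda>\<omega>. F (g \<omega>) (g' \<omega>)) \<in> K"
proof -
  obtain N M where "constant_at_level N g" "constant_at_level M g'"
    using K_constant_at_level assms by metis
  then have "constant_at_level (max N M) g" "constant_at_level (max N M) g'"
    using constant_at_level_mono by simp_all
  then have "constant_at_level (max N M) (\<lambda>\<omega>. F (g \<omega>) (g' \<omega>))"
    unfolding constant_at_level_def by metis
  then show ?thesis by (rule K_I) (simp add: K_outside[OF assms(1)] K_outside[OF assms(2)] assms(3))
qed

lemma K_zero: "(\<lambda>_. 0) \<in> K" by (rule K_I[of 0]) (auto simp: constant_at_level_def)
lemma K_add: "g \<in> K \<Longrightarrow> g' \<in> K \<Longrightarrow> (\<lambda>\<omega>. g \<omega> + g' \<omega>) \<in> K" by (rule K_comp2) auto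
lemma K_diff: "g \<in> K \<Longrightarrow> g' \<in> K \<Longrightarrow> (\<lambda>\<omega>. g \<omega> - g' \<omega>) \<in> K" by (rule K_comp2) auto
lemma K_mult: "g \<in> K \<Longrightarrow> g' \<in> K \<Longrightarrow> (\<lambda>\<omega>. g \<omega> * g' \<omega>) \<in> K" by (rule K_comp2) auto
lemma K_scale: "g \<in> K \<Longrightarrow> (\<lambda>\<omega>. c * g \<omega>) \<in> K" by (rule K_comp2[of g g "\<lambda>x _. c * x"]) auto
lemma K_cnj: "g \<in> K \<Longrightarrow> (\<lambda>\<omega>. cnj (g \<omega>)) \<in> K" by (rule K_comp2[of g g "\<lambda>x _. cnj x"]) auto

lemma K_sum: "(\<And>i. i \<in> S \<Longrightarrow> f i \<in> K) \<Longrightarrow> (\<lambda>\<omega>. \<Sum>i\<in>S. f i \<omega>) \<in> K"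
  by (induction S rule: infinite_finite_induct) (auto intro: K_zero K_add)

lemma constant_at_level_cyl: "constant_at_level (level v) (indicator (cyl v))"
  by (auto simp: constant_at_level_def indicator_def cyl_iff)

lemma K_cyl: "indicator (cyl v) \<in> K"
  by (rule K_I[OF constant_at_level_cyl]) (auto simp: indicator_def cyl_def)

text \<open>The value of a function constant at level \<open>level v\<close> on the cylinder of \<open>v\<close>.\<close>
definition cyl_value :: "('v bdry \<Rightarrow> complex) \<Rightarrow> 'v \<Rightarrow> complex" where
  "cyl_value g v = g (SOME \<omega>. \<omega> \<in> cyl v)"

lemma constant_at_level_expand:
  assumes "constant_at_level N g" "\<And>\<omega>. \<omega> \<notin> \<Omega> \<Longrightarrow> g \<omega> = 0"
  shows "g = (\<lambda>\<omega>. \<Sum>v | level v = N. cyl_value g v * indicator (cyl v) \<omega>)"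
proof
  fix \<omega>
  show "g \<omega> = (\<Sum>v | level v = N. cyl_value g v * indicator (cyl v) \<omega>)"
  proof (cases "\<omega> \<in> \<Omega>")
    case True
    have "(\<Sum>v | level v = N. cyl_value g v * indicator (cyl v) \<omega>) = cyl_value g (ray \<omega> N)"
    proof (subst sum.remove[of _ "ray \<omega> N"])
      show "cyl_value g (ray \<omega> N) * indicator (cyl (ray \<omega> N)) \<omega> +
        (\<Sum>v\<in>{v. level v = N} - {ray \<omega> N}. cyl_value g v * indicator (cyl v) \<omega>) = cyl_value g (ray \<omega> N)"
        using True by (auto simp: indicator_def cyl_iff intro!: sum.neutral)
    qed (use True finite_level in auto)
    moreover have "(SOME \<omega>'. \<omega>' \<in> cyl (ray \<omega> N)) \<in> cyl (ray \<omega> N)"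
      by (rule someI[of _ \<omega>]) (use True in simp)
    then have "g \<omega> = cyl_value g (ray \<omega> N)"
      using assms(1) True unfolding cyl_value_def constant_at_level_def by (metis cyl_iff level_ray)
    ultimately show ?thesis by simp
  next
    case False
    then show ?thesis using assms(2) by (auto simp: indicator_def cyl_def)
  qed
qed

end


section \<open>Poisson kernels\<close>

context regular_tree
begin

definition poisson_kernel :: "complex \<Rightarrow> 'v \<Rightarrow> 'v bdry \<Rightarrow> complex" where
  "poisson_kernel a v \<omega> = (if \<omega> \<in> \<Omega> then a powi (horo \<omega> v) else 0)"

lemma poisson_eq_kernel: "poisson z m v = m (poisson_kernel (of_real (sqrt q) * z) v)"
  by (simp add: poisson_def poisson_kernel_def[abs_def])

lemma poisson_kernel_org: "poisson_kernel a org = indicator \<Omega>"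
  by (auto simp: poisson_kernel_def indicator_def)

text \<open>Horocycle heights at a vertex and at its parent differ by one, with the sign telling whether the
  end lies beyond the vertex; hence the kernels generate the indicators of the cylinders.\<close>
lemma poisson_kernel_parent:
  assumes "v \<noteq> org" "a \<noteq> 0"
  shows "poisson_kernel a v = (\<lambda>\<omega>. inverse a * poisson_kernel a (parent v) \<omega> +
    a ^ level v * (1 - inverse a ^ 2) * indicator (cyl v) \<omega>)"
proof
  fix \<omega>
  show "poisson_kernel a v \<omega> = inverse a * poisson_kernel a (parent v) \<omega> +
    a ^ level v * (1 - inverse a ^ 2) * indicator (cyl v) \<omega>"
  proof (cases "\<omega> \<in> \<Omega>")
    case True
    note h = horo_parent[OF True assms(1)]
    show ?thesis
    proof (cases "\<omega> \<in> cyl v")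
      case c: True
      have e: "horo \<omega> v = int (level v)" using horo_on_cyl[OF c] .
      then have "horo \<omega> (parent v) = int (level v) - 1" using h c by simp
      then have "a powi horo \<omega> (parent v) = a ^ level v * inverse a"
        using assms(2) by (simp add: power_int_diff divide_inverse)
      then show ?thesis using True c e by (simp add: poisson_kernel_def algebra_simps power2_eq_square)
    next
      case False
      then have "horo \<omega> v = horo \<omega> (parent v) - 1" using h by simp
      then have "a powi horo \<omega> v = inverse a * a powi horo \<omega> (parent v)"
        using assms(2) by (simp add: power_int_diff divide_inverse)
      then show ?thesis using True False by (simp add: poisson_kernel_def)
    qed
  next
    case False
    then show ?thesis using cyl_subset by (auto simp: poisson_kernel_def indicator_def)
  qed
qed

lemma poisson_kernel_K: "a \<noteq> 0 \<Longrightarrow> poisson_kernel a v \<in> K"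
proof (induction v rule: vertex_induct)
  case org
  then show ?case unfolding poisson_kernel_org using K_cyl[of org] by simp
next
  case (child v)
  show ?case
    unfolding poisson_kernel_parent[OF child(1,3)] using child
    by (intro K_add K_scale K_cyl) auto
qed

definition kernel_span :: "complex \<Rightarrow> ('v bdry \<Rightarrow> complex) set" where
  "kernel_span a = {g. \<exists>S c. finite S \<and> g = (\<lambda>\<omega>. \<Sum>v\<in>S. c v * poisson_kernel a v \<omega>)}"

lemma kernel_span_kernel: "poisson_kernel a v \<in> kernel_span a"
  unfolding kernel_span_def by (auto intro!: exI[of _ "{v}"] exI[of _ "\<lambda>_. 1"])

lemma kernel_span_zero: "(\<lambda>_. 0) \<in> kernel_span a"
  unfolding kernel_span_def by (auto intro!: exI[of _ "{}"])

lemma kernel_span_scale: "g \<in> kernel_span a \<Longrightarrow> (\<lambda>\<omega>. k * g \<omega>) \<in> kernel_span a"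
proof -
  assume "g \<in> kernel_span a"
  then obtain S c where "finite S" "g = (\<lambda>\<omega>. \<Sum>v\<in>S. c v * poisson_kernel a v \<omega>)"
    by (auto simp: kernel_span_def)
  then show ?thesis unfolding kernel_span_def
    by (auto intro!: exI[of _ S] exI[of _ "\<lambda>v. k * c v"] simp: sum_distrib_left mult.assoc)
qed

lemma kernel_span_add:
  assumes "g \<in> kernel_span a" "g' \<in> kernel_span a"
  shows "(\<lambda>\<omega>. g \<omega> + g' \<omega>) \<in> kernel_span a"
proof -
  obtain S c where S: "finite S" "g = (\<lambda>\<omega>. \<Sum>v\<in>S. c v * poisson_kernel a v \<omega>)"
    using assms(1) by (auto simp: kernel_span_def)
  obtain S' c' where S': "finite S'" "g' = (\<lambda>\<omega>. \<Sum>v\<in>S'. c' v * poisson_kernel a v \<omega>)"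
    using assms(2) by (auto simp: kernel_span_def)
  have "g \<omega> + g' \<omega> = (\<Sum>v\<in>S \<union> S'. ((if v \<in> S then c v else 0) + (if v \<in> S' then c' v else 0)) *
    poisson_kernel a v \<omega>)" for \<omega>
  proof -
    have "g \<omega> = (\<Sum>v\<in>S \<union> S'. (if v \<in> S then c v else 0) * poisson_kernel a v \<omega>)"
      unfolding S(2) using S(1) S'(1) by (intro sum.mono_neutral_cong_left) auto
    moreover have "g' \<omega> = (\<Sum>v\<in>S \<union> S'. (if v \<in> S' then c' v else 0) * poisson_kernel a v \<omega>)"
      unfolding S'(2) using S(1) S'(1) by (intro sum.mono_neutral_cong_left) auto
    ultimately show ?thesis by (simp add: ring_distribs sum.distrib)
  qed
  then show ?thesis
    unfolding kernel_span_def using S(1) S'(1)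
    by (intro CollectI exI[of _ "S \<union> S'"] exI conjI ext) auto
qed

lemma kernel_span_sum: "(\<And>i. i \<in> I \<Longrightarrow> f i \<in> kernel_span a) \<Longrightarrow> (\<lambda>\<omega>. \<Sum>i\<in>I. f i \<omega>) \<in> kernel_span a"
  by (induction I rule: infinite_finite_induct) (auto intro: kernel_span_zero kernel_span_add)

text \<open>The relation between the kernels at \<open>v\<close> and at its parent can be solved for the indicator, its
  coefficient being nonzero unless \<open>a\<close> is 1 or -1.\<close>
lemma cyl_kernel_span:
  assumes "a \<noteq> 0" "a\<^sup>2 \<noteq> 1"
  shows "indicator (cyl v) \<in> kernel_span a"
proof (cases "v = org")
  case True
  then show ?thesis using kernel_span_kernel[of a org] by (simp add: poisson_kernel_org)
next
  case False
  define k where "k = a ^ level v * (1 - inverse a ^ 2)"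
  have k: "k \<noteq> 0" using assms by (simp add: k_def field_simps)
  have "indicator (cyl v) = (\<lambda>\<omega>. (1 / k) * poisson_kernel a v \<omega> +
      (- inverse a / k) * poisson_kernel a (parent v) \<omega>)"
    using k unfolding poisson_kernel_parent[OF False assms(1), folded k_def]
    by (auto simp: field_simps)
  then show ?thesis by (simp only: kernel_span_add kernel_span_scale kernel_span_kernel)
qed

lemma K_kernel_span:
  assumes "a \<noteq> 0" "a\<^sup>2 \<noteq> 1" "g \<in> K"
  shows "g \<in> kernel_span a"
proof -
  obtain N where "constant_at_level N g" using K_constant_at_level assms(3) by metis
  from constant_at_level_expand[OF this K_outside[OF assms(3)]]
  have e: "g = (\<lambda>\<omega>. \<Sum>v | level v = N. cyl_value g v * indicator (cyl v) \<omega>)" .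
  show ?thesis
    by (subst e) (intro kernel_span_sum kernel_span_scale cyl_kernel_span assms(1,2))
qed

lemma K_dual_add: "m \<in> K_dual \<Longrightarrow> g \<in> K \<Longrightarrow> g' \<in> K \<Longrightarrow> m (\<lambda>\<omega>. g \<omega> + g' \<omega>) = m g + m g'"
  and K_dual_scale: "m \<in> K_dual \<Longrightarrow> g \<in> K \<Longrightarrow> m (\<lambda>\<omega>. c * g \<omega>) = c * m g"
  by (auto simp: K_dual_def)

lemma K_dual_sum:
  assumes "m \<in> K_dual" "finite S" "\<And>v. v \<in> S \<Longrightarrow> f v \<in> K"
  shows "m (\<lambda>\<omega>. \<Sum>v\<in>S. c v * f v \<omega>) = (\<Sum>v\<in>S. c v * m (f v))"
  using assms(2,3)
proof (induction S)
  case empty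
  have "m (\<lambda>\<omega>. 0 * 0) = 0 * m (\<lambda>_. 0)"
    by (rule K_dual_scale[OF assms(1) K_zero])
  then show ?case by simp
next
  case (insert v S)
  have "(\<lambda>\<omega>. c v * f v \<omega>) \<in> K" "(\<lambda>\<omega>. \<Sum>v\<in>S. c v * f v \<omega>) \<in> K"
    using insert by (auto intro!: K_scale K_sum)
  then have "m (\<lambda>\<omega>. c v * f v \<omega> + (\<Sum>v\<in>S. c v * f v \<omega>)) =
      m (\<lambda>\<omega>. c v * f v \<omega>) + m (\<lambda>\<omega>. \<Sum>v\<in>S. c v * f v \<omega>)"
    by (rule K_dual_add[OF assms(1)])
  moreover have "m (\<lambda>\<omega>. c v * f v \<omega>) = c v * m (f v)"
    using insert by (intro K_dual_scale[OF assms(1)]) simp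
  ultimately show ?case using insert by simp
qed

text \<open>A functional is determined by its values on the kernels, as these span \<open>K\<close>. This is the uniqueness
  behind all inverse Poisson transforms below; existence will always be exhibited by an explicit density.\<close>
lemma poisson_inj:
  assumes "m \<in> K_dual" "m' \<in> K_dual" "poisson z m = poisson z m'" "z \<noteq> 0" "of_nat q * z\<^sup>2 \<noteq> 1"
  shows "m = m'"
proof
  fix g
  define a where "a = of_real (sqrt q) * z"
  have a: "a \<noteq> 0" "a\<^sup>2 \<noteq> 1"
    using assms(4,5) q_ge_2 by (auto simp: a_def power_mult_distrib simp flip: of_real_power)
  show "m g = m' g"
  proof (cases "g \<in> K")
    case True
    then obtain S c where S: "finite S" "g = (\<lambda>\<omega>. \<Sum>v\<in>S. c v * poisson_kernel a v \<omega>)"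
      using K_kernel_span[OF a True] unfolding kernel_span_def by blast
    have "m (poisson_kernel a v) = m' (poisson_kernel a v)" for v
      using fun_cong[OF assms(3), of v] by (simp add: poisson_eq_kernel a_def)
    then show ?thesis using K_dual_sum[OF assms(1) S(1)] K_dual_sum[OF assms(2) S(1)]
        poisson_kernel_K[OF a(1)] S(2) by simp
  next
    case False
    then show ?thesis using assms(1,2) by (auto simp: K_dual_def)
  qed
qed

lemma poisson_inv_eqI:
  assumes "m \<in> K_dual" "poisson z m = F" "z \<noteq> 0" "of_nat q * z\<^sup>2 \<noteq> 1"
  shows "poisson_inv z F = m"
  unfolding poisson_inv_def
  by (rule the_equality) (use assms poisson_inj in blast)+

lemma cnj_poisson_kernel: "cnj (poisson_kernel a v \<omega>) = poisson_kernel (cnj a) v \<omega>"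
  by (simp add: poisson_kernel_def power_int_def)

end


section \<open>Pairings of Poisson kernels\<close>

context tree_boundary
begin

sublocale prob_space \<nu> by (rule prob)

lemma space_nu [simp]: "space \<nu> = \<Omega>"
proof -
  have "{U. openin bdry_top U} \<subseteq> Pow \<Omega>" using openin_subset[of bdry_top] by auto
  then show ?thesis using sets_eq_imp_space_eq[OF sets_nu] by (simp add: space_measure_of)
qed

lemma openin_sets: "openin bdry_top U \<Longrightarrow> U \<in> sets \<nu>"
proof -
  assume "openin bdry_top U"
  moreover have "{U. openin bdry_top U} \<subseteq> Pow \<Omega>" using openin_subset[of bdry_top] by auto
  ultimately show ?thesis unfolding sets_nu by (simp add: sets_measure_of)
qed

lemma cyl_sets [measurable]: "cyl v \<in> sets \<nu>"
  by (rule openin_sets[OF openin_cyl])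

lemma K_measurable: "g \<in> K \<Longrightarrow> g \<in> borel_measurable \<nu>"
proof -
  assume g: "g \<in> K"
  obtain N where "constant_at_level N g" using K_constant_at_level g by metis
  from constant_at_level_expand[OF this] K_outside[OF g]
  have e: "g = (\<lambda>\<omega>. \<Sum>v | level v = N. cyl_value g v * indicator (cyl v) \<omega>)" by metis
  show ?thesis by (subst e) measurable
qed

lemma K_bounded: "g \<in> K \<Longrightarrow> \<exists>B. \<forall>\<omega>. cmod (g \<omega>) \<le> B"
proof -
  assume g: "g \<in> K"
  have "finite (g ` \<Omega>)" using g by (simp add: K_def)
  then have "finite (cmod ` insert 0 (g ` \<Omega>))" by simp
  then obtain B where "\<And>y. y \<in> cmod ` insert 0 (g ` \<Omega>) \<Longrightarrow> y \<le> B"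
    using Max_ge by blast
  then have "cmod (g \<omega>) \<le> B" for \<omega> using K_outside[OF g, of \<omega>] by (cases "\<omega> \<in> \<Omega>") auto
  then show ?thesis by blast
qed

lemma K_integrable: "g \<in> K \<Longrightarrow> integrable \<nu> g"
  using K_bounded[of g] K_measurable[of g] by (auto intro: integrable_const_bound)

lemma K_square_integrable: "g \<in> K \<Longrightarrow> integrable \<nu> (\<lambda>\<omega>. (cmod (g \<omega>))\<^sup>2)"
  unfolding complex_of_real_integrable_eq[symmetric] complex_norm_square
  by (intro K_integrable K_mult K_cnj)

lemma measure_cyl_level:
  assumes "v \<noteq> org"
  shows "(1 + 1 / of_nat q) * of_nat q ^ level v * of_real (measure \<nu> (cyl v)) = (1 :: complex)"
proof -
  obtain n where n: "level v = Suc n" using level_parent[OF assms] by blast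
  have "(1 + 1 / real q) * real q ^ level v * measure \<nu> (cyl v) = 1"
  proof -
    have q0: "real q > 0" using q_ge_2 by simp
    have "(1 + 1 / real q) * real q ^ Suc n = (real q + 1) * real q ^ n"
    proof -
      have "(1 + 1 / real q) * real q = real q + 1" using q0 by (simp add: field_simps)
      then show ?thesis by (simp only: power_Suc mult.assoc[symmetric])
    qed
    moreover have "measure \<nu> (cyl v) = 1 / ((real q + 1) * real q ^ n)"
      unfolding measure_cyl[OF assms] n by (simp only: diff_Suc_1 of_nat_mult of_nat_add of_nat_power of_nat_1)
    moreover have "(real q + 1) * real q ^ n \<noteq> 0" using q0 by simp
    ultimately show ?thesis unfolding n by (simp only: nonzero_mult_div_cancel_left times_divide_eq_right mult_1_right)
      (rule divide_self)
  qed
  from arg_cong[OF this, of complex_of_real] show ?thesis by simp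
qed

lemma integral_cyl: "(\<integral>\<omega>. indicator (cyl v) \<omega> \<partial>\<nu>) = complex_of_real (measure \<nu> (cyl v))"
proof -
  have "(\<integral>\<omega>. indicator (cyl v) \<omega> \<partial>\<nu>) = (\<integral>\<omega>. complex_of_real (indicator (cyl v) \<omega>) \<partial>\<nu>)"
    by (intro Bochner_Integration.integral_cong) (auto simp: indicator_def)
  also have "\<dots> = complex_of_real (measure \<nu> (cyl v))"
    using cyl_subset[of v] by (simp add: Int_absorb2)
  finally show ?thesis .
qed

lemma measure_cyl_pos: "measure \<nu> (cyl v) > 0"
proof (cases "v = org")
  case True
  then show ?thesis using prob_space by simp
next
  case False
  then show ?thesis using measure_cyl[OF False] q_ge_2 by (simp add: add_pos_pos)
qed

lemma kernel_cyl_K: "a \<noteq> 0 \<Longrightarrow> (\<lambda>\<omega>. poisson_kernel a v \<omega> * indicator (cyl w) \<omega>) \<in> K"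
  by (intro K_mult poisson_kernel_K K_cyl)

text \<open>The integral of a kernel over a cylinder satisfies the recursion of the kernels, and the mass of
  a cylinder is a geometric sequence in the level.\<close>
lemma kernel_cyl_integral_parent:
  assumes "v \<noteq> org" "a \<noteq> 0" "below w v"
  shows "(\<integral>\<omega>. poisson_kernel a v \<omega> * indicator (cyl w) \<omega> \<partial>\<nu>) =
    inverse a * (\<integral>\<omega>. poisson_kernel a (parent v) \<omega> * indicator (cyl w) \<omega> \<partial>\<nu>) +
    a ^ level v * (1 - inverse a ^ 2) * of_real (measure \<nu> (cyl v))"
proof -
  have "poisson_kernel a v \<omega> * indicator (cyl w) \<omega> =
     inverse a * (poisson_kernel a (parent v) \<omega> * indicator (cyl w) \<omega>) +
     a ^ level v * (1 - inverse a ^ 2) * indicator (cyl v) \<omega>" for \<omega>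
    unfolding poisson_kernel_parent[OF assms(1,2)] using cyl_mono[OF assms(3)]
    by (auto simp: indicator_def algebra_simps)
  then have "(\<integral>\<omega>. poisson_kernel a v \<omega> * indicator (cyl w) \<omega> \<partial>\<nu>) =
     (\<integral>\<omega>. inverse a * (poisson_kernel a (parent v) \<omega> * indicator (cyl w) \<omega>) +
     a ^ level v * (1 - inverse a ^ 2) * indicator (cyl v) \<omega> \<partial>\<nu>)" by simp
  also have "\<dots> = inverse a * (\<integral>\<omega>. poisson_kernel a (parent v) \<omega> * indicator (cyl w) \<omega> \<partial>\<nu>) +
    a ^ level v * (1 - inverse a ^ 2) * of_real (measure \<nu> (cyl v))"
    using K_integrable[OF kernel_cyl_K[OF assms(2)]] K_integrable[OF K_cyl]
    by (subst Bochner_Integration.integral_add) (simp_all add: integral_cyl)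
  finally show ?thesis .
qed

text \<open>Solution of this recursion along the geodesic from \<open>w\<close> down to \<open>v\<close>. The factor \<open>a - b\<close> clears the
  denominator of a geometric sum with ratio \<open>a / b\<close>.\<close>
lemma kernel_cyl_integral_below:
  assumes "a * b = of_nat q" "w \<noteq> org" "below w v"
  shows "(1 + 1 / of_nat q) * (a - b) * b ^ level w *
      (\<integral>\<omega>. poisson_kernel a v \<omega> * indicator (cyl w) \<omega> \<partial>\<nu>) =
    (a - inverse a) * inverse b ^ tdist w v - (b - inverse a) * inverse a ^ tdist w v"
  using assms(3)
proof (induction v rule: vertex_induct)
  case org
  then show ?case using assms(2) by (auto simp: below_def)
next
  case (child v)
  have ab: "a \<noteq> 0" "b \<noteq> 0" using assms(1) q_ge_2 by auto
  have mass: "(1 + 1 / of_nat q) * (a ^ level v * b ^ level v) * of_real (measure \<nu> (cyl v)) = 1"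
    using measure_cyl_level[OF child(1)] by (simp add: assms(1) flip: power_mult_distrib)
  show ?case
  proof (cases "v = w")
    case True
    have "(\<integral>\<omega>. poisson_kernel a v \<omega> * indicator (cyl w) \<omega> \<partial>\<nu>) = (\<integral>\<omega>. a ^ level v * indicator (cyl v) \<omega> \<partial>\<nu>)"
      using cyl_subset[of v] unfolding True
      by (intro Bochner_Integration.integral_cong)
        (auto simp: poisson_kernel_def indicator_def horo_on_cyl)
    also have "\<dots> = a ^ level v * of_real (measure \<nu> (cyl v))" by (simp add: integral_cyl)
    finally have "(1 + 1 / of_nat q) * (a - b) * b ^ level w *
      (\<integral>\<omega>. poisson_kernel a v \<omega> * indicator (cyl w) \<omega> \<partial>\<nu>) =
      (a - b) * ((1 + 1 / of_nat q) * (a ^ level v * b ^ level v) * of_real (measure \<nu> (cyl v)))"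
      using True by (simp only: mult_ac)
    also have "\<dots> = a - b" unfolding mass by simp
    finally show ?thesis using True by simp
  next
    case False
    then have b: "below w (parent v)" using child below_parent by metis
    define I where "I = (\<integral>\<omega>. poisson_kernel a (parent v) \<omega> * indicator (cyl w) \<omega> \<partial>\<nu>)"
    define k where "k = (1 + 1 / of_nat q :: complex)"
    define m where "m = complex_of_real (measure \<nu> (cyl v))"
    have e: "tdist w v = Suc (tdist w (parent v))" "level v = level w + tdist w v"
      using b child(3) level_parent[OF child(1)] by (auto simp: below_def)
    define e' where "e' = tdist w (parent v)"
    have IH: "k * (a - b) * b ^ level w * I =
       (a - inverse a) * inverse b ^ e' - (b - inverse a) * inverse a ^ e'"
      using child(2)[OF b] by (simp add: I_def k_def e'_def)
    have m: "k * (a ^ level v * b ^ level w) * m = inverse b ^ Suc e'"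
    proof -
      have "b ^ level v = b ^ level w * b ^ Suc e'" using e by (simp add: e'_def power_add)
      then have "k * (a ^ level v * b ^ level w) * m * b ^ Suc e' = 1"
        using mass by (simp add: k_def m_def ac_simps)
      then show ?thesis using ab by (simp add: field_simps)
    qed
    have "k * (a - b) * b ^ level w * (inverse a * I + a ^ level v * (1 - inverse a ^ 2) * m) =
      inverse a * (k * (a - b) * b ^ level w * I) +
        (a - b) * (1 - inverse a ^ 2) * (k * (a ^ level v * b ^ level w) * m)"
      by (simp add: algebra_simps)
    also have "\<dots> = inverse a * ((a - inverse a) * inverse b ^ e' - (b - inverse a) * inverse a ^ e') +
        (a - b) * (1 - inverse a ^ 2) * inverse b ^ Suc e'"
      unfolding IH m ..
    also have "\<dots> = (a - inverse a) * inverse b ^ Suc e' - (b - inverse a) * inverse a ^ Suc e'"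
      using ab by (simp add: field_simps power2_eq_square)
    finally show ?thesis
      unfolding kernel_cyl_integral_parent[OF child(1) ab(1) child(3)]
      by (simp add: I_def k_def m_def e'_def e)
  qed
qed

text \<open>As \<open>v\<close> lies outside, the kernel is constant on the cylinder.\<close>
lemma kernel_cyl_integral_not_below:
  assumes "a * b = of_nat q" "w \<noteq> org" "\<not> below w v"
  shows "(1 + 1 / of_nat q) * b ^ level w *
      (\<integral>\<omega>. poisson_kernel a v \<omega> * indicator (cyl w) \<omega> \<partial>\<nu>) = inverse a ^ tdist v w"
proof -
  have ab: "a \<noteq> 0" "b \<noteq> 0" using assms(1) q_ge_2 by auto
  have "(\<integral>\<omega>. poisson_kernel a v \<omega> * indicator (cyl w) \<omega> \<partial>\<nu>) =
      (\<integral>\<omega>. a ^ level w * inverse a ^ tdist v w * indicator (cyl w) \<omega> \<partial>\<nu>)"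
    using cyl_subset[of w] ab
    by (intro Bochner_Integration.integral_cong)
      (auto simp: poisson_kernel_def indicator_def horo_cyl[OF _ assms(2,3)] power_int_diff field_simps)
  also have "\<dots> = a ^ level w * inverse a ^ tdist v w * of_real (measure \<nu> (cyl w))"
    by (simp add: integral_cyl)
  finally have "(1 + 1 / of_nat q) * b ^ level w *
      (\<integral>\<omega>. poisson_kernel a v \<omega> * indicator (cyl w) \<omega> \<partial>\<nu>) =
      ((1 + 1 / of_nat q) * (a * b) ^ level w * of_real (measure \<nu> (cyl w))) * inverse a ^ tdist v w"
    by (simp add: power_mult_distrib)
  then show ?thesis using measure_cyl_level[OF assms(2)] by (simp add: assms(1))
qed

definition kernel_pairing :: "complex \<Rightarrow> complex \<Rightarrow> 'v \<Rightarrow> 'v \<Rightarrow> complex" where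
  "kernel_pairing a b v w = (\<integral>\<omega>. poisson_kernel a v \<omega> * poisson_kernel b w \<omega> \<partial>\<nu>)"

text \<open>That \<open>v\<close> and \<open>w\<close> enter through their distance only is remarkable, since \<open>\<nu>\<close> and the
  heights are normalised at \<open>org\<close>. The reason is that \<open>q\<close> to the power of the height at \<open>w\<close> is the density
  with respect to \<open>\<nu>\<close> of the harmonic measure seen from \<open>w\<close>, so that \<open>a * b = q\<close> makes the pairing the
  integral of \<open>a\<close> to the power of the difference of the heights against that measure. The proof is an induction on both vertices.\<close>
lemma kernel_pairing_eq:
  assumes "a * b = of_nat q"
  shows "(1 + 1 / of_nat q) * (a - b) * kernel_pairing a b v w =
    (a - inverse a) * inverse b ^ tdist v w - (b - inverse b) * inverse a ^ tdist v w"
proof (induction w arbitrary: v rule: vertex_induct)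
  case org
  have ab: "a \<noteq> 0" "b \<noteq> 0" using assms(1) q_ge_2 by auto
  define k where "k = (1 + 1 / of_nat q :: complex)"
  have pair: "kernel_pairing a b v org = (\<integral>\<omega>. poisson_kernel a v \<omega> * indicator (cyl org) \<omega> \<partial>\<nu>)" for v
    by (simp add: kernel_pairing_def poisson_kernel_org)
  show ?case unfolding pair
  proof (induction v rule: vertex_induct)
    case org
    have "(\<integral>\<omega>. poisson_kernel a org \<omega> * indicator (cyl org) \<omega> \<partial>\<nu>) = (\<integral>\<omega>. indicator \<Omega> \<omega> \<partial>\<nu>)"
      by (intro Bochner_Integration.integral_cong) (auto simp: poisson_kernel_org indicator_def)
    also have "\<dots> = 1" using integral_cyl[of org] prob_space by simp
    finally have one: "(\<integral>\<omega>. poisson_kernel a org \<omega> * indicator (cyl org) \<omega> \<partial>\<nu>) = 1" .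
    show ?case unfolding one assms[symmetric] using ab by (simp add: field_simps)
  next
    case (child v)
    define I where "I = (\<integral>\<omega>. poisson_kernel a (parent v) \<omega> * indicator (cyl org) \<omega> \<partial>\<nu>)"
    define m where "m = complex_of_real (measure \<nu> (cyl v))"
    define e where "e = tdist (parent v) org"
    have e: "tdist v org = Suc e" "level v = Suc e"
      using level_parent[OF child(1)] by (simp_all add: e_def tdist_sym)
    have m: "k * a ^ level v * m = inverse b ^ Suc e"
    proof -
      have "k * (a ^ level v * b ^ level v) * m = 1"
        using measure_cyl_level[OF child(1)] by (simp add: k_def m_def assms flip: power_mult_distrib)
      then have "k * a ^ level v * m * b ^ Suc e = 1" by (simp only: e(2) mult_ac)
      then show ?thesis using ab by (simp add: field_simps)
    qed
    have IH: "k * (a - b) * I = (a - inverse a) * inverse b ^ e - (b - inverse b) * inverse a ^ e"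
      using child(2) by (simp add: I_def k_def e_def)
    have "k * (a - b) * (inverse a * I + a ^ level v * (1 - inverse a ^ 2) * m) =
      inverse a * (k * (a - b) * I) + (a - b) * (1 - inverse a ^ 2) * (k * a ^ level v * m)"
      by (simp add: algebra_simps)
    also have "\<dots> = inverse a * ((a - inverse a) * inverse b ^ e - (b - inverse b) * inverse a ^ e) +
       (a - b) * (1 - inverse a ^ 2) * inverse b ^ Suc e" unfolding IH m ..
    also have "\<dots> = (a - inverse a) * inverse b ^ Suc e - (b - inverse b) * inverse a ^ Suc e"
      using ab by (simp add: field_simps power2_eq_square)
    finally show ?case
      unfolding kernel_cyl_integral_parent[OF child(1) ab(1) below_org]
      by (simp add: I_def k_def m_def e)
  qed
next
  case (child w)
  have ab: "a \<noteq> 0" "b \<noteq> 0" using assms(1) q_ge_2 by auto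
  define k where "k = (1 + 1 / of_nat q :: complex)"
  define J where "J = (\<integral>\<omega>. poisson_kernel a v \<omega> * indicator (cyl w) \<omega> \<partial>\<nu>)"
  define P where "P = kernel_pairing a b v (parent w)"
  have "poisson_kernel a v \<omega> * poisson_kernel b w \<omega> =
      inverse b * (poisson_kernel a v \<omega> * poisson_kernel b (parent w) \<omega>) +
      b ^ level w * (1 - inverse b ^ 2) * (poisson_kernel a v \<omega> * indicator (cyl w) \<omega>)" for \<omega>
    unfolding poisson_kernel_parent[OF child(1) ab(2)] by (simp add: algebra_simps)
  then have "kernel_pairing a b v w =
      (\<integral>\<omega>. inverse b * (poisson_kernel a v \<omega> * poisson_kernel b (parent w) \<omega>) +
      b ^ level w * (1 - inverse b ^ 2) * (poisson_kernel a v \<omega> * indicator (cyl w) \<omega>) \<partial>\<nu>)"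
    by (simp add: kernel_pairing_def)
  also have "\<dots> = inverse b * P + b ^ level w * (1 - inverse b ^ 2) * J"
    using K_integrable[OF kernel_cyl_K[OF ab(1)]]
      K_integrable[OF K_mult[OF poisson_kernel_K[OF ab(1)] poisson_kernel_K[OF ab(2)]]]
    by (subst Bochner_Integration.integral_add) (simp_all add: J_def P_def kernel_pairing_def)
  finally have rec: "kernel_pairing a b v w = inverse b * P + b ^ level w * (1 - inverse b ^ 2) * J" .
  have pair: "k * (a - b) * kernel_pairing a b v w = inverse b * (k * (a - b) * P) +
      (a - b) * (1 - inverse b ^ 2) * (k * b ^ level w * J)"
    unfolding rec by (simp add: algebra_simps)
  \<comment> \<open>With the pairing at \<open>parent w\<close> and the integral over the cylinder of \<open>w\<close> known, it remains to
    distinguish on which side of the edge from \<open>w\<close> to its parent the vertex \<open>v\<close> lies.\<close>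
  have IH: "k * (a - b) * P = (a - inverse a) * inverse b ^ tdist v (parent w) -
      (b - inverse b) * inverse a ^ tdist v (parent w)"
    using child(2)[of v] by (simp add: P_def k_def)
  have "k * (a - b) * kernel_pairing a b v w =
    (a - inverse a) * inverse b ^ tdist v w - (b - inverse b) * inverse a ^ tdist v w"
  proof (cases "below w v")
    case True
    define e where "e = tdist v w"
    have d: "tdist v (parent w) = Suc e" "tdist w v = e" 
      using below_tdist[OF child(1) True] by (simp_all add: e_def tdist_sym)
    have "(a - b) * (k * b ^ level w * J) =
        (a - inverse a) * inverse b ^ e - (b - inverse a) * inverse a ^ e"
      using kernel_cyl_integral_below[OF assms child(1) True] by (simp add: d k_def J_def ac_simps)
    then have "k * (a - b) * kernel_pairing a b v w =
        inverse b * ((a - inverse a) * inverse b ^ Suc e - (b - inverse b) * inverse a ^ Suc e) +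
        (1 - inverse b ^ 2) * ((a - inverse a) * inverse b ^ e - (b - inverse a) * inverse a ^ e)"
      unfolding pair IH d by (simp add: ac_simps)
    also have "\<dots> = (a - inverse a) * inverse b ^ e - (b - inverse b) * inverse a ^ e"
      using ab by (simp add: field_simps power2_eq_square)
    finally show ?thesis by (simp add: e_def)
  next
    case False
    define e where "e = tdist v (parent w)"
    have d: "tdist v (parent w) = e" "tdist v w = Suc e"
      using not_below_tdist[OF child(1) False] by (simp_all add: e_def)
    have "k * b ^ level w * J = inverse a ^ Suc e"
      using kernel_cyl_integral_not_below[OF assms child(1) False] by (simp add: d k_def J_def)
    then have "k * (a - b) * kernel_pairing a b v w =
        inverse b * ((a - inverse a) * inverse b ^ e - (b - inverse b) * inverse a ^ e) +
        (a - b) * (1 - inverse b ^ 2) * inverse a ^ Suc e"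
      unfolding pair IH d by simp
    also have "\<dots> = (a - inverse a) * inverse b ^ Suc e - (b - inverse b) * inverse a ^ Suc e"
      using ab by (simp add: field_simps power2_eq_square)
    finally show ?thesis by (simp add: d)
  qed
  then show ?case by (simp add: k_def)
qed

text \<open>The explicit formula is symmetric in the vertices; it is void for \<open>a = b\<close>, where the definition is
  symmetric.\<close>
lemma kernel_pairing_sym:
  assumes "a * b = of_nat q"
  shows "kernel_pairing a b v w = kernel_pairing a b w v"
proof (cases "a = b")
  case True
  then show ?thesis by (simp add: kernel_pairing_def mult.commute)
next
  case False
  have "1 + 1 / of_nat q \<noteq> (0 :: complex)"
  proof -
    have "1 + 1 / real q \<noteq> 0" using q_ge_2 by (simp add: field_simps)
    from this[unfolded of_real_eq_0_iff[where 'a = complex, symmetric]] show ?thesis by simp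
  qed
  then have "(1 + 1 / of_nat q) * (a - b) \<noteq> 0" using False by simp
  moreover have "(1 + 1 / of_nat q) * (a - b) * kernel_pairing a b v w =
      (1 + 1 / of_nat q) * (a - b) * kernel_pairing a b w v"
    unfolding kernel_pairing_eq[OF assms] tdist_sym[of w v] ..
  ultimately show ?thesis by (rule mult_left_cancel[THEN iffD1])
qed


section \<open>Densities and the intertwining operator\<close>

lemma density_fnl_K_dual: "g \<in> K \<Longrightarrow> density_fnl g \<in> K_dual"
proof -
  assume g: "g \<in> K"
  have "integrable \<nu> (\<lambda>\<omega>. \<phi> \<omega> * g \<omega>)" if "\<phi> \<in> K" for \<phi>
    using K_integrable[OF K_mult[OF that g]] .
  then show ?thesis
    unfolding K_dual_def density_fnl_def by (auto simp: K_add K_scale ring_distribs mult.assoc)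
qed

text \<open>Testing against its conjugate shows that a locally constant function vanishes with its density,
  because every cylinder has positive mass.\<close>
lemma density_fnl_inj:
  assumes "g \<in> K" "g' \<in> K" "density_fnl g = density_fnl g'"
  shows "g = g'"
proof -
  define d where "d \<omega> = g \<omega> - g' \<omega>" for \<omega>
  have d: "d \<in> K" using K_diff assms unfolding d_def[abs_def] by blast
  obtain N where N: "constant_at_level N d" using K_constant_at_level d by metis
  have "(\<integral>\<omega>. cnj (d \<omega>) * g \<omega> \<partial>\<nu>) = (\<integral>\<omega>. cnj (d \<omega>) * g' \<omega> \<partial>\<nu>)"
    using fun_cong[OF assms(3), of "\<lambda>\<omega>. cnj (d \<omega>)"] K_cnj[OF d] by (simp add: density_fnl_def)
  then have "(\<integral>\<omega>. cnj (d \<omega>) * g \<omega> - cnj (d \<omega>) * g' \<omega> \<partial>\<nu>) = 0"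
    using assms(1,2) d by (subst Bochner_Integration.integral_diff) (auto intro!: K_integrable K_mult K_cnj)
  then have "(\<integral>\<omega>. complex_of_real ((cmod (d \<omega>))\<^sup>2) \<partial>\<nu>) = 0"
    by (simp only: d_def complex_norm_square left_diff_distrib right_diff_distrib mult.commute)
  then have z: "(\<integral>\<omega>. (cmod (d \<omega>))\<^sup>2 \<partial>\<nu>) = 0"
    by (subst (asm) integral_complex_of_real) simp
  note int = K_square_integrable[OF d]
  have "d \<omega> = 0" if o: "\<omega> \<in> \<Omega>" for \<omega>
  proof (rule ccontr)
    assume nz: "d \<omega> \<noteq> 0"
    have "(\<integral>\<omega>'. (cmod (d \<omega>))\<^sup>2 * indicator (cyl (ray \<omega> N)) \<omega>' \<partial>\<nu>) \<le> (\<integral>\<omega>. (cmod (d \<omega>))\<^sup>2 \<partial>\<nu>)"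
    proof (rule integral_mono)
      show "integrable \<nu> (\<lambda>\<omega>'. (cmod (d \<omega>))\<^sup>2 * indicator (cyl (ray \<omega> N)) \<omega>')"
        using cyl_subset[of "ray \<omega> N"]
        by (simp add: integrable_indicator_iff emeasure_eq_measure Int_absorb2)
      fix \<omega>'
      show "(cmod (d \<omega>))\<^sup>2 * indicator (cyl (ray \<omega> N)) \<omega>' \<le> (cmod (d \<omega>'))\<^sup>2"
      proof (cases "\<omega>' \<in> cyl (ray \<omega> N)")
        case True
        then have "\<omega>' \<in> \<Omega>" "ray \<omega>' N = ray \<omega> N" using o by (auto simp: cyl_iff)
        then have "d \<omega>' = d \<omega>" using N o unfolding constant_at_level_def by blast
        then show ?thesis using True by simp
      qed simp
    qed (rule int)
    then have "(cmod (d \<omega>))\<^sup>2 * measure \<nu> (cyl (ray \<omega> N)) \<le> 0"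
      using cyl_subset[of "ray \<omega> N"] by (simp add: z Int_absorb2)
    then show False using nz measure_cyl_pos[of "ray \<omega> N"]
      by (simp add: mult_le_0_iff)
  qed
  then have "d \<omega> = 0" for \<omega> using K_outside[OF d] by blast
  then show ?thesis unfolding d_def by (intro ext) simp
qed

lemma fun_of_density: "g \<in> K \<Longrightarrow> fun_of (density_fnl g) = g"
  unfolding fun_of_def by (rule the_equality) (use density_fnl_inj in blast)+

lemma poisson_density:
  "z \<noteq> 0 \<Longrightarrow> poisson z (density_fnl g) v = (\<integral>\<omega>. poisson_kernel (of_real (sqrt q) * z) v \<omega> * g \<omega> \<partial>\<nu>)"
  using q_ge_2 by (simp add: poisson_eq_kernel density_fnl_def poisson_kernel_K)

lemma circle_nonsingular:
  assumes "cmod z = 1"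
  shows "z \<noteq> 0" "of_nat q * z\<^sup>2 \<noteq> 1" "inverse z = cnj z" "cmod (inverse z) = 1"
proof -
  show "z \<noteq> 0" using assms by auto
  have "cmod (of_nat q * z\<^sup>2) = real q" using assms by (simp add: norm_mult norm_power)
  then show "of_nat q * z\<^sup>2 \<noteq> 1" using q_ge_2 by (metis norm_one of_nat_1 of_nat_eq_iff one_eq_numeral_iff numeral_One Suc_1 not_less_eq_eq order_refl One_nat_def)
  show "inverse z = cnj z" using assms by (simp add: inverse_complex_def complex_eq_iff cmod_def)
  show "cmod (inverse z) = 1" using assms by (simp add: norm_inverse)
qed

lemma fun_of_poisson_inv:
  assumes "cmod z = 1" "g \<in> K" "poisson z (density_fnl g) = F"
  shows "fun_of (poisson_inv z F) = g"
  using poisson_inv_eqI[OF density_fnl_K_dual[OF assms(2)] assms(3)] circle_nonsingular[OF assms(1)]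
    fun_of_density[OF assms(2)] by simp

lemma intertwiner_eqI:
  assumes "cmod z = 1" "g' \<in> K" "poisson z (density_fnl g') = poisson (inverse z) (density_fnl g)"
  shows "intertwiner z g = g'"
  unfolding intertwiner_def
proof (rule the_equality)
  fix g'' assume g'': "g'' \<in> K \<and> poisson z (density_fnl g'') = poisson (inverse z) (density_fnl g)"
  then show "g'' = g'"
    using fun_of_poisson_inv[OF assms(1,2,3)]
      fun_of_poisson_inv[OF assms(1), of g'' "poisson (inverse z) (density_fnl g)"] by simp
qed (simp add: assms)

text \<open>The Poisson transforms \<open>poisson z\<close> and \<open>poisson (inverse z)\<close> integrate against the kernels with
  parameters \<open>a_of z\<close> and \<open>b_of z\<close>, whose product is \<open>q\<close>.\<close>
abbreviation a_of :: "complex \<Rightarrow> complex" where "a_of z \<equiv> of_real (sqrt q) * z"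
abbreviation b_of :: "complex \<Rightarrow> complex" where "b_of z \<equiv> of_real (sqrt q) * inverse z"

lemma a_b: "z \<noteq> 0 \<Longrightarrow> a_of z * b_of z = of_nat q"
  by (simp add: field_simps flip: of_real_mult)

lemma a_nz: "z \<noteq> 0 \<Longrightarrow> a_of z \<noteq> 0" and b_nz: "z \<noteq> 0 \<Longrightarrow> b_of z \<noteq> 0"
  using q_ge_2 by auto

definition kernel_sum :: "complex \<Rightarrow> 'v set \<Rightarrow> ('v \<Rightarrow> complex) \<Rightarrow> 'v bdry \<Rightarrow> complex" where
  "kernel_sum a S c \<omega> = (\<Sum>w\<in>S. c w * poisson_kernel a w \<omega>)"

lemma kernel_sum_K: "a \<noteq> 0 \<Longrightarrow> kernel_sum a S c \<in> K"
  unfolding kernel_sum_def[abs_def] by (intro K_sum K_scale poisson_kernel_K)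

lemma integral_kernel_sum:
  assumes "a \<noteq> 0" "b \<noteq> 0"
  shows "(\<integral>\<omega>. poisson_kernel a v \<omega> * kernel_sum b S c \<omega> \<partial>\<nu>) = (\<Sum>w\<in>S. c w * kernel_pairing a b v w)"
proof -
  have "(\<integral>\<omega>. poisson_kernel a v \<omega> * kernel_sum b S c \<omega> \<partial>\<nu>) =
      (\<integral>\<omega>. (\<Sum>w\<in>S. c w * (poisson_kernel a v \<omega> * poisson_kernel b w \<omega>)) \<partial>\<nu>)"
    by (simp add: kernel_sum_def sum_distrib_left mult.left_commute)
  also have "\<dots> = (\<Sum>w\<in>S. c w * kernel_pairing a b v w)"
    using assms unfolding kernel_pairing_def
    by (subst Bochner_Integration.integral_sum) (auto intro!: K_integrable K_scale K_mult[OF poisson_kernel_K poisson_kernel_K])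
  finally show ?thesis .
qed

lemma integral_kernel_sum2:
  assumes "a \<noteq> 0" "b \<noteq> 0"
  shows "(\<integral>\<omega>. kernel_sum a S c \<omega> * kernel_sum b S' c' \<omega> \<partial>\<nu>) =
    (\<Sum>v\<in>S. \<Sum>w\<in>S'. c v * c' w * kernel_pairing a b v w)"
proof -
  have "(\<integral>\<omega>. kernel_sum a S c \<omega> * kernel_sum b S' c' \<omega> \<partial>\<nu>) =
      (\<integral>\<omega>. (\<Sum>v\<in>S. c v * (poisson_kernel a v \<omega> * kernel_sum b S' c' \<omega>)) \<partial>\<nu>)"
    by (simp add: kernel_sum_def[of a] sum_distrib_right mult.assoc)
  also have "\<dots> = (\<Sum>v\<in>S. c v * (\<Sum>w\<in>S'. c' w * kernel_pairing a b v w))"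
    using assms 
    by (subst Bochner_Integration.integral_sum)
      (auto intro!: K_integrable K_scale K_mult[OF poisson_kernel_K kernel_sum_K] simp: integral_kernel_sum)
  finally show ?thesis by (simp add: sum_distrib_left mult.assoc)
qed

lemma cnj_kernel_sum: "cnj (kernel_sum a S c \<omega>) = kernel_sum (cnj a) S (\<lambda>w. cnj (c w)) \<omega>"
  by (simp add: kernel_sum_def cnj_poisson_kernel)

text \<open>The intertwining operator exchanges the two families of kernels: both sides have the same
  Poisson transform because pairings are symmetric in the two vertices.\<close>
lemma intertwiner_kernel_sum:
  assumes "cmod z = 1"
  shows "intertwiner z (kernel_sum (a_of z) S c) = kernel_sum (b_of z) S c"
proof (rule intertwiner_eqI[OF assms])
  note z = circle_nonsingular[OF assms]
  show "kernel_sum (b_of z) S c \<in> K" using kernel_sum_K b_nz z by blast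
  show "poisson z (density_fnl (kernel_sum (b_of z) S c)) =
      poisson (inverse z) (density_fnl (kernel_sum (a_of z) S c))"
  proof
    fix v
    have "kernel_pairing (a_of z) (b_of z) v w = kernel_pairing (b_of z) (a_of z) v w" for w
      unfolding kernel_pairing_sym[OF a_b[OF z(1)], of v w]
      by (simp add: kernel_pairing_def mult.commute)
    then show "poisson z (density_fnl (kernel_sum (b_of z) S c)) v =
      poisson (inverse z) (density_fnl (kernel_sum (a_of z) S c)) v"
      using z(1) a_nz[OF z(1)] b_nz[OF z(1)] by (simp add: poisson_density integral_kernel_sum)
  qed
qed

lemma K_kernel_sum:
  assumes "cmod z = 1" "g \<in> K"
  obtains S c where "finite S" "g = kernel_sum (a_of z) S c"
proof -
  note z = circle_nonsingular[OF assms(1)]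
  have "(a_of z)\<^sup>2 \<noteq> 1"
    using z by (simp add: power_mult_distrib flip: of_real_power)
  then have "g \<in> kernel_span (a_of z)" using K_kernel_span[OF a_nz] z assms by blast
  then show thesis using that unfolding kernel_span_def kernel_sum_def[abs_def] by blast
qed

lemma intertwiner_K: "cmod z = 1 \<Longrightarrow> g \<in> K \<Longrightarrow> intertwiner z g \<in> K"
  by (metis K_kernel_sum intertwiner_kernel_sum kernel_sum_K b_nz circle_nonsingular(1))

lemma poisson_intertwiner:
  assumes "cmod z = 1" "g \<in> K"
  shows "poisson z (density_fnl (intertwiner z g)) = poisson (inverse z) (density_fnl g)"
proof -
  obtain S c where g: "g = kernel_sum (a_of z) S c" using K_kernel_sum assms by metis
  note z = circle_nonsingular[OF assms(1)]
  have "kernel_pairing (a_of z) (b_of z) v w = kernel_pairing (b_of z) (a_of z) v w" for v w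
    unfolding kernel_pairing_sym[OF a_b[OF z(1)], of v w]
    by (simp add: kernel_pairing_def mult.commute)
  then show ?thesis
    using z(1) a_nz[OF z(1)] b_nz[OF z(1)] unfolding g intertwiner_kernel_sum[OF assms(1)]
    by (simp add: poisson_density integral_kernel_sum fun_eq_iff)
qed

lemma intertwiner_diff:
  assumes "cmod z = 1" "g \<in> K" "g' \<in> K"
  shows "intertwiner z (\<lambda>\<omega>. g \<omega> - g' \<omega>) = (\<lambda>\<omega>. intertwiner z g \<omega> - intertwiner z g' \<omega>)"
proof (rule intertwiner_eqI[OF assms(1)])
  note z = circle_nonsingular[OF assms(1)]
  note I = intertwiner_K[OF assms(1,2)] intertwiner_K[OF assms(1,3)]
  show "(\<lambda>\<omega>. intertwiner z g \<omega> - intertwiner z g' \<omega>) \<in> K" using I by (rule K_diff)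
  have diff: "poisson y (density_fnl (\<lambda>\<omega>. f \<omega> - f' \<omega>)) = 
      (\<lambda>v. poisson y (density_fnl f) v - poisson y (density_fnl f') v)" 
    if "f \<in> K" "f' \<in> K" "y \<noteq> 0" for f f' y
    using that a_nz
    by (simp add: poisson_density fun_eq_iff right_diff_distrib Bochner_Integration.integral_diff
        K_integrable K_mult poisson_kernel_K)
  show "poisson z (density_fnl (\<lambda>\<omega>. intertwiner z g \<omega> - intertwiner z g' \<omega>)) =
      poisson (inverse z) (density_fnl (\<lambda>\<omega>. g \<omega> - g' \<omega>))"
    using z I assms by (simp add: diff poisson_intertwiner)
qed

lemma K_L2: "g \<in> K \<Longrightarrow> g \<in> L2_space \<nu>"
  by (simp add: L2_space_def K_measurable K_square_integrable)

text \<open>On the circle \<open>b_of z\<close> is the conjugate of \<open>a_of z\<close>, so that inner products of kernels with parameter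
  \<open>a_of z\<close> are pairings of the kind above.\<close>
lemma L2_norm_kernel_sum:
  assumes "cmod z = 1"
  shows "complex_of_real ((L2_norm \<nu> (kernel_sum (a_of z) S c))\<^sup>2) =
    (\<Sum>v\<in>S. \<Sum>w\<in>S. c v * cnj (c w) * kernel_pairing (a_of z) (b_of z) v w)"
proof -
  note z = circle_nonsingular[OF assms]
  have "complex_of_real ((L2_norm \<nu> (kernel_sum (a_of z) S c))\<^sup>2) =
      (\<integral>\<omega>. complex_of_real ((cmod (kernel_sum (a_of z) S c \<omega>))\<^sup>2) \<partial>\<nu>)"
    by (simp add: L2_norm_def del: of_real_power)
  also have "\<dots> = (\<integral>\<omega>. kernel_sum (a_of z) S c \<omega> * kernel_sum (b_of z) S (\<lambda>w. cnj (c w)) \<omega> \<partial>\<nu>)"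
    unfolding complex_norm_square cnj_kernel_sum by (simp add: z)
  also have "\<dots> = (\<Sum>v\<in>S. \<Sum>w\<in>S. c v * cnj (c w) * kernel_pairing (a_of z) (b_of z) v w)"
    using integral_kernel_sum2[OF a_nz[OF z(1)] b_nz[OF z(1)]] by simp
  finally show ?thesis .
qed

text \<open>The Gram matrices of the two families of kernels agree, again by symmetry of the pairing.\<close>
lemma L2_norm_intertwiner:
  assumes "cmod z = 1" "g \<in> K"
  shows "L2_norm \<nu> (intertwiner z g) = L2_norm \<nu> g"
proof -
  obtain S c where g: "g = kernel_sum (a_of z) S c" using K_kernel_sum assms by metis
  note z = circle_nonsingular[OF assms(1)]
  have sym: "kernel_pairing (b_of z) (a_of z) v w = kernel_pairing (a_of z) (b_of z) v w" for v w
    unfolding kernel_pairing_sym[OF a_b[OF z(1)], of v w]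
    by (simp add: kernel_pairing_def mult.commute)
  have "complex_of_real ((L2_norm \<nu> (intertwiner z g))\<^sup>2) = complex_of_real ((L2_norm \<nu> g)\<^sup>2)"
    unfolding g intertwiner_kernel_sum[OF assms(1)] L2_norm_kernel_sum[OF assms(1)]
    using L2_norm_kernel_sum[OF z(4), of S c] by (simp add: sym del: of_real_power)
  then have "(L2_norm \<nu> (intertwiner z g))\<^sup>2 = (L2_norm \<nu> g)\<^sup>2" by (simp only: of_real_eq_iff)
  then show ?thesis by (simp add: L2_norm_def)
qed

end


section \<open>Solutions of the wave equation\<close>

context regular_tree
begin

text \<open>\<open>cheb n d\<close> is the kernel, at distance \<open>d\<close>, of the Chebyshev polynomial of the second kind of
  degree \<open>n\<close> in the operator \<open>adj / (2 sqrt q)\<close>.\<close>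
definition cheb :: "nat \<Rightarrow> nat \<Rightarrow> complex" where
  "cheb n d = (if d \<le> n \<and> even (n - d) then of_real (1 / sqrt q) ^ n else 0)"

text \<open>The solution with data \<open>(0, \<delta>)\<close> at distance \<open>d\<close>.\<close>
definition fund :: "int \<Rightarrow> nat \<Rightarrow> complex" where
  "fund t d = (if t > 0 then cheb (nat t - 1) d else if t < 0 then - cheb (nat (- t) - 1) d else 0)"

lemma fund_0 [simp]: "fund 0 d = 0" by (simp add: fund_def)
lemma fund_Suc: "fund (int (Suc n)) d = cheb n d" by (simp add: fund_def del: of_nat_Suc)
lemma fund_minus: "fund (- t) d = - fund t d" by (simp add: fund_def)

text \<open>The radial part of the adjacency operator: one neighbour toward \<open>x\<close>, and \<open>q\<close> away from it.\<close>
lemma adj_radial: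
  "adj (\<lambda>w. F (tdist x w)) v = (if v = x then of_nat (q + 1) * F 1
     else F (tdist x v - 1) + of_nat q * F (tdist x v + 1))"
proof (cases "v = x")
  case True
  have "adj (\<lambda>w. F (tdist x w)) v = (\<Sum>w | E v w. F 1)"
    unfolding adj_def True by (intro sum.cong) (auto simp: tdist_edge)
  then show ?thesis using degree[of v] True by simp
next
  case False
  then obtain p where p: "E v p" "tdist x v = Suc (tdist x p)"
    "\<And>w. E v w \<Longrightarrow> w \<noteq> p \<Longrightarrow> tdist x w = Suc (tdist x v)"
    using tdist_nbr[of x v] by metis
  have "adj (\<lambda>w. F (tdist x w)) v = F (tdist x p) + (\<Sum>w\<in>{w. E v w} - {p}. F (tdist x w))"
    unfolding adj_def using p finite_nbrs by (subst sum.remove[of _ p]) auto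
  also have "(\<Sum>w\<in>{w. E v w} - {p}. F (tdist x w)) = (\<Sum>w\<in>{w. E v w} - {p}. F (tdist x v + 1))"
    using p by (intro sum.cong) auto
  also have "\<dots> = of_nat q * F (tdist x v + 1)"
    using degree[of v] p finite_nbrs[of v] by simp
  finally show ?thesis using p False by simp
qed

lemma q_sqrt: "of_real (1 / sqrt q) * of_real (sqrt q) = (1 :: complex)"
  "of_real (sqrt q) * of_real (sqrt q) = (of_nat q :: complex)" "of_real (sqrt q) \<noteq> (0 :: complex)"
proof -
  have "sqrt q \<noteq> 0" using q_ge_2 by simp
  then have "1 / sqrt q * sqrt q = 1" by simp
  from arg_cong[OF this, of complex_of_real]
  show "of_real (1 / sqrt q) * of_real (sqrt q) = (1 :: complex)" by (simp only: of_real_mult of_real_1)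
  show "of_real (sqrt q) \<noteq> (0 :: complex)" using q_ge_2 by simp
  show "of_real (sqrt q) * of_real (sqrt q) = (of_nat q :: complex)" by (simp flip: of_real_mult)
qed

text \<open>The three-term recursion of the Chebyshev polynomials.\<close>
lemma cheb_adj_Suc:
  "adj (\<lambda>w. cheb (Suc n) (tdist x w)) v =
    of_real (sqrt q) * (cheb (Suc (Suc n)) (tdist x v) + cheb n (tdist x v))"
proof -
  define r where "r = (of_real (1 / sqrt q) :: complex)"
  define s where "s = (of_real (sqrt q) :: complex)"
  have rs: "r * s = 1" "s * s = of_nat q" using q_sqrt by (simp_all add: r_def s_def)
  have sr: "s * (r * y) = y" for y using rs by (metis mult.commute mult.left_commute mult_1_right)
  have qr: "of_nat q * (r * y) = s * y" for y using rs by (metis mult.assoc sr)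
  show ?thesis
  proof (cases "v = x")
    case True
    then show ?thesis
      unfolding adj_radial[of "cheb (Suc n)"] unfolding cheb_def r_def[symmetric] s_def[symmetric]
      by (auto simp: ring_distribs sr qr)
  next
    case False
    then obtain d where d: "tdist x v = Suc d" by (metis not0_implies_Suc tdist_eq_0_iff)
    have 1: "d \<le> Suc n \<and> even (Suc n - d) \<longleftrightarrow> Suc d \<le> Suc (Suc n) \<and> even (Suc (Suc n) - Suc d)"
      by auto
    have 2: "d + 2 \<le> Suc n \<and> even (Suc n - (d + 2)) \<longleftrightarrow> Suc d \<le> n \<and> even (n - Suc d)"
      by auto
    have "cheb (Suc n) d + of_nat q * cheb (Suc n) (d + 2) = s * (cheb (Suc (Suc n)) (Suc d) + cheb n (Suc d))"
      unfolding cheb_def 1 2 r_def[symmetric] by (auto simp: ring_distribs sr qr)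
    then show ?thesis using False d by (simp add: adj_radial[of "cheb (Suc n)"] s_def)
  qed
qed

lemma cheb_adj_0:
  "adj (\<lambda>w. cheb 0 (tdist x w)) v = of_real (sqrt q) * cheb 1 (tdist x v)"
proof -
  have "of_real (sqrt q) * of_real (1 / sqrt q) = (1 :: complex)" using q_sqrt(1) by (simp only: mult.commute)
  then show ?thesis
    unfolding adj_radial[of "cheb 0"] unfolding cheb_def
    by (cases "v = x") (auto simp del: of_real_divide simp: le_Suc_eq)
qed

lemma adj_uminus: "adj (\<lambda>w. - F w) v = - adj F v"
  by (simp add: adj_def sum_negf)

lemma adj_zero: "adj (\<lambda>w. 0) v = 0" by (simp add: adj_def)

lemma fund_wave:
  "adj (\<lambda>w. fund t (tdist x w)) v = of_real (sqrt q) * (fund (t + 1) (tdist x v) + fund (t - 1) (tdist x v))"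
proof -
  have pos: "adj (\<lambda>w. fund (int (Suc n)) (tdist x w)) v =
    of_real (sqrt q) * (fund (int (Suc n) + 1) (tdist x v) + fund (int (Suc n) - 1) (tdist x v))" for n
  proof (cases n)
    case 0
    have "fund 2 d = cheb 1 d" for d by (simp add: fund_def)
    then show ?thesis using 0 fund_Suc[of 0] by (simp add: cheb_adj_0)
  next
    case (Suc m)
    have "int (Suc n) + 1 = int (Suc (Suc (Suc m)))" "int (Suc n) - 1 = int (Suc m)" using Suc by auto
    then show ?thesis unfolding fund_Suc Suc by (simp only: fund_Suc cheb_adj_Suc)
  qed
  consider n where "t = int (Suc n)" | "t = 0" | n where "t = - int (Suc n)"
    by (metis int_cases2 nat.exhaust of_nat_0 minus_zero)
  then show ?thesis
  proof cases
    case 1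
    then show ?thesis using pos by simp
  next
    case 2
    then show ?thesis using fund_minus[of 1] by (simp add: adj_zero)
  next
    case (3 n)
    have "t + 1 = - (int (Suc n) - 1)" "t - 1 = - (int (Suc n) + 1)" using 3 by auto
    then show ?thesis using pos[of n] unfolding 3
      by (simp only: fund_minus adj_uminus) (simp add: algebra_simps)
  qed
qed

text \<open>The equation at time 0 gives the sum of \<open>u v 1\<close> and \<open>u v (-1)\<close>, the second datum their difference;
  from two consecutive times the equation determines the solution in both directions of time.\<close>
lemma wave_unique:
  fixes u u' :: "'v \<Rightarrow> int \<Rightarrow> complex"
  assumes "\<And>v t. adj (\<lambda>w. u w t) v / of_real (2 * sqrt q) = (u v (t + 1) + u v (t - 1)) / 2"
    and "\<And>v t. adj (\<lambda>w. u' w t) v / of_real (2 * sqrt q) = (u' v (t + 1) + u' v (t - 1)) / 2"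
    and "\<And>v. u v 0 = u' v 0" "\<And>v. (u v 1 - u v (-1)) / 2 = (u' v 1 - u' v (-1)) / 2"
  shows "u = u'"
proof -
  define B where "B f v = adj f v / of_real (2 * sqrt q)" for f v
  have up: "u v (t + 1) = 2 * B (\<lambda>w. u w t) v - u v (t - 1)" for v t
    using assms(1)[of t v] by (simp add: B_def field_simps)
  have up': "u' v (t + 1) = 2 * B (\<lambda>w. u' w t) v - u' v (t - 1)" for v t
    using assms(2)[of t v] by (simp add: B_def field_simps)
  have one: "u v 1 = u' v 1 \<and> u v (-1) = u' v (-1)" for v
  proof -
    have "u v 1 + u v (-1) = u' v 1 + u' v (-1)"
      using up[of v 0] up'[of v 0] assms(3) by simp
    moreover have "a = c \<and> b = d" if "a + b = c + d" "(a - b) / 2 = (c - d) / 2" for a b c d :: complex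
      using that by (simp add: complex_eq_iff)
    ultimately show ?thesis using assms(4)[of v] by blast
  qed
  have "(\<forall>v. u v (int n) = u' v (int n)) \<and> (\<forall>v. u v (int (Suc n)) = u' v (int (Suc n)))" for n
  proof (induction n)
    case 0
    then show ?case using assms(3) one by simp
  next
    case (Suc n)
    have e: "int (Suc (Suc n)) = int (Suc n) + 1" "int (Suc n) - 1 = int n" by auto
    have "u v (int (Suc (Suc n))) = u' v (int (Suc (Suc n)))" for v
      unfolding e(1) up up' e(2) using Suc by simp
    then show ?case using Suc by blast
  qed
  moreover have "(\<forall>v. u v (- int n) = u' v (- int n)) \<and> (\<forall>v. u v (- int (Suc n)) = u' v (- int (Suc n)))" for n
  proof (induction n)
    case 0
    then show ?case using assms(3) one by simp
  next
    case (Suc n)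
    have e: "- int (Suc (Suc n)) = - int (Suc n) - 1" "- int (Suc n) + 1 = - int n" by auto
    have "u v (- int (Suc n) - 1) = u' v (- int (Suc n) - 1)" for v
      using up[of v "- int (Suc n)"] up'[of v "- int (Suc n)"] Suc unfolding e(2) by simp
    then show ?case using Suc unfolding e(1) by blast
  qed
  ultimately have "u v t = u' v t" for v t by (metis int_cases2)
  then show ?thesis by blast
qed

lemma adj_sum: "adj (\<lambda>w. \<Sum>i\<in>S. F i w) v = (\<Sum>i\<in>S. adj (F i) v)"
  unfolding adj_def by (rule sum.swap)

lemma adj_cmult: "adj (\<lambda>w. c * F w) v = c * adj F v"
  by (simp add: adj_def sum_distrib_left)

lemma adj_add: "adj (\<lambda>w. F w + G w) v = adj F v + adj G v"
  by (simp add: adj_def sum.distrib)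

lemma adj_diff: "adj (\<lambda>w. F w - G w) v = adj F v - adj G v"
  by (simp add: adj_def sum_subtractf)

text \<open>The first component of the data is propagated by half the difference of \<open>fund\<close> at the times
  \<open>t + 1\<close> and \<open>t - 1\<close>, which is the Chebyshev polynomial of the first kind.\<close>
definition wave_fun :: "'v set \<Rightarrow> 'v data \<Rightarrow> 'v \<Rightarrow> int \<Rightarrow> complex" where
  "wave_fun S f v t = (\<Sum>x\<in>S. fst f x * ((fund (t + 1) (tdist x v) - fund (t - 1) (tdist x v)) / 2) +
     snd f x * fund t (tdist x v))"

lemma cheb_small: "cheb 0 d = (if d = 0 then 1 else 0)"
  by (simp add: cheb_def)

definition supports :: "'v set \<Rightarrow> 'v data \<Rightarrow> bool" where
  "supports S f \<longleftrightarrow> finite S \<and> (\<forall>v. v \<notin> S \<longrightarrow> fst f v = 0 \<and> snd f v = 0)"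

lemma data_supports: "f \<in> data \<Longrightarrow> supports ({v. fst f v \<noteq> 0} \<union> {v. snd f v \<noteq> 0}) f"
  by (auto simp: data_def supports_def)

lemma supports_data: "supports S f \<Longrightarrow> f \<in> data"
  unfolding data_def supports_def by (auto intro: finite_subset[of _ S])

lemma wave_sol_eq:
  assumes "supports S f"
  shows "wave_sol f = wave_fun S f"
  unfolding wave_sol_def
proof (rule the_equality)
  have fin: "finite S" using assms by (simp add: supports_def)
  have f2: "fund 2 d = cheb 1 d" "fund 1 d = cheb 0 d" "fund (-1) d = - cheb 0 d"
    "fund (-2) d = - cheb 1 d" for d by (simp_all add: fund_def)
  have delta: "(\<Sum>x\<in>S. h x * cheb 0 (tdist x v)) = h v" if "\<And>x. x \<notin> S \<Longrightarrow> h x = 0" for h v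
    using that fin by (simp add: cheb_small if_distrib cong: if_cong)
  have W: "adj (\<lambda>w. wave_fun S f w t) v / of_real (2 * sqrt q) = (wave_fun S f v (t + 1) + wave_fun S f v (t - 1)) / 2" for v t
  proof -
    have "adj (\<lambda>w. wave_fun S f w t) v =
       (\<Sum>x\<in>S. fst f x * ((adj (\<lambda>w. fund (t + 1) (tdist x w)) v - adj (\<lambda>w. fund (t - 1) (tdist x w)) v) / 2) +
        snd f x * adj (\<lambda>w. fund t (tdist x w)) v)"
    proof -
      have "fst f x * ((a - b) / 2) = fst f x / 2 * (a - b)" for x and a b :: complex by simp
      then show ?thesis unfolding wave_fun_def adj_sum by (simp only: adj_add adj_cmult adj_diff)
    qed
    also have "\<dots> = of_real (sqrt q) * (wave_fun S f v (t + 1) + wave_fun S f v (t - 1))"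
      unfolding fund_wave wave_fun_def sum.distrib[symmetric] sum_distrib_left
      by (intro sum.cong refl) (simp add: field_simps)
    finally show ?thesis using q_sqrt(3) by simp
  qed
  have I: "wave_fun S f v 0 = fst f v" "(wave_fun S f v 1 - wave_fun S f v (-1)) / 2 = snd f v" for v
  proof -
    have "wave_fun S f v 0 = (\<Sum>x\<in>S. fst f x * cheb 0 (tdist x v))"
      unfolding wave_fun_def by (intro sum.cong refl) (simp add: f2)
    also have "\<dots> = fst f v" by (rule delta) (use assms in \<open>simp add: supports_def\<close>)
    finally show "wave_fun S f v 0 = fst f v" .
    have "(wave_fun S f v 1 - wave_fun S f v (-1)) / 2 = (\<Sum>x\<in>S. snd f x * cheb 0 (tdist x v))"
      unfolding wave_fun_def sum_subtractf[symmetric] sum_divide_distrib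
      by (intro sum.cong refl) (simp add: f2 field_simps)
    also have "\<dots> = snd f v" by (rule delta) (use assms in \<open>simp add: supports_def\<close>)
    finally show "(wave_fun S f v 1 - wave_fun S f v (-1)) / 2 = snd f v" .
  qed
  show "(\<forall>v t. adj (\<lambda>w. wave_fun S f w t) v / of_real (2 * sqrt q) = (wave_fun S f v (t + 1) + wave_fun S f v (t - 1)) / 2) \<and>
     (\<forall>v. wave_fun S f v 0 = fst f v) \<and> (\<forall>v. (wave_fun S f v 1 - wave_fun S f v (-1)) / 2 = snd f v)"
    using W I by blast
  fix u :: "'v \<Rightarrow> int \<Rightarrow> complex"
  assume u: "(\<forall>v t. adj (\<lambda>w. u w t) v / of_real (2 * sqrt q) = (u v (t + 1) + u v (t - 1)) / 2) \<and>
     (\<forall>v. u v 0 = fst f v) \<and> (\<forall>v. (u v 1 - u v (-1)) / 2 = snd f v)"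
  show "u = wave_fun S f"
    by (rule wave_unique) (use u W I in simp_all)
qed


section \<open>The Fourier transform in time\<close>

text \<open>The generating function of \<open>fund\<close>. At distance \<open>d\<close> the polynomials of degree \<open>d + 2 * j\<close> contribute,
  which gives a geometric series for positive times and, by oddness, another one for negative times.\<close>
definition fund_hat :: "complex \<Rightarrow> nat \<Rightarrow> complex" where
  "fund_hat z d = z * (z / of_real (sqrt q)) ^ d / (1 - z\<^sup>2 / of_nat q) -
     inverse z * (inverse z / of_real (sqrt q)) ^ d / (1 - (inverse z)\<^sup>2 / of_nat q)"

lemma cheb_has_sum:
  assumes "cmod z = 1"
  shows "((\<lambda>n. cheb n d * z ^ Suc n) has_sum z * (z / of_real (sqrt q)) ^ d / (1 - z\<^sup>2 / of_nat q)) UNIV"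
proof -
  define y where "y = z / of_real (sqrt q)"
  have y: "y\<^sup>2 = z\<^sup>2 / of_nat q" using q_sqrt(2) by (simp add: y_def power_divide power2_eq_square)
  have "cmod (y\<^sup>2) = 1 / real q" using assms by (simp add: y norm_divide norm_power)
  then have y1: "cmod (y\<^sup>2) < 1" using q_ge_2 by simp
  have s: "(\<lambda>j. (y\<^sup>2) ^ j) sums (1 / (1 - y\<^sup>2))" by (rule geometric_sums[OF y1])
  have "summable (\<lambda>j. norm ((y\<^sup>2) ^ j))" unfolding norm_power[of "y\<^sup>2"] by (rule summable_geometric) (use y1 in simp)
  then have "((\<lambda>j. (y\<^sup>2) ^ j) has_sum (1 / (1 - y\<^sup>2))) UNIV"
    using s by (rule norm_summable_imp_has_sum)
  then have h: "((\<lambda>j. z * y ^ d * (y\<^sup>2) ^ j) has_sum z * y ^ d * (1 / (1 - y\<^sup>2))) UNIV"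
    by (rule has_sum_cmult_right)
  have "((\<lambda>n. cheb n d * z ^ Suc n) has_sum z * y ^ d * (1 / (1 - y\<^sup>2))) (range (\<lambda>j. d + 2 * j))"
  proof (subst has_sum_reindex)
    show "inj (\<lambda>j. d + 2 * j)" by (simp add: inj_on_def)
    have e: "cheb (d + 2 * j) d * z ^ Suc (d + 2 * j) = z * y ^ d * (y\<^sup>2) ^ j" for j
    proof -
      have "cheb (d + 2 * j) d = of_real (1 / sqrt q) ^ (d + 2 * j)" by (simp add: cheb_def)
      then have "cheb (d + 2 * j) d * z ^ Suc (d + 2 * j) = z * y ^ (d + 2 * j)"
        by (simp add: y_def power_divide)
      then show ?thesis by (simp add: power_add power_mult)
    qed
    show "((\<lambda>n. cheb n d * z ^ Suc n) \<circ> (\<lambda>j. d + 2 * j) has_sum z * y ^ d * (1 / (1 - y\<^sup>2))) UNIV"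
      using h by (simp only: o_def e)
  qed
  then have "((\<lambda>n. cheb n d * z ^ Suc n) has_sum z * y ^ d * (1 / (1 - y\<^sup>2))) UNIV"
  proof (rule has_sum_cong_neutral[THEN iffD1, rotated -1])
    fix n assume n: "n \<in> UNIV - range (\<lambda>j. d + 2 * j)"
    have "\<not> (d \<le> n \<and> even (n - d))"
    proof
      assume a: "d \<le> n \<and> even (n - d)"
      then have "even (n - d)" ..
      then obtain j where j: "n - d = 2 * j" by (rule evenE)
      then have "n = d + 2 * j" using a by arith
      then show False using n by blast
    qed
    then have "cheb n d = 0" unfolding cheb_def by (rule if_not_P)
    then show "cheb n d * z ^ Suc n = 0" by simp
  qed auto
  then show ?thesis unfolding y by (simp add: y_def)
qed

lemma fund_has_sum:
  assumes "cmod z = 1"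
  shows "((\<lambda>t. fund t d * z powi t) has_sum fund_hat z d) UNIV"
proof -
  have z0: "z \<noteq> 0" using assms by auto
  have P: "((\<lambda>t. fund t d * z powi t) has_sum z * (z / of_real (sqrt q)) ^ d / (1 - z\<^sup>2 / of_nat q))
    (range (\<lambda>n. int (Suc n)))"
    using cheb_has_sum[OF assms, of d]
    by (subst has_sum_reindex) (simp add: inj_on_def, simp only: o_def fund_Suc power_int_of_nat)
  have "cmod (inverse z) = 1" using assms by (simp add: norm_inverse)
  note h = cheb_has_sum[OF this, of d]
  have N: "((\<lambda>t. fund t d * z powi t) has_sum - (inverse z * (inverse z / of_real (sqrt q)) ^ d / (1 - (inverse z)\<^sup>2 / of_nat q)))
    (range (\<lambda>n. - int (Suc n)))"
  proof (subst has_sum_reindex)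
    show "inj (\<lambda>n. - int (Suc n))" by (simp add: inj_on_def)
    have "fund (- int (Suc n)) d * z powi (- int (Suc n)) = - (cheb n d * inverse z ^ Suc n)" for n
      unfolding fund_minus fund_Suc power_int_minus power_int_of_nat power_inverse by simp
    then show "((\<lambda>t. fund t d * z powi t) \<circ> (\<lambda>n. - int (Suc n)) has_sum
       - (inverse z * (inverse z / of_real (sqrt q)) ^ d / (1 - (inverse z)\<^sup>2 / of_nat q))) UNIV"
      using has_sum_cmult_right[OF h, of "-1"] by (simp only: o_def mult_minus1)
  qed
  have "((\<lambda>t. fund t d * z powi t) has_sum fund_hat z d) (range (\<lambda>n. int (Suc n)) \<union> range (\<lambda>n. - int (Suc n)))"
  proof -
    have "range (\<lambda>n. int (Suc n)) \<inter> range (\<lambda>n. - int (Suc n)) = {}" by auto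
    from has_sum_Un_disjoint[OF P N this] show ?thesis
      unfolding fund_hat_def by (simp only: diff_conv_add_uminus)
  qed
  then show ?thesis
  proof (rule has_sum_cong_neutral[THEN iffD1, rotated -1])
    fix t assume t: "t \<in> UNIV - (range (\<lambda>n. int (Suc n)) \<union> range (\<lambda>n. - int (Suc n)))"
    have "t = 0"
    proof (rule ccontr)
      assume "t \<noteq> 0"
      then have "t = int (Suc (nat t - 1)) \<or> t = - int (Suc (nat (- t) - 1))" by arith
      then show False using t by blast
    qed
    then show "fund t d * z powi t = 0" by simp
  qed auto
qed

lemma fund_shift_has_sum:
  assumes "cmod z = 1"
  shows "((\<lambda>t. fund (t + s) d * z powi t) has_sum fund_hat z d * z powi (- s)) UNIV"
proof -
  have z0: "z \<noteq> 0" using assms by auto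
  have "((\<lambda>t. fund t d * z powi t * z powi (- s)) has_sum fund_hat z d * z powi (- s)) UNIV"
    by (rule has_sum_cmult_left[OF fund_has_sum[OF assms]])
  moreover have "bij_betw (\<lambda>t. t + s) UNIV (UNIV :: int set)"
    by (rule bij_betwI[where g = "\<lambda>t. t - s"]) auto
  ultimately have "((\<lambda>t. fund (t + s) d * z powi (t + s) * z powi (- s)) has_sum fund_hat z d * z powi (- s)) UNIV"
    using has_sum_reindex_bij_betw[of "\<lambda>t. t + s" UNIV UNIV "\<lambda>t. fund t d * z powi t * z powi (- s)"] by simp
  moreover have "fund (t + s) d * z powi (t + s) * z powi (- s) = fund (t + s) d * z powi t" for t
    using z0 by (simp add: mult.assoc flip: power_int_add)
  ultimately show ?thesis by simp
qed

lemma has_sum_finite_sum: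
  fixes F :: "'i \<Rightarrow> int \<Rightarrow> complex"
  assumes "finite S" "\<And>x. x \<in> S \<Longrightarrow> (F x has_sum s x) A"
  shows "((\<lambda>t. \<Sum>x\<in>S. F x t) has_sum (\<Sum>x\<in>S. s x)) A"
  using assms by (induction S) (auto intro: has_sum_add)

text \<open>A shift in time becomes a power of \<open>z\<close>; hence the first component of the data enters the transform
  with the factor \<open>(inverse z - z) / 2\<close>.\<close>
definition symbol :: "'v data \<Rightarrow> complex \<Rightarrow> 'v \<Rightarrow> complex" where
  "symbol f z w = (inverse z - z) / 2 * fst f w + snd f w"

lemma wave_hat_eq:
  assumes "supports S f" "cmod z = 1"
  shows "wave_hat f z v = (\<Sum>w\<in>S. symbol f z w * fund_hat z (tdist w v))"
  unfolding wave_hat_def wave_sol_eq[OF assms(1)]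
proof (rule infsumI)
  have z0: "z \<noteq> 0" using assms(2) by auto
  have fin: "finite S" using assms by (simp add: supports_def)
  have one: "((\<lambda>t. (fst f x * ((fund (t + 1) d - fund (t - 1) d) / 2) + snd f x * fund t d) * z powi t)
    has_sum symbol f z x * fund_hat z d) UNIV" for x d
  proof -
    have "((\<lambda>t. fst f x / 2 * (fund (t + 1) d * z powi t) + (- (fst f x / 2)) * (fund (t + (-1)) d * z powi t) + snd f x * (fund t d * z powi t))
      has_sum (fst f x / 2 * (fund_hat z d * z powi (- 1)) + (- (fst f x / 2)) * (fund_hat z d * z powi (- (- 1))) + snd f x * fund_hat z d)) UNIV"
      by (intro has_sum_add has_sum_cmult_right fund_shift_has_sum fund_has_sum assms)
    moreover have "fst f x / 2 * (fund_hat z d * z powi (- 1)) + (- (fst f x / 2)) * (fund_hat z d * z powi (- (- 1))) + snd f x * fund_hat z d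
       = symbol f z x * fund_hat z d"
      by (simp add: symbol_def power_int_minus field_simps)
    ultimately show ?thesis by (simp add: field_simps)
  qed
  have "((\<lambda>t. \<Sum>x\<in>S. (fst f x * ((fund (t + 1) (tdist x v) - fund (t - 1) (tdist x v)) / 2) + snd f x * fund t (tdist x v)) * z powi t)
    has_sum (\<Sum>w\<in>S. symbol f z w * fund_hat z (tdist w v))) UNIV"
    by (intro has_sum_finite_sum one fin)
  then show "((\<lambda>t. wave_fun S f v t * z powi t) has_sum (\<Sum>w\<in>S. symbol f z w * fund_hat z (tdist w v))) UNIV"
    by (simp add: wave_fun_def sum_distrib_right)
qed

end


section \<open>The translation representations of finitely supported data\<close>

context tree_boundary
begin

lemma circle_denom:
  assumes "cmod z = 1"
  shows "1 - z\<^sup>2 / of_nat q \<noteq> 0" "1 - (inverse z)\<^sup>2 / of_nat q \<noteq> 0"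
proof -
  have "1 - y\<^sup>2 / of_nat q \<noteq> 0" if "cmod y = 1" for y
  proof
    assume "1 - y\<^sup>2 / of_nat q = 0"
    then have "cmod (y\<^sup>2 / of_nat q) = 1" by simp
    then show False using that q_ge_2 by (simp add: norm_divide norm_power)
  qed
  then show "1 - z\<^sup>2 / of_nat q \<noteq> 0" "1 - (inverse z)\<^sup>2 / of_nat q \<noteq> 0"
    using assms by (auto simp: norm_inverse)
qed

lemma q_plus_1: "1 + 1 / of_nat q \<noteq> (0 :: complex)"
proof -
  have "1 + 1 / real q \<noteq> 0" using q_ge_2 by (simp add: field_simps)
  from this[unfolded of_real_eq_0_iff[where 'a = complex, symmetric]] show ?thesis by simp
qed

text \<open>The factor between the transform of the fundamental solution and the pairing of kernels.\<close>
definition hat_const :: "complex \<Rightarrow> complex" where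
  "hat_const z = (1 + 1 / of_nat q) * (z - inverse z) / ((1 - z\<^sup>2 / of_nat q) * (1 - (inverse z)\<^sup>2 / of_nat q))"

text \<open>Both sides are the same combination of \<open>(z / sqrt q) ^ d\<close> and \<open>(inverse z / sqrt q) ^ d\<close>, where \<open>d\<close> is
  the distance. Read as a function of \<open>v\<close>, the pairing is the Poisson transform of a kernel, so this
  inverts the Poisson transform of \<open>wave_hat\<close> explicitly.\<close>
lemma fund_hat_pairing:
  assumes "cmod z = 1"
  shows "fund_hat z (tdist v w) = hat_const z * kernel_pairing (a_of z) (b_of z) v w"
proof -
  note z = circle_nonsingular[OF assms]
  define s where "s = (of_real (sqrt q) :: complex)"
  have s: "s \<noteq> 0" "s * s = of_nat q" using q_sqrt by (simp_all add: s_def)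
  define y where "y = inverse z"
  have zy: "z * y = 1" using z(1) by (simp add: y_def)
  define P where "P = 1 - z\<^sup>2 / of_nat q"
  define Q where "Q = 1 - y\<^sup>2 / of_nat q"
  have PQ: "P \<noteq> 0" "Q \<noteq> 0" using circle_denom[OF assms] by (simp_all add: P_def Q_def y_def)
  define X where "X = (z / s) ^ tdist v w"
  define Y where "Y = (y / s) ^ tdist v w"
  define \<Phi> where "\<Phi> = kernel_pairing (a_of z) (b_of z) v w"
  have ia: "inverse (s * z) = y / s" and ib: "inverse (s * y) = z / s"
    using zy s z by (simp_all add: y_def field_simps)
  have a: "s * z - inverse (s * z) = s * z * Q"
  proof -
    have "s * z * (y\<^sup>2 / (s * s)) = (z * y) * y / s" using s(1) by (simp add: power2_eq_square field_simps)
    then have "s * z * (y\<^sup>2 / (s * s)) = y / s" by (simp add: zy)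
    then show ?thesis unfolding Q_def ia by (simp add: s(2) right_diff_distrib)
  qed
  have b: "s * y - inverse (s * y) = s * y * P"
  proof -
    have "s * y * (z\<^sup>2 / (s * s)) = (z * y) * z / s" using s(1) by (simp add: power2_eq_square field_simps)
    then have "s * y * (z\<^sup>2 / (s * s)) = z / s" by (simp add: zy)
    then show ?thesis unfolding P_def ib by (simp add: s(2) right_diff_distrib)
  qed
  have "(1 + 1 / of_nat q) * (s * z - s * y) * \<Phi> = (s * z - inverse (s * z)) * inverse (s * y) ^ tdist v w -
      (s * y - inverse (s * y)) * inverse (s * z) ^ tdist v w"
    using kernel_pairing_eq[OF a_b[OF z(1)], of v w] by (simp only: \<Phi>_def s_def y_def)
  then have "s * ((1 + 1 / of_nat q) * (z - y) * \<Phi>) = s * (z * Q * X - y * P * Y)"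
    unfolding a b unfolding ia ib X_def[symmetric] Y_def[symmetric]
    by (simp add: algebra_simps diff_divide_distrib)
  then have e: "(1 + 1 / of_nat q) * (z - y) * \<Phi> = z * Q * X - y * P * Y" using s(1) by simp
  have "hat_const z * \<Phi> = ((1 + 1 / of_nat q) * (z - y) * \<Phi>) / (P * Q)"
    by (simp add: hat_const_def P_def Q_def y_def)
  also have "\<dots> = z * X / P - y * Y / Q" unfolding e using PQ by (simp add: divide_simps)
  also have "\<dots> = fund_hat z (tdist v w)"
    by (simp add: fund_hat_def P_def Q_def X_def Y_def s_def y_def)
  finally show ?thesis by (simp add: \<Phi>_def)
qed

lemma R_plus_eq:
  assumes "supports S f" "cmod z = 1"
  shows "R_plus f z = kernel_sum (b_of z) S (\<lambda>w. hat_const z * symbol f z w)"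
  unfolding R_plus_def
proof (rule fun_of_poisson_inv[OF assms(2)])
  note z = circle_nonsingular[OF assms(2)]
  show "kernel_sum (b_of z) S (\<lambda>w. hat_const z * symbol f z w) \<in> K"
    by (rule kernel_sum_K[OF b_nz[OF z(1)]])
  show "poisson z (density_fnl (kernel_sum (b_of z) S (\<lambda>w. hat_const z * symbol f z w))) = wave_hat f z"
  proof
    fix v
    have "poisson z (density_fnl (kernel_sum (b_of z) S (\<lambda>w. hat_const z * symbol f z w))) v =
       (\<Sum>w\<in>S. symbol f z w * (hat_const z * kernel_pairing (a_of z) (b_of z) v w))"
      using z(1) a_nz[OF z(1)] b_nz[OF z(1)]
      by (simp add: poisson_density integral_kernel_sum mult.assoc mult.left_commute)
    then show "poisson z (density_fnl (kernel_sum (b_of z) S (\<lambda>w. hat_const z * symbol f z w))) v = wave_hat f z v"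
      unfolding fund_hat_pairing[OF assms(2), symmetric] wave_hat_eq[OF assms]
      by (simp add: tdist_sym[of v])
  qed
qed

text \<open>Since the pairing is symmetric in the vertices, \<open>wave_hat f z\<close> is the Poisson transform of kernel sums
  with parameter \<open>b_of z\<close> and, with the opposite parameter, of kernel sums with parameter \<open>a_of z\<close>.\<close>
lemma R_minus_eq:
  assumes "supports S f" "cmod z = 1"
  shows "R_minus f z = kernel_sum (a_of z) S (\<lambda>w. hat_const z * symbol f z w)"
  unfolding R_minus_def
proof (rule fun_of_poisson_inv)
  note z = circle_nonsingular[OF assms(2)]
  show "cmod (inverse z) = 1" by (rule z)
  show "kernel_sum (a_of z) S (\<lambda>w. hat_const z * symbol f z w) \<in> K"
    by (rule kernel_sum_K[OF a_nz[OF z(1)]])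
  show "poisson (inverse z) (density_fnl (kernel_sum (a_of z) S (\<lambda>w. hat_const z * symbol f z w))) = wave_hat f z"
  proof
    fix v
    have sym: "kernel_pairing (b_of z) (a_of z) v w = kernel_pairing (a_of z) (b_of z) w v" for w
      by (simp add: kernel_pairing_def mult.commute)
    have "poisson (inverse z) (density_fnl (kernel_sum (a_of z) S (\<lambda>w. hat_const z * symbol f z w))) v =
       (\<Sum>w\<in>S. symbol f z w * (hat_const z * kernel_pairing (a_of z) (b_of z) w v))"
      using z(1) a_nz[OF z(1)] b_nz[OF z(1)]
      by (simp add: poisson_density integral_kernel_sum sym mult.assoc mult.left_commute)
    then show "poisson (inverse z) (density_fnl (kernel_sum (a_of z) S (\<lambda>w. hat_const z * symbol f z w))) v = wave_hat f z v"
      unfolding fund_hat_pairing[OF assms(2), symmetric] wave_hat_eq[OF assms] .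
  qed
qed

lemma R_minus_K: "f \<in> data \<Longrightarrow> cmod z = 1 \<Longrightarrow> R_minus f z \<in> K"
  by (metis R_minus_eq data_supports kernel_sum_K a_nz circle_nonsingular(1))

lemma R_plus_intertwiner: "f \<in> data \<Longrightarrow> cmod z = 1 \<Longrightarrow> R_plus f z = intertwiner z (R_minus f z)"
  using R_plus_eq[OF data_supports] R_minus_eq[OF data_supports] intertwiner_kernel_sum by metis

text \<open>The total factor in front of the kernels in \<open>T_minus_data\<close>. Its zeros 1 and -1 are what makes the
  density of the range a matter of approximation.\<close>
definition kappa :: "complex \<Rightarrow> complex" where
  "kappa z = (z - inverse z) / (z - inverse z / of_nat q)"

lemma circle_factor_nz:
  assumes "cmod z = 1"
  shows "z - inverse z / of_nat q \<noteq> 0" "inverse z - z / of_nat q \<noteq> 0"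
    "cmod (z - inverse z / of_nat q) = cmod (inverse z - z / of_nat q)"
proof -
  note z = circle_nonsingular[OF assms]
  have "z - inverse z / of_nat q = z * (1 - (inverse z)\<^sup>2 / of_nat q)"
    using z(1) by (simp add: power2_eq_square right_diff_distrib)
  then show "z - inverse z / of_nat q \<noteq> 0" using z circle_denom[OF assms] by simp
  have "inverse z - z / of_nat q = inverse z * (1 - z\<^sup>2 / of_nat q)"
    using z(1) by (simp add: power2_eq_square right_diff_distrib)
  then show "inverse z - z / of_nat q \<noteq> 0" using z circle_denom[OF assms] by simp
  have "cnj (z - inverse z / of_nat q) = inverse z - z / of_nat q" by (simp add: z)
  then show "cmod (z - inverse z / of_nat q) = cmod (inverse z - z / of_nat q)"
    by (metis complex_mod_cnj)
qed

lemma kappa_hat_const: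
  assumes "cmod z = 1"
  shows "(inverse z - z / of_nat q) / (1 + 1 / of_nat q) * hat_const z = kappa z"
proof -
  note z = circle_nonsingular[OF assms]
  define P where "P = 1 - z\<^sup>2 / of_nat q"
  define Q where "Q = 1 - (inverse z)\<^sup>2 / of_nat q"
  have PQ: "P \<noteq> 0" "Q \<noteq> 0" using circle_denom[OF assms] by (simp_all add: P_def Q_def)
  define k where "k = (1 + 1 / of_nat q :: complex)"
  have k: "k \<noteq> 0" using q_plus_1 by (simp add: k_def)
  have 1: "z - inverse z / of_nat q = z * Q"
    using z(1) by (simp add: Q_def power2_eq_square right_diff_distrib)
  have 2: "inverse z - z / of_nat q = inverse z * P"
    using z(1) by (simp add: P_def power2_eq_square right_diff_distrib)
  have "inverse z * P / k * (k * (z - inverse z) / (P * Q)) = (z - inverse z) / (z * Q)"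
    using k PQ z(1) by (simp add: divide_simps)
  then show ?thesis unfolding kappa_def hat_const_def 1 2 k_def[symmetric] P_def[symmetric] Q_def[symmetric] .
qed

lemma kernel_sum_scale: "kernel_sum a S (\<lambda>w. k * c w) \<omega> = k * kernel_sum a S c \<omega>"
  by (simp add: kernel_sum_def sum_distrib_left mult.assoc)

lemma T_minus_data_eq:
  assumes "supports S f" "cmod z = 1"
  shows "T_minus_data f (z, \<omega>) = kappa z * kernel_sum (a_of z) S (symbol f z) \<omega>"
  by (simp add: T_minus_data_def R_minus_eq[OF assms] kernel_sum_scale kappa_hat_const[OF assms(2), symmetric])

lemma T_plus_data_intertwiner:
  assumes "f \<in> data" "cmod z = 1"
  shows "T_plus_data f (z, \<omega>) = (z - inverse z / of_nat q) / (1 + 1 / of_nat q) * intertwiner z (R_minus f z) \<omega>"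
  by (simp add: T_plus_data_def R_plus_intertwiner[OF assms])

lemma intertwiner_scale:
  assumes "cmod z = 1" "g \<in> K"
  shows "intertwiner z (\<lambda>\<omega>. k * g \<omega>) = (\<lambda>\<omega>. k * intertwiner z g \<omega>)"
proof -
  obtain S c where g: "g = kernel_sum (a_of z) S c" using K_kernel_sum[OF assms] by metis
  have "(\<lambda>\<omega>. k * g \<omega>) = kernel_sum (a_of z) S (\<lambda>w. k * c w)"
    unfolding g by (rule ext) (simp add: kernel_sum_scale)
  then have "intertwiner z (\<lambda>\<omega>. k * g \<omega>) = kernel_sum (b_of z) S (\<lambda>w. k * c w)"
    by (simp only: intertwiner_kernel_sum[OF assms(1)])
  then show ?thesis unfolding g intertwiner_kernel_sum[OF assms(1)]
    by (simp only: kernel_sum_scale[abs_def])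
qed

lemma T_minus_fibre_K: "f \<in> data \<Longrightarrow> cmod z = 1 \<Longrightarrow> (\<lambda>\<omega>. T_minus_data f (z, \<omega>)) \<in> K"
  unfolding T_minus_data_def by (simp only: prod.case) (intro K_scale R_minus_K)

text \<open>The two representations use the same coefficients with the two families of kernels, which the
  intertwining operator exchanges; the quotient of their normalising factors remains. This is the
  scattering multiplier on finitely supported data.\<close>
lemma T_plus_T_minus_fibre:
  assumes "f \<in> data" "cmod z = 1"
  shows "T_plus_data f (z, \<omega>) = (z - inverse z / of_nat q) / (inverse z - z / of_nat q) *
    intertwiner z (\<lambda>\<omega>. T_minus_data f (z, \<omega>)) \<omega>"
proof -
  have "intertwiner z (\<lambda>\<omega>. T_minus_data f (z, \<omega>)) \<omega> =
      (inverse z - z / of_nat q) / (1 + 1 / of_nat q) * intertwiner z (R_minus f z) \<omega>"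
    unfolding T_minus_data_def prod.case intertwiner_scale[OF assms(2) R_minus_K[OF assms]] ..
  then show ?thesis
    unfolding T_plus_data_intertwiner[OF assms] using circle_factor_nz[OF assms(2)] by simp
qed


section \<open>Measurability and boundedness on the product space\<close>

abbreviation circle_bdry :: "(complex \<times> 'v bdry) measure" where "circle_bdry \<equiv> circle \<Otimes>\<^sub>M \<nu>"

sublocale circle_nu: pair_sigma_finite circle \<nu>
proof
qed

sublocale prod: finite_measure "circle_bdry"
proof
  have "emeasure circle_bdry (space circle \<times> space \<nu>) = emeasure circle (space circle) * emeasure \<nu> (space \<nu>)"
    by (rule emeasure_pair_measure_Times[OF sets.top sets.top])
  then show "emeasure circle_bdry (space circle_bdry) \<noteq> \<infinity>"
    using emeasure_circle_space emeasure_space_1 by (simp add: space_pair_measure)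
qed

text \<open>An algebra of functions, closed under everything needed to assemble the representations from
  continuous functions on the circle and indicators of cylinders, and contained in the space of
  square-integrable functions.\<close>
definition bounded_measurable :: "(complex \<times> 'v bdry \<Rightarrow> complex) \<Rightarrow> bool" where
  "bounded_measurable F \<longleftrightarrow> F \<in> borel_measurable circle_bdry \<and>
     (\<exists>B. \<forall>x\<in>space circle_bdry. cmod (F x) \<le> B)"

lemma bounded_measurable_add:
  assumes "bounded_measurable F" "bounded_measurable G"
  shows "bounded_measurable (\<lambda>x. F x + G x)"
proof -
  obtain B C where B: "\<And>x. x \<in> space circle_bdry \<Longrightarrow> cmod (F x) \<le> B"
    and C: "\<And>x. x \<in> space circle_bdry \<Longrightarrow> cmod (G x) \<le> C"
    using assms unfolding bounded_measurable_def by blast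
  have "cmod (F x + G x) \<le> B + C" if "x \<in> space circle_bdry" for x
    using norm_triangle_ineq[of "F x" "G x"] B[OF that] C[OF that] by linarith
  then show ?thesis using assms unfolding bounded_measurable_def by (intro conjI borel_measurable_add) blast+
qed

lemma bounded_measurable_mult:
  assumes "bounded_measurable F" "bounded_measurable G"
  shows "bounded_measurable (\<lambda>x. F x * G x)"
proof -
  obtain B C where B: "\<And>x. x \<in> space circle_bdry \<Longrightarrow> cmod (F x) \<le> B"
    and C: "\<And>x. x \<in> space circle_bdry \<Longrightarrow> cmod (G x) \<le> C"
    using assms unfolding bounded_measurable_def by blast
  have "cmod (F x * G x) \<le> B * C" if "x \<in> space circle_bdry" for x
    unfolding norm_mult using B[OF that] C[OF that]
    by (intro mult_mono) (auto intro: order_trans[OF norm_ge_zero])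
  then show ?thesis using assms unfolding bounded_measurable_def by (intro conjI borel_measurable_times) blast+
qed

lemma bounded_measurable_circle:
  assumes "continuous_on (sphere 0 1) F"
  shows "bounded_measurable (\<lambda>(z, \<omega>). F z)"
proof -
  have "compact (F ` sphere 0 1)" using assms by (intro compact_continuous_image) auto
  then obtain B where B: "\<And>z. z \<in> sphere 0 1 \<Longrightarrow> cmod (F z) \<le> B"
    using compact_imp_bounded bounded_iff by (metis (no_types, lifting) image_eqI)
  have [measurable]: "F \<in> borel_measurable circle" by (rule circle_continuous_measurable[OF assms])
  have "\<exists>B. \<forall>x\<in>space circle_bdry. cmod (case x of (z, \<omega>) \<Rightarrow> F z) \<le> B"
    using B by (intro exI[of _ B]) (auto simp: space_pair_measure)
  then show ?thesis unfolding bounded_measurable_def by (intro conjI) (measurable, blast?)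
qed

lemma bounded_measurable_cyl: "bounded_measurable (\<lambda>(z, \<omega>). indicator (cyl v) \<omega>)"
  unfolding bounded_measurable_def
  by (intro conjI, measurable) (auto intro!: exI[of _ 1] simp: indicator_def)

lemma bounded_measurable_sum:
  "(\<And>i. i \<in> S \<Longrightarrow> bounded_measurable (F i)) \<Longrightarrow> bounded_measurable (\<lambda>x. \<Sum>i\<in>S. F i x)"
proof (induction S rule: infinite_finite_induct)
  case (insert i S)
  then show ?case by (simp add: bounded_measurable_add)
qed (use bounded_measurable_circle[of "\<lambda>_. 0"] in \<open>auto simp: case_prod_beta' intro!: continuous_intros\<close>)

lemma bounded_measurable_cong:
  assumes "bounded_measurable F" "\<And>z \<omega>. cmod z = 1 \<Longrightarrow> \<omega> \<in> \<Omega> \<Longrightarrow> F (z, \<omega>) = G (z, \<omega>)"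
  shows "bounded_measurable G"
proof -
  have e: "x \<in> space circle_bdry \<Longrightarrow> F x = G x" for x
    using assms(2) by (auto simp: space_pair_measure)
  then have "F \<in> borel_measurable circle_bdry \<longleftrightarrow> G \<in> borel_measurable circle_bdry"
    by (intro measurable_cong) auto
  then show ?thesis using assms(1) e unfolding bounded_measurable_def by auto
qed

lemma bounded_measurable_L2:
  assumes "bounded_measurable F"
  shows "F \<in> L2_space circle_bdry"
proof -
  obtain B where B: "\<And>x. x \<in> space circle_bdry \<Longrightarrow> cmod (F x) \<le> B"
    using assms unfolding bounded_measurable_def by blast
  show ?thesis
  proof (rule L2_spaceI_bound)
    show "F \<in> borel_measurable circle_bdry" using assms by (simp add: bounded_measurable_def)
    show "integrable circle_bdry (\<lambda>_. B\<^sup>2)" by simp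
    show "AE x in circle_bdry. (cmod (F x))\<^sup>2 \<le> B\<^sup>2"
      by (rule AE_I2) (simp add: B power_mono)
  qed
qed

lemma continuous_on_circle_inverse [continuous_intros]:
  "continuous_on (sphere 0 1) (inverse :: complex \<Rightarrow> complex)"
  by (intro continuous_on_inverse continuous_on_id) auto

text \<open>The recursion from parent to child expresses the kernel by finitely many indicators, with
  coefficients depending continuously on the parameter.\<close>
lemma bounded_measurable_kernel:
  assumes c: "continuous_on (sphere 0 1) c" "\<And>z. cmod z = 1 \<Longrightarrow> c z \<noteq> 0"
  shows "bounded_measurable (\<lambda>(z, \<omega>). poisson_kernel (c z) v \<omega>)"
proof (induction v rule: vertex_induct)
  case org
  show ?case using bounded_measurable_cyl[of org] by (simp add: poisson_kernel_org)
next
  case (child v)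
  have "bounded_measurable (\<lambda>x. (\<lambda>(z, \<omega>). inverse (c z)) x * (\<lambda>(z, \<omega>). poisson_kernel (c z) (parent v) \<omega>) x +
      (\<lambda>(z, \<omega>). c z ^ level v * (1 - inverse (c z) ^ 2)) x * (\<lambda>(z, \<omega>). indicator (cyl v) \<omega>) x)"
    by (intro bounded_measurable_add bounded_measurable_mult child bounded_measurable_cyl
        bounded_measurable_circle continuous_intros c) (use c(2) in auto)
  then show ?case
  proof (rule bounded_measurable_cong)
    fix z :: complex and \<omega> assume "cmod z = 1"
    from fun_cong[OF poisson_kernel_parent[OF child(1) c(2)[OF this]], of \<omega>]
    show "(\<lambda>(z, \<omega>). inverse (c z)) (z, \<omega>) * (\<lambda>(z, \<omega>). poisson_kernel (c z) (parent v) \<omega>) (z, \<omega>) +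
      (\<lambda>(z, \<omega>). c z ^ level v * (1 - inverse (c z) ^ 2)) (z, \<omega>) * (\<lambda>(z, \<omega>). indicator (cyl v) \<omega>) (z, \<omega>) =
      (\<lambda>(z, \<omega>). poisson_kernel (c z) v \<omega>) (z, \<omega>)" by simp
  qed
qed

lemma bounded_measurable_kernels:
  "bounded_measurable (\<lambda>(z, \<omega>). poisson_kernel (a_of z) v \<omega>)"
  "bounded_measurable (\<lambda>(z, \<omega>). poisson_kernel (b_of z) v \<omega>)"
  by (rule bounded_measurable_kernel;
      use a_nz b_nz circle_nonsingular(1) in \<open>auto intro!: continuous_intros\<close>)+

lemma kappa_continuous [continuous_intros]: "continuous_on (sphere 0 1) kappa"
  unfolding kappa_def[abs_def] by (intro continuous_intros) (use circle_factor_nz(1) q_ge_2 in auto)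

lemma symbol_continuous [continuous_intros]: "continuous_on (sphere 0 1) (\<lambda>z. symbol f z w)"
  unfolding symbol_def by (intro continuous_intros) auto

lemma bounded_measurable_T_minus:
  assumes "f \<in> data"
  shows "bounded_measurable (T_minus_data f)"
proof -
  obtain S where S: "supports S f" using data_supports[OF assms] by blast
  have "bounded_measurable (\<lambda>x. (\<lambda>(z, \<omega>). kappa z) x * (\<Sum>w\<in>S. (\<lambda>(z, \<omega>). symbol f z w) x *
      (\<lambda>(z, \<omega>). poisson_kernel (a_of z) w \<omega>) x))"
    by (intro bounded_measurable_mult bounded_measurable_sum bounded_measurable_kernels
        bounded_measurable_circle continuous_intros)
  then show ?thesis
    by (rule bounded_measurable_cong) (simp add: T_minus_data_eq[OF S] kernel_sum_def)
qed

lemma hat_const_continuous [continuous_intros]: "continuous_on (sphere 0 1) hat_const"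
  unfolding hat_const_def[abs_def] by (intro continuous_intros) (use circle_denom q_ge_2 in auto)

lemma bounded_measurable_T_plus:
  assumes "f \<in> data"
  shows "bounded_measurable (T_plus_data f)"
proof -
  obtain S where S: "supports S f" using data_supports[OF assms] by blast
  have "bounded_measurable (\<lambda>x. (\<lambda>(z, \<omega>). (z - inverse z / of_nat q) / (1 + 1 / of_nat q)) x *
      (\<Sum>w\<in>S. (\<lambda>(z, \<omega>). hat_const z * symbol f z w) x * (\<lambda>(z, \<omega>). poisson_kernel (b_of z) w \<omega>) x))"
    by (intro bounded_measurable_mult bounded_measurable_sum bounded_measurable_kernels
        bounded_measurable_circle continuous_intros) (use q_plus_1 q_ge_2 in auto)
  then show ?thesis
    by (rule bounded_measurable_cong) (simp add: T_plus_data_def R_plus_eq[OF S] kernel_sum_def)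
qed

lemmas T_minus_L2 = bounded_measurable_L2[OF bounded_measurable_T_minus]
lemmas T_plus_L2 = bounded_measurable_L2[OF bounded_measurable_T_plus]

lemma L2_norm_product:
  assumes "F \<in> L2_space circle_bdry"
  shows "(L2_norm circle_bdry F)\<^sup>2 = (\<integral>z. (L2_norm \<nu> (\<lambda>\<omega>. F (z, \<omega>)))\<^sup>2 \<partial>circle)"
    "integrable circle (\<lambda>z. (L2_norm \<nu> (\<lambda>\<omega>. F (z, \<omega>)))\<^sup>2)"
    "AE z in circle. (\<lambda>\<omega>. F (z, \<omega>)) \<in> L2_space \<nu>"
proof -
  note i = L2_spaceD(2)[OF assms]
  show "(L2_norm circle_bdry F)\<^sup>2 = (\<integral>z. (L2_norm \<nu> (\<lambda>\<omega>. F (z, \<omega>)))\<^sup>2 \<partial>circle)"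
    unfolding L2_norm_squared using circle_nu.integral_fst'[OF i] by simp
  show "integrable circle (\<lambda>z. (L2_norm \<nu> (\<lambda>\<omega>. F (z, \<omega>)))\<^sup>2)"
    unfolding L2_norm_squared using circle_nu.integrable_fst'[OF i] by simp
  show "AE z in circle. (\<lambda>\<omega>. F (z, \<omega>)) \<in> L2_space \<nu>"
    using circle_nu.AE_integrable_fst'[OF i] AE_space
  proof eventually_elim
    case (elim z)
    have "(\<lambda>\<omega>. F (z, \<omega>)) \<in> borel_measurable \<nu>"
      using L2_spaceD(1)[OF assms] elim(2) by (rule measurable_Pair2)
    then show ?case using elim(1) by (simp add: L2_space_def)
  qed
qed


section \<open>The energy isometry\<close>

text \<open>The wave equation summed over time against \<open>z powi t\<close>: a shift in time becomes a power of \<open>z\<close>.\<close>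
lemma fund_hat_adj:
  assumes "cmod z = 1"
  shows "adj (\<lambda>u. fund_hat z (tdist v u)) w = of_real (sqrt q) * (z + inverse z) * fund_hat z (tdist v w)"
proof (rule has_sum_unique)
  have "((\<lambda>t. \<Sum>u | E w u. fund t (tdist v u) * z powi t) has_sum (\<Sum>u | E w u. fund_hat z (tdist v u))) UNIV"
    by (intro has_sum_finite_sum finite_nbrs fund_has_sum assms)
  moreover have "(\<Sum>u | E w u. fund t (tdist v u) * z powi t) =
      of_real (sqrt q) * (fund (t + 1) (tdist v w) * z powi t + fund (t + (-1)) (tdist v w) * z powi t)" for t
  proof -
    have "(\<Sum>u | E w u. fund t (tdist v u) * z powi t) = adj (\<lambda>u. fund t (tdist v u)) w * z powi t"
      by (simp add: adj_def sum_distrib_right)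
    then show ?thesis unfolding fund_wave by (simp add: distrib_right distrib_left mult.assoc)
  qed
  ultimately show "((\<lambda>t. of_real (sqrt q) * (fund (t + 1) (tdist v w) * z powi t + fund (t + (-1)) (tdist v w) * z powi t))
      has_sum adj (\<lambda>u. fund_hat z (tdist v u)) w) UNIV"
    by (simp only: adj_def)
  have "((\<lambda>t. of_real (sqrt q) * (fund (t + 1) (tdist v w) * z powi t + fund (t + (-1)) (tdist v w) * z powi t))
      has_sum of_real (sqrt q) * (fund_hat z (tdist v w) * z powi (- 1) + fund_hat z (tdist v w) * z powi (- (- 1)))) UNIV"
    by (intro has_sum_cmult_right has_sum_add fund_shift_has_sum assms)
  then show "((\<lambda>t. of_real (sqrt q) * (fund (t + 1) (tdist v w) * z powi t + fund (t + (-1)) (tdist v w) * z powi t))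
      has_sum of_real (sqrt q) * (z + inverse z) * fund_hat z (tdist v w)) UNIV"
    by (simp add: power_int_minus algebra_simps)
qed

lemma fund_hat_continuous [continuous_intros]: "continuous_on (sphere 0 1) (\<lambda>z. fund_hat z d)"
  unfolding fund_hat_def
  by (intro continuous_intros) (use circle_denom q_sqrt(3) q_ge_2 in auto)

lemma fund_hat_inverse: "fund_hat (inverse z) d = - fund_hat z d"
  by (simp add: fund_hat_def)

text \<open>\<open>inverse z - z\<close> times \<open>fund_hat z d\<close> is the sum of a function holomorphic in the unit disc and of
  its image under \<open>z \<mapsto> inverse z\<close>; the mean value property gives the integral.\<close>
lemma integral_fund_hat:
  "(\<integral>z. (inverse z - z) * fund_hat z d \<partial>circle) = (if d = 0 then of_real (4 * pi) else 0)"
proof -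
  define s where "s = (of_real (sqrt q) :: complex)"
  have s: "s \<noteq> 0" using q_sqrt by (simp_all add: s_def)
  define G where "G z = (z / s) ^ d * (1 - z\<^sup>2) / (1 - z\<^sup>2 / of_nat q)" for z
  have Gc: "continuous_on (sphere 0 1) G"
    unfolding G_def[abs_def] by (intro continuous_intros) (use circle_denom s q_ge_2 in auto)
  have Gic: "continuous_on (sphere 0 1) (\<lambda>z. G (inverse z))"
    by (rule continuous_on_compose2[OF Gc continuous_on_circle_inverse]) (auto simp: norm_inverse)
  have split: "(inverse z - z) * fund_hat z d = G z + G (inverse z)" if "cmod z = 1" for z
  proof -
    have z0: "z \<noteq> 0" using that by auto
    have "(inverse z - z) * (z * (z / s) ^ d / (1 - z\<^sup>2 / of_nat q)) = ((inverse z - z) * z) * (z / s) ^ d / (1 - z\<^sup>2 / of_nat q)"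
      by simp
    also have "(inverse z - z) * z = 1 - z\<^sup>2" using z0 by (simp add: field_simps power2_eq_square)
    finally have 1: "(inverse z - z) * (z * (z / s) ^ d / (1 - z\<^sup>2 / of_nat q)) = G z"
      by (simp add: G_def mult.commute)
    have e: "(inverse z - z) * inverse z = - (1 - (inverse z)\<^sup>2)" using z0 by (simp add: field_simps power2_eq_square)
    have "(inverse z - z) * (inverse z * (inverse z / s) ^ d / (1 - (inverse z)\<^sup>2 / of_nat q)) =
        ((inverse z - z) * inverse z) * (inverse z / s) ^ d / (1 - (inverse z)\<^sup>2 / of_nat q)"
      by (simp only: times_divide_eq_right mult.assoc)
    also have "\<dots> = - G (inverse z)" unfolding e G_def minus_mult_left[symmetric] minus_divide_left[symmetric]
      by (simp only: mult.commute)
    finally have 2: "(inverse z - z) * (inverse z * (inverse z / s) ^ d / (1 - (inverse z)\<^sup>2 / of_nat q)) = - G (inverse z)" .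
    show ?thesis
      unfolding fund_hat_def s_def[symmetric] right_diff_distrib 1 2 by simp
  qed
  have "(\<integral>z. (inverse z - z) * fund_hat z d \<partial>circle) = (\<integral>z. G z + G (inverse z) \<partial>circle)"
    by (intro Bochner_Integration.integral_cong) (auto simp: split)
  also have "\<dots> = (\<integral>z. G z \<partial>circle) + (\<integral>z. G (inverse z) \<partial>circle)"
    by (intro Bochner_Integration.integral_add circle_continuous_integrable Gc Gic)
  also have "(\<integral>z. G (inverse z) \<partial>circle) = (\<integral>z. G z \<partial>circle)"
    by (rule integral_circle_inverse[OF circle_continuous_measurable[OF Gc]])
  finally have two: "(\<integral>z. (inverse z - z) * fund_hat z d \<partial>circle) = 2 * (\<integral>z. G z \<partial>circle)" by simp
  \<comment> \<open>\<open>G\<close> extends to the disc with value 1 at the centre for \<open>d = 0\<close> and 0 otherwise. The terms \<open>H j\<close> are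
    those of its power series beyond \<open>(z / s) ^ d\<close>.\<close>
  define H where "H j z = (1 / of_nat q - 1) / s ^ d / of_nat q ^ j * z ^ (d + 2 + 2 * j)" for j z
  have Hc: "continuous_on (sphere 0 1) (H j)" for j
    unfolding H_def[abs_def] by (intro continuous_intros)
  have Hn: "cmod (H j z) \<le> cmod ((1 / of_nat q - 1) / s ^ d) * (1 / real q) ^ j" if "cmod z = 1" for j z
    using that by (simp add: H_def norm_mult norm_divide norm_power power_divide)
  have geo: "summable (\<lambda>j. cmod ((1 / of_nat q - 1) / s ^ d) * (1 / real q) ^ j)"
    using q_ge_2 by (intro summable_mult summable_geometric) simp
  have Hs: "(\<Sum>j. H j z) = z\<^sup>2 * (1 / of_nat q - 1) * (z / s) ^ d / (1 - z\<^sup>2 / of_nat q)" if "cmod z = 1" for z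
  proof -
    have "cmod (z\<^sup>2 / of_nat q) < 1" using that q_ge_2 by (simp add: norm_divide norm_power)
    from sums_mult[OF geometric_sums[OF this], of "z\<^sup>2 * (1 / of_nat q - 1) * (z / s) ^ d"]
    have "(\<lambda>j. z\<^sup>2 * (1 / of_nat q - 1) * (z / s) ^ d * (z\<^sup>2 / of_nat q) ^ j) sums
       (z\<^sup>2 * (1 / of_nat q - 1) * (z / s) ^ d * (1 / (1 - z\<^sup>2 / of_nat q)))" .
    moreover have "z\<^sup>2 * (1 / of_nat q - 1) * (z / s) ^ d * (z\<^sup>2 / of_nat q) ^ j = H j z" for j
      by (simp add: H_def power_divide power_add power_mult power2_eq_square)
    ultimately show ?thesis by (simp add: sums_iff)
  qed
  have Hint: "(\<integral>z. (\<Sum>j. H j z) \<partial>circle) = 0" "integrable circle (\<lambda>z. \<Sum>j. H j z)"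
  proof -
    have i: "integrable circle (H j)" for j by (rule circle_continuous_integrable[OF Hc])
    have a: "AE z in circle. summable (\<lambda>j. cmod (H j z))"
      by (rule AE_I2, rule summable_comparison_test'[OF geo]) (use Hn in auto)
    have b: "summable (\<lambda>j. \<integral>z. cmod (H j z) \<partial>circle)"
    proof (rule summable_comparison_test'[of "\<lambda>j. 2 * pi * (cmod ((1 / of_nat q - 1) / s ^ d) * (1 / real q) ^ j)" 0])
      fix j
      have "(\<integral>z. cmod (H j z) \<partial>circle) \<le> (\<integral>z. cmod ((1 / of_nat q - 1) / s ^ d) * (1 / real q) ^ j \<partial>circle)"
        using Hn i by (intro integral_mono) auto
      also have "\<dots> = 2 * pi * (cmod ((1 / of_nat q - 1) / s ^ d) * (1 / real q) ^ j)"
        using emeasure_circle_space by (simp add: measure_def)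
      finally show "norm (\<integral>z. cmod (H j z) \<partial>circle) \<le> 2 * pi * (cmod ((1 / of_nat q - 1) / s ^ d) * (1 / real q) ^ j)"
        by simp
    qed (intro summable_mult geo)
    have "(\<integral>z. H j z \<partial>circle) = 0" for j
      unfolding H_def using integral_circle_power[of "d + 2 + 2 * j"] by simp
    then show "(\<integral>z. (\<Sum>j. H j z) \<partial>circle) = 0" using integral_suminf[OF i a b] by simp
    show "integrable circle (\<lambda>z. \<Sum>j. H j z)" by (rule integrable_suminf[OF i a b])
  qed
  have "G z = (z / s) ^ d + (\<Sum>j. H j z)" if "cmod z = 1" for z
  proof -
    define P where "P = 1 - z\<^sup>2 / of_nat q"
    have P: "P \<noteq> 0" using circle_denom[OF that] by (simp add: P_def)
    define c where "c = (1 / of_nat q - 1 :: complex)"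
    have e: "1 - z\<^sup>2 = P + z\<^sup>2 * c" by (simp add: P_def c_def algebra_simps)
    have "u * (P + z\<^sup>2 * c) / P = u + z\<^sup>2 * c * u / P" for u
      using P by (simp add: field_simps)
    then show ?thesis unfolding Hs[OF that] G_def P_def[symmetric] e c_def[symmetric] .
  qed
  then have "(\<integral>z. G z \<partial>circle) = (\<integral>z. (z / s) ^ d + (\<Sum>j. H j z) \<partial>circle)"
    by (intro Bochner_Integration.integral_cong) auto
  also have "\<dots> = (\<integral>z. (z / s) ^ d \<partial>circle) + (\<integral>z. (\<Sum>j. H j z) \<partial>circle)"
    using s by (intro Bochner_Integration.integral_add Hint circle_continuous_integrable continuous_intros) auto
  also have "\<dots> = (if d = 0 then of_real (2 * pi) else 0)"
    using integral_circle_powi[of "int d"] by (simp add: Hint power_divide)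
  finally show ?thesis unfolding two by simp
qed

text \<open>The integrand is odd under \<open>z \<mapsto> inverse z\<close>, which preserves arclength.\<close>
lemma integral_fund_hat_square: "(\<integral>z. (inverse z - z)\<^sup>2 * fund_hat z d \<partial>circle) = 0"
proof -
  have "(\<integral>z. (inverse (inverse z) - inverse z)\<^sup>2 * fund_hat (inverse z) d \<partial>circle) =
      (\<integral>z. (inverse z - z)\<^sup>2 * fund_hat z d \<partial>circle)"
    by (rule integral_circle_inverse) (intro circle_continuous_measurable continuous_intros)
  moreover have "(inverse (inverse z) - inverse z)\<^sup>2 * fund_hat (inverse z) d = - ((inverse z - z)\<^sup>2 * fund_hat z d)" for z :: complex
    by (simp add: fund_hat_inverse power2_commute)
  ultimately have "- (\<integral>z. (inverse z - z)\<^sup>2 * fund_hat z d \<partial>circle) = (\<integral>z. (inverse z - z)\<^sup>2 * fund_hat z d \<partial>circle)"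
    by simp
  then show ?thesis by simp
qed

lemma integral_adj:
  assumes "\<And>w. integrable circle (F w)"
  shows "(\<integral>z. adj (\<lambda>w. F w z) v \<partial>circle) = adj (\<lambda>w. \<integral>z. F w z \<partial>circle) v"
    "integrable circle (\<lambda>z. adj (\<lambda>w. F w z) v)"
  unfolding adj_def using assms by (auto intro: Bochner_Integration.integral_sum)

text \<open>On the circle \<open>(inverse z - z)\<^sup>2 = (z + inverse z)\<^sup>2 - 4\<close>, and by the eigenvalue equation multiplication
  by \<open>q * (z + inverse z)\<^sup>2\<close> is the square of the adjacency operator.\<close>
lemma integral_fund_hat_cube:
  "(\<integral>z. (inverse z - z) ^ 3 * fund_hat z (tdist v w) \<partial>circle) =
    adj (adj (\<lambda>x. if v = x then of_real (4 * pi) else 0)) w / of_nat q - 4 * (if v = w then of_real (4 * pi) else 0)"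
proof -
  define L where "L x z = (inverse z - z) * fund_hat z (tdist v x)" for x z
  have Li: "integrable circle (L x)" for x
    unfolding L_def[abs_def] by (intro circle_continuous_integrable continuous_intros)
  have L0: "(\<integral>z. L x z \<partial>circle) = (if v = x then of_real (4 * pi) else 0)" for x
    unfolding L_def by (simp add: integral_fund_hat)
  have AL: "adj (adj (\<lambda>x. L x z)) w = of_nat q * (z + inverse z)\<^sup>2 * L w z" if "cmod z = 1" for z
  proof -
    have "adj (\<lambda>x. L x z) u = of_real (sqrt q) * (z + inverse z) * L u z" for u
      unfolding L_def adj_cmult fund_hat_adj[OF that] by (simp add: mult.left_commute)
    then have e: "adj (\<lambda>x. L x z) = (\<lambda>u. of_real (sqrt q) * (z + inverse z) * L u z)" by (rule ext)
    have "adj (adj (\<lambda>x. L x z)) w = of_real (sqrt q) * (z + inverse z) * adj (\<lambda>x. L x z) w"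
      by (subst e) (rule adj_cmult)
    also have "\<dots> = of_real (sqrt q) * (z + inverse z) * (of_real (sqrt q) * (z + inverse z) * L w z)"
      unfolding e ..
    also have "\<dots> = (of_real (sqrt q) * of_real (sqrt q)) * (z + inverse z)\<^sup>2 * L w z"
      by (simp only: power2_eq_square mult_ac)
    finally show ?thesis unfolding q_sqrt(2) .
  qed
  have "(inverse z - z) ^ 3 * fund_hat z (tdist v w) = adj (adj (\<lambda>x. L x z)) w / of_nat q - 4 * L w z"
    if "cmod z = 1" for z
  proof -
    have z0: "z \<noteq> 0" using that by auto
    have "(inverse z - z)\<^sup>2 = (z + inverse z)\<^sup>2 - 4" using z0 by (simp add: field_simps power2_eq_square)
    moreover have "(inverse z - z) ^ 3 * fund_hat z (tdist v w) = (inverse z - z)\<^sup>2 * L w z"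
      by (simp add: L_def power3_eq_cube power2_eq_square)
    ultimately show ?thesis unfolding AL[OF that] using q_ge_2 by (simp add: left_diff_distrib)
  qed
  then have "(\<integral>z. (inverse z - z) ^ 3 * fund_hat z (tdist v w) \<partial>circle) =
      (\<integral>z. adj (adj (\<lambda>x. L x z)) w / of_nat q - 4 * L w z \<partial>circle)"
    by (intro Bochner_Integration.integral_cong) auto
  also have "\<dots> = (\<integral>z. adj (adj (\<lambda>x. L x z)) w \<partial>circle) / of_nat q - 4 * (\<integral>z. L w z \<partial>circle)"
    using integral_adj(2)[OF integral_adj(2)[OF Li]] Li
    by (subst Bochner_Integration.integral_diff) auto
  also have "(\<integral>z. adj (adj (\<lambda>x. L x z)) w \<partial>circle) = adj (\<lambda>u. \<integral>z. adj (\<lambda>x. L x z) u \<partial>circle) w"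
    by (rule integral_adj(1)[OF integral_adj(2)[OF Li]])
  also have "\<dots> = adj (adj (\<lambda>x. \<integral>z. L x z \<partial>circle)) w"
    unfolding integral_adj(1)[OF Li] ..
  finally show ?thesis unfolding L0 .
qed

lemma energy_eq:
  assumes "supports S f"
  shows "energy f f = (\<Sum>w\<in>S. (fst f w - adj (adj (fst f)) w / of_nat (4 * q)) * cnj (fst f w) + snd f w * cnj (snd f w))"
proof -
  have "(\<Sum>\<^sub>\<infinity>v. (fst f v - adj (adj (fst f)) v / of_nat (4 * q)) * cnj (fst f v)) =
     (\<Sum>\<^sub>\<infinity>v\<in>S. (fst f v - adj (adj (fst f)) v / of_nat (4 * q)) * cnj (fst f v))"
    by (rule infsum_cong_neutral) (use assms in \<open>auto simp: supports_def\<close>)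
  moreover have "(\<Sum>\<^sub>\<infinity>v. snd f v * cnj (snd f v)) = (\<Sum>\<^sub>\<infinity>v\<in>S. snd f v * cnj (snd f v))"
    by (rule infsum_cong_neutral) (use assms in \<open>auto simp: supports_def\<close>)
  ultimately show ?thesis using assms by (simp add: energy_def supports_def sum.distrib)
qed

text \<open>The norm of a kernel sum is a quadratic form in pairings; \<open>(cmod (kappa z))\<^sup>2\<close> supplies the factor that
  turns the pairings into \<open>fund_hat\<close>, and one factor \<open>inverse z - z\<close> is left over.\<close>
lemma T_minus_fibre_norm:
  assumes "supports S f" "cmod z = 1"
  shows "complex_of_real ((L2_norm \<nu> (\<lambda>\<omega>. T_minus_data f (z, \<omega>)))\<^sup>2) =
    (\<Sum>v\<in>S. \<Sum>w\<in>S. symbol f z v * cnj (symbol f z w) * ((inverse z - z) * fund_hat z (tdist v w))) / (1 + 1 / of_nat q)"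
proof -
  note z = circle_nonsingular[OF assms(2)]
  define k where "k = (1 + 1 / of_nat q :: complex)"
  have k: "k \<noteq> 0" using q_plus_1 by (simp add: k_def)
  have kk: "complex_of_real ((cmod (kappa z))\<^sup>2) = (inverse z - z) * hat_const z / k"
  proof -
    define P where "P = 1 - z\<^sup>2 / of_nat q"
    define Q where "Q = 1 - (inverse z)\<^sup>2 / of_nat q"
    have PQ: "P \<noteq> 0" "Q \<noteq> 0" using circle_denom[OF assms(2)] by (simp_all add: P_def Q_def)
    have 1: "z - inverse z / of_nat q = z * Q"
      using z(1) by (simp add: Q_def power2_eq_square right_diff_distrib)
    have "cnj (z - inverse z / of_nat q) = inverse z - z / of_nat q" by (simp add: z)
    also have "\<dots> = inverse z * P"
      using z(1) by (simp add: P_def power2_eq_square right_diff_distrib)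
    finally have 2: "cnj (z - inverse z / of_nat q) = inverse z * P" .
    have 3: "cnj (z - inverse z) = inverse z - z" by (simp add: z)
    have "complex_of_real ((cmod (kappa z))\<^sup>2) = kappa z * cnj (kappa z)" by (rule complex_norm_square)
    also have "\<dots> = ((z - inverse z) / (z * Q)) * ((inverse z - z) / (inverse z * P))"
      unfolding kappa_def complex_cnj_divide 2 3 unfolding 1 ..
    also have "\<dots> = (inverse z - z) * (z - inverse z) / (P * Q)"
      using PQ z(1) by (simp add: divide_simps)
    also have "\<dots> = (inverse z - z) * hat_const z / k"
      unfolding hat_const_def k_def[symmetric] P_def[symmetric] Q_def[symmetric] using k by simp
    finally show ?thesis .
  qed
  have "complex_of_real ((L2_norm \<nu> (\<lambda>\<omega>. T_minus_data f (z, \<omega>)))\<^sup>2) =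
      complex_of_real ((cmod (kappa z))\<^sup>2) * complex_of_real ((L2_norm \<nu> (kernel_sum (a_of z) S (symbol f z)))\<^sup>2)"
    unfolding T_minus_data_eq[OF assms] L2_norm_cmult by (simp add: power_mult_distrib)
  also have "\<dots> = (\<Sum>v\<in>S. \<Sum>w\<in>S. symbol f z v * cnj (symbol f z w) *
      ((inverse z - z) * (hat_const z * kernel_pairing (a_of z) (b_of z) v w))) / k"
    unfolding kk L2_norm_kernel_sum[OF assms(2)] sum_divide_distrib sum_distrib_left
    by (intro sum.cong refl) (simp add: mult_ac)
  finally show ?thesis unfolding fund_hat_pairing[OF assms(2), symmetric] k_def .
qed

text \<open>The factor by which \<open>T_minus\<close> multiplies the square of the energy norm.\<close>
definition energy_const :: real where "energy_const = 4 * pi / (1 + 1 / q)"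

lemma energy_const_pos: "energy_const > 0"
  by (simp add: energy_const_def add_pos_nonneg)

text \<open>The product of two symbols contributes the powers 1, 2 and 3 of \<open>inverse z - z\<close>: the first gives
  the inner product of the second components of the data, the second, from the mixed terms, gives zero,
  and the third gives the form of \<open>1 - adj\<^sup>2 / (4 * q)\<close> on the first components.\<close>
theorem T_minus_isometry:
  assumes "f \<in> data"
  shows "complex_of_real ((L2_norm circle_bdry (T_minus_data f))\<^sup>2) = of_real energy_const * energy f f"
proof -
  obtain S where S: "supports S f" using data_supports[OF assms] by blast
  have fin: "finite S" using S by (simp add: supports_def)
  define k where "k = (1 + 1 / of_nat q :: complex)"
  define F1 where "F1 = fst f"
  define F2 where "F2 = snd f"
  define L where "L j v w = (\<lambda>z. (inverse z - z) ^ j * fund_hat z (tdist v w))" for j v w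
  have Li: "integrable circle (L j v w)" for j v w
    unfolding L_def by (intro circle_continuous_integrable continuous_intros)
  have L1: "(\<integral>z. L 1 v w z \<partial>circle) = of_real (4 * pi) * (if v = w then 1 else 0)" for v w
    unfolding L_def by (simp add: integral_fund_hat)
  have L2: "(\<integral>z. L 2 v w z \<partial>circle) = 0" for v w
    unfolding L_def by (rule integral_fund_hat_square)
  have L3: "(\<integral>z. L 3 v w z \<partial>circle) = of_real (4 * pi) *
      (adj (adj (\<lambda>x. if v = x then 1 else 0)) w / of_nat q - 4 * (if v = w then 1 else 0))" for v w
  proof -
    have 1: "(\<lambda>x. if v = x then of_real (4 * pi) else (0 :: complex)) = (\<lambda>x. of_real (4 * pi) * (if v = x then 1 else 0))"
      by auto
    have "adj (\<lambda>x. of_real (4 * pi) * (if v = x then 1 else 0)) = (\<lambda>u. of_real (4 * pi) * adj (\<lambda>x. if v = x then 1 else 0) u)"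
      by (rule ext) (rule adj_cmult)
    then have "adj (adj (\<lambda>x. if v = x then of_real (4 * pi) else (0 :: complex))) w =
        of_real (4 * pi) * adj (adj (\<lambda>x. if v = x then 1 else 0)) w"
      unfolding 1 by (simp only: adj_cmult)
    then show ?thesis unfolding L_def integral_fund_hat_cube by (simp add: right_diff_distrib)
  qed
  have "complex_of_real ((L2_norm circle_bdry (T_minus_data f))\<^sup>2) =
      (\<integral>z. complex_of_real ((L2_norm \<nu> (\<lambda>\<omega>. T_minus_data f (z, \<omega>)))\<^sup>2) \<partial>circle)"
    unfolding L2_norm_product(1)[OF T_minus_L2[OF assms]] by (simp del: of_real_power)
  also have "\<dots> = (\<integral>z. (\<Sum>v\<in>S. \<Sum>w\<in>S. (- 1 / 4 * F1 v * cnj (F1 w)) * L 3 v w z +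
      (1 / 2 * (F1 v * cnj (F2 w) - F2 v * cnj (F1 w))) * L 2 v w z + (F2 v * cnj (F2 w)) * L 1 v w z) / k \<partial>circle)"
  proof (intro Bochner_Integration.integral_cong refl)
    fix z assume "z \<in> space circle"
    then have z: "cmod z = 1" by simp
    have "symbol f z v * cnj (symbol f z w) * ((inverse z - z) * fund_hat z (tdist v w)) =
      (- 1 / 4 * F1 v * cnj (F1 w)) * L 3 v w z +
      (1 / 2 * (F1 v * cnj (F2 w) - F2 v * cnj (F1 w))) * L 2 v w z + (F2 v * cnj (F2 w)) * L 1 v w z" for v w
    proof -
      have "cnj (symbol f z w) = - (inverse z - z) / 2 * cnj (F1 w) + cnj (F2 w)"
        by (simp add: symbol_def circle_nonsingular(3)[OF z] F1_def F2_def)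
      moreover have "(e / 2 * a + b) * (- e / 2 * c + d) * (e * l) = (- 1 / 4 * a * c) * (e ^ 3 * l) +
          (1 / 2 * (a * d - b * c)) * (e ^ 2 * l) + (b * d) * (e ^ 1 * l)" for e a b c d l :: complex
        by (simp add: power3_eq_cube power2_eq_square algebra_simps)
      ultimately show ?thesis
        unfolding L_def symbol_def F1_def[symmetric] F2_def[symmetric] by (simp only:)
    qed
    then show "complex_of_real ((L2_norm \<nu> (\<lambda>\<omega>. T_minus_data f (z, \<omega>)))\<^sup>2) =
        (\<Sum>v\<in>S. \<Sum>w\<in>S. (- 1 / 4 * F1 v * cnj (F1 w)) * L 3 v w z +
      (1 / 2 * (F1 v * cnj (F2 w) - F2 v * cnj (F1 w))) * L 2 v w z + (F2 v * cnj (F2 w)) * L 1 v w z) / k"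
      unfolding T_minus_fibre_norm[OF S z] k_def by simp
  qed
  also have "\<dots> = (\<Sum>v\<in>S. \<Sum>w\<in>S. (- 1 / 4 * F1 v * cnj (F1 w)) * (\<integral>z. L 3 v w z \<partial>circle) +
      (1 / 2 * (F1 v * cnj (F2 w) - F2 v * cnj (F1 w))) * (\<integral>z. L 2 v w z \<partial>circle) +
      (F2 v * cnj (F2 w)) * (\<integral>z. L 1 v w z \<partial>circle)) / k"
    using Li by (simp add: Bochner_Integration.integral_sum Bochner_Integration.integral_add)
  also have "\<dots> = of_real (4 * pi) / k * (\<Sum>w\<in>S. \<Sum>v\<in>S. F1 v * ((if v = w then 1 else 0) -
      adj (adj (\<lambda>x. if v = x then 1 else 0)) w / of_nat (4 * q)) * cnj (F1 w) +
      F2 v * (if v = w then 1 else 0) * cnj (F2 w))"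
  proof -
    have id: "(- 1 / 4 * a * c) * (p * (A / of_nat q - 4 * \<delta>)) + m * 0 + b * d * (p * \<delta>) =
        p * (a * (\<delta> - A / of_nat (4 * q)) * c + b * \<delta> * d)" for a b c d p m A \<delta> :: complex
      using q_ge_2 by (simp add: field_simps)
    show ?thesis
      unfolding L1 L2 L3 id
      by (subst (2) sum.swap) (simp only: sum_distrib_left sum_divide_distrib times_divide_eq_left)
  qed
  also have "\<dots> = of_real (4 * pi) / k * (\<Sum>w\<in>S. (F1 w - adj (adj F1) w / of_nat (4 * q)) * cnj (F1 w) + F2 w * cnj (F2 w))"
  proof -
    have delta: "(\<Sum>v\<in>S. h v * (if v = x then 1 else 0)) = h x" if "\<And>x. x \<notin> S \<Longrightarrow> h x = 0" for h :: "'v \<Rightarrow> complex" and x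
      using that fin by (simp add: if_distrib cong: if_cong)
    have d1: "(\<Sum>v\<in>S. F1 v * (if v = x then 1 else 0)) = F1 x" for x
      by (rule delta) (use S in \<open>simp add: supports_def F1_def\<close>)
    have d2: "(\<Sum>v\<in>S. F2 v * (if v = x then 1 else 0)) = F2 x" for x
      by (rule delta) (use S in \<open>simp add: supports_def F2_def\<close>)
    have aa: "(\<Sum>v\<in>S. F1 v * adj (adj (\<lambda>x. if v = x then 1 else 0)) w) = adj (adj F1) w" for w
    proof -
      have "(\<Sum>v\<in>S. F1 v * adj (adj (\<lambda>x. if v = x then 1 else 0)) w) =
          adj (\<lambda>u. adj (\<lambda>x. \<Sum>v\<in>S. F1 v * (if v = x then 1 else 0)) u) w"
        by (simp add: adj_sum adj_cmult)
      then show ?thesis unfolding d1 by simp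
    qed
    have "(\<Sum>v\<in>S. F1 v * ((if v = w then 1 else 0) -
      adj (adj (\<lambda>x. if v = x then 1 else 0)) w / of_nat (4 * q)) * cnj (F1 w) +
      F2 v * (if v = w then 1 else 0) * cnj (F2 w)) =
      (F1 w - adj (adj F1) w / of_nat (4 * q)) * cnj (F1 w) + F2 w * cnj (F2 w)" for w
    proof -
      have "(\<Sum>v\<in>S. F1 v * ((if v = w then 1 else 0) -
        adj (adj (\<lambda>x. if v = x then 1 else 0)) w / of_nat (4 * q)) * cnj (F1 w) +
        F2 v * (if v = w then 1 else 0) * cnj (F2 w)) =
        ((\<Sum>v\<in>S. F1 v * (if v = w then 1 else 0)) - (\<Sum>v\<in>S. F1 v * adj (adj (\<lambda>x. if v = x then 1 else 0)) w) / of_nat (4 * q)) * cnj (F1 w) +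
        (\<Sum>v\<in>S. F2 v * (if v = w then 1 else 0)) * cnj (F2 w)"
        unfolding sum_distrib_right sum_divide_distrib sum_subtractf[symmetric] sum.distrib[symmetric]
        by (intro sum.cong refl) (simp add: field_simps)
      then show ?thesis unfolding d1 d2 aa .
    qed
    then show ?thesis by simp
  qed
  finally show ?thesis
    unfolding energy_eq[OF S] F1_def F2_def k_def energy_const_def by simp
qed

end


section \<open>Multiplication by the spectral parameter\<close>

context regular_tree
begin

text \<open>Seen from a neighbourhood of \<open>w\<close>, the end \<open>\<omega>\<close> may be replaced by the vertex \<open>x\<close> of its ray just beyond
  the level of \<open>w\<close>: one neighbour of \<open>w\<close> is closer to it, and \<open>q\<close> are farther away.\<close>
lemma poisson_kernel_adj:
  assumes "a \<noteq> 0"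
  shows "adj (\<lambda>u. poisson_kernel a u \<omega>) w = (a + of_nat q / a) * poisson_kernel a w \<omega>"
proof (cases "\<omega> \<in> \<Omega>")
  case True
  define n where "n = Suc (level w)"
  define x where "x = ray \<omega> n"
  define F where "F d = a powi (int n - int d)" for d
  have xw: "w \<noteq> x" using level_ray[OF True, of n] by (auto simp: x_def n_def)
  have pk: "poisson_kernel a u \<omega> = F (tdist x u)" if "level u \<le> n" for u
    using True horo_eq[OF True that] by (simp add: poisson_kernel_def F_def x_def)
  have "adj (\<lambda>u. poisson_kernel a u \<omega>) w = adj (\<lambda>u. F (tdist x u)) w"
    unfolding adj_def
  proof (intro sum.cong refl)
    fix u assume "u \<in> {u. E w u}"
    then have "level u \<le> n" using tdist_nbr_cases[of w u org] by (auto simp: n_def)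
    then show "poisson_kernel a u \<omega> = F (tdist x u)" by (rule pk)
  qed
  also have "\<dots> = F (tdist x w - 1) + of_nat q * F (tdist x w + 1)"
    using xw by (simp add: adj_radial)
  also have "F (tdist x w - 1) = a * F (tdist x w)"
  proof -
    obtain d where "tdist x w = Suc d" using xw by (metis not0_implies_Suc tdist_eq_0_iff)
    then have e: "int n - int (tdist x w - 1) = 1 + (int n - int (tdist x w))" by simp
    show ?thesis unfolding F_def e using assms by (subst power_int_add) simp_all
  qed
  also have "F (tdist x w + 1) = F (tdist x w) / a"
  proof -
    have e: "int n - int (tdist x w + 1) = (int n - int (tdist x w)) - 1" by simp
    show ?thesis unfolding F_def e using assms by (subst power_int_diff) simp_all
  qed
  also have "F (tdist x w) = poisson_kernel a w \<omega>" by (rule pk[symmetric]) (simp add: n_def)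
  finally show ?thesis by (simp add: algebra_simps)
next
  case False
  then show ?thesis by (simp add: poisson_kernel_def adj_zero)
qed

definition nbhd :: "'v set \<Rightarrow> 'v set" where
  "nbhd S = S \<union> (\<Union>w\<in>S. {u. E w u})"

lemma finite_nbhd: "finite S \<Longrightarrow> finite (nbhd S)"
  using finite_nbrs by (simp add: nbhd_def)

lemma adj_outside_nbhd: "(\<And>w. w \<notin> S \<Longrightarrow> h w = 0) \<Longrightarrow> u \<notin> nbhd S \<Longrightarrow> adj h u = 0"
  unfolding adj_def nbhd_def using adj_sym by (intro sum.neutral) blast

text \<open>Double counting of the edges meeting \<open>S\<close>. The larger set \<open>S'\<close> appears because applying \<open>adj\<close> enlarges
  the support.\<close>
lemma adj_selfadjoint:
  assumes "finite S" "\<And>w. w \<notin> S \<Longrightarrow> h w = 0" "nbhd S \<subseteq> S'" "finite S'"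
  shows "(\<Sum>w\<in>S'. adj h w * g w) = (\<Sum>w\<in>S. h w * adj g w)"
proof -
  have "(\<Sum>w\<in>S. h w * adj g w) = (\<Sum>w\<in>S. \<Sum>u\<in>S'. if E w u then h w * g u else 0)"
  proof (intro sum.cong refl)
    fix w assume w: "w \<in> S"
    have "adj g w = (\<Sum>u\<in>S'. if E w u then g u else 0)"
      unfolding adj_def using w assms(3,4)
      by (intro sum.mono_neutral_cong_left) (auto simp: nbhd_def)
    then show "h w * adj g w = (\<Sum>u\<in>S'. if E w u then h w * g u else 0)"
      by (simp add: sum_distrib_left if_distrib cong: if_cong)
  qed
  also have "\<dots> = (\<Sum>u\<in>S'. \<Sum>w\<in>S. if E w u then h w * g u else 0)" by (rule sum.swap)
  also have "\<dots> = (\<Sum>u\<in>S'. adj h u * g u)"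
  proof (intro sum.cong refl)
    fix u
    have "adj h u = (\<Sum>w\<in>{w. E u w} \<inter> S. h w)"
      unfolding adj_def using assms(2) finite_nbrs by (intro sum.mono_neutral_right) auto
    also have "\<dots> = (\<Sum>w\<in>S. if E w u then h w else 0)"
    proof -
      have "{w. E u w} \<inter> S = {w \<in> S. E w u}" using adj_sym by blast
      then show ?thesis using sum.inter_filter[OF assms(1), of h "\<lambda>w. E w u"] by simp
    qed
    finally show "(\<Sum>w\<in>S. if E w u then h w * g u else 0) = adj h u * g u"
      by (simp add: sum_distrib_right if_distrib[of "\<lambda>x. x * _"] cong: if_cong)
  qed
  finally show ?thesis ..
qed

end

context tree_boundary
begin

definition half_adj :: "('v \<Rightarrow> complex) \<Rightarrow> 'v \<Rightarrow> complex" where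
  "half_adj h v = adj h v / of_real (2 * sqrt q)"

lemma kernel_sum_half_adj:
  assumes "finite S" "\<And>w. w \<notin> S \<Longrightarrow> h w = 0" "nbhd S \<subseteq> S'" "finite S'" "z \<noteq> 0"
  shows "kernel_sum (a_of z) S' (half_adj h) \<omega> = (z + inverse z) / 2 * kernel_sum (a_of z) S' h \<omega>"
proof -
  define s where "s = (of_real (sqrt q) :: complex)"
  have s: "s \<noteq> 0" "s * s = of_nat q" using q_sqrt by (simp_all add: s_def)
  have c: "(a_of z + of_nat q / a_of z) = s * (z + inverse z)"
    unfolding s(2)[symmetric] using s(1) assms(5) by (simp add: s_def[symmetric] divide_inverse algebra_simps)
  have "kernel_sum (a_of z) S' (half_adj h) \<omega> = (\<Sum>w\<in>S'. adj h w * poisson_kernel (a_of z) w \<omega>) / (2 * s)"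
    by (simp add: kernel_sum_def half_adj_def s_def sum_divide_distrib)
  also have "(\<Sum>w\<in>S'. adj h w * poisson_kernel (a_of z) w \<omega>) =
      (\<Sum>w\<in>S. h w * adj (\<lambda>u. poisson_kernel (a_of z) u \<omega>) w)"
    by (rule adj_selfadjoint[OF assms(1-4)])
  also have "\<dots> = (\<Sum>w\<in>S. h w * (s * (z + inverse z) * poisson_kernel (a_of z) w \<omega>))"
    unfolding poisson_kernel_adj[OF a_nz[OF assms(5)]] c ..
  also have "\<dots> / (2 * s) = (z + inverse z) / 2 * (\<Sum>w\<in>S. h w * poisson_kernel (a_of z) w \<omega>)"
    unfolding sum_distrib_left sum_divide_distrib using s(1) by (intro sum.cong refl) simp
  also have "(\<Sum>w\<in>S. h w * poisson_kernel (a_of z) w \<omega>) = kernel_sum (a_of z) S' h \<omega>"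
    unfolding kernel_sum_def using assms(2-4)
    by (intro sum.mono_neutral_left) (auto simp: nbhd_def)
  finally show ?thesis .
qed

lemma kernel_sum_add: "kernel_sum a S (\<lambda>w. c w + d w) \<omega> = kernel_sum a S c \<omega> + kernel_sum a S d \<omega>"
  by (simp add: kernel_sum_def ring_distribs sum.distrib)

text \<open>Multiplication by \<open>(z + inverse z) / 2 - \<epsilon> (inverse z - z) / 2\<close>, that is by \<open>z\<close> for \<open>\<epsilon> = 1\<close> and
  by \<open>inverse z\<close> for \<open>\<epsilon> = -1\<close>, corresponds to the step of the wave evolution backward respectively forward
  in time, and it preserves finite support because waves propagate with finite speed.\<close>
definition wave_step :: "complex \<Rightarrow> 'v data \<Rightarrow> 'v data" where
  "wave_step \<epsilon> f = (\<lambda>v. half_adj (fst f) v - \<epsilon> * snd f v,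
     \<lambda>v. half_adj (snd f) v - \<epsilon> * (half_adj (half_adj (fst f)) v - fst f v))"

lemma T_minus_wave_step:
  assumes "f \<in> data"
  shows "wave_step \<epsilon> f \<in> data"
    "cmod z = 1 \<Longrightarrow> T_minus_data (wave_step \<epsilon> f) (z, \<omega>) =
      ((z + inverse z) / 2 - \<epsilon> * ((inverse z - z) / 2)) * T_minus_data f (z, \<omega>)"
proof -
  obtain S where S: "supports S f" using data_supports[OF assms] by blast
  define S1 where "S1 = nbhd S"
  define S2 where "S2 = nbhd S1"
  have fin: "finite S" "finite S1" "finite S2"
    using S finite_nbhd by (auto simp: supports_def S1_def S2_def)
  have sub: "S \<subseteq> S1" "S1 \<subseteq> S2" by (auto simp: S1_def S2_def nbhd_def)
  have z1: "fst f w = 0" "snd f w = 0" if "w \<notin> S" for w using S that by (auto simp: supports_def)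
  have z2: "half_adj (fst f) w = 0" "half_adj (snd f) w = 0" if "w \<notin> S1" for w
    using adj_outside_nbhd[OF z1(1)] adj_outside_nbhd[OF z1(2)] that by (auto simp: half_adj_def S1_def)
  have z3: "half_adj (half_adj (fst f)) w = 0" if "w \<notin> S2" for w
    using adj_outside_nbhd[OF z2(1)] that by (simp add: half_adj_def[of "half_adj _"] S2_def)
  have supp: "supports S2 (wave_step \<epsilon> f)"
    unfolding supports_def wave_step_def fst_conv snd_conv
  proof (intro conjI allI impI)
    fix v assume v: "v \<notin> S2"
    then have "v \<notin> S1" "v \<notin> S" using sub by auto
    then show "half_adj (fst f) v - \<epsilon> * snd f v = 0"
      "half_adj (snd f) v - \<epsilon> * (half_adj (half_adj (fst f)) v - fst f v) = 0"
      using z1 z2 z3[OF v] by simp_all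
  qed (rule fin)
  then show "wave_step \<epsilon> f \<in> data" by (rule supports_data)
  have supp2: "supports S2 f" using S sub fin by (auto simp: supports_def)
  assume c: "cmod z = 1"
  then have z0: "z \<noteq> 0" by auto
  define k where "k = (\<lambda>h. kernel_sum (a_of z) S2 h \<omega>)"
  define e where "e = (inverse z - z) / 2"
  define g where "g = (z + inverse z) / 2"
  have k_add: "k (\<lambda>w. c w + d w) = k c + k d" for c d by (simp add: k_def kernel_sum_add)
  have k_scale: "k (\<lambda>w. r * c w) = r * k c" for r c by (simp add: k_def kernel_sum_scale)
  have B1: "k (half_adj (fst f)) = g * k (fst f)" "k (half_adj (snd f)) = g * k (snd f)"
    unfolding k_def g_def
    by (rule kernel_sum_half_adj[OF fin(1)]; use z1 sub fin z0 S1_def in auto)+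
  have B2: "k (half_adj (half_adj (fst f))) = g * k (half_adj (fst f))"
    unfolding k_def g_def
    by (rule kernel_sum_half_adj[OF fin(2)]; use z2 sub fin z0 S2_def in auto)
  have "symbol (wave_step \<epsilon> f) z = (\<lambda>w. e * half_adj (fst f) w + (- e * \<epsilon>) * snd f w +
      (half_adj (snd f) w + ((- \<epsilon>) * half_adj (half_adj (fst f)) w + \<epsilon> * fst f w)))"
    unfolding symbol_def wave_step_def fst_conv snd_conv e_def[symmetric]
    by (rule ext) (simp add: algebra_simps)
  then have "k (symbol (wave_step \<epsilon> f) z) = e * k (half_adj (fst f)) + (- e * \<epsilon>) * k (snd f) +
      (k (half_adj (snd f)) + ((- \<epsilon>) * k (half_adj (half_adj (fst f))) + \<epsilon> * k (fst f)))"
    by (simp only: k_add k_scale)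
  also have "\<dots> = (g - \<epsilon> * e) * (e * k (fst f) + k (snd f))"
  proof -
    have "g * g = e * e + 1" using z0 by (simp add: g_def e_def field_simps)
    then have gg: "g * (g * x) = e * (e * x) + x" for x by (metis mult.assoc distrib_right mult_1_left)
    show ?thesis unfolding B2 B1 gg by (simp add: algebra_simps)
  qed
  also have "e * k (fst f) + k (snd f) = k (symbol f z)"
    unfolding symbol_def e_def[symmetric] k_add k_scale ..
  finally show "T_minus_data (wave_step \<epsilon> f) (z, \<omega>) = ((z + inverse z) / 2 - \<epsilon> * ((inverse z - z) / 2)) * T_minus_data f (z, \<omega>)"
    unfolding T_minus_data_eq[OF supp c] T_minus_data_eq[OF supp2 c] k_def e_def g_def
    by (simp only: mult_ac)
qed

definition data_comb :: "complex \<Rightarrow> 'v data \<Rightarrow> 'v data \<Rightarrow> 'v data" where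
  "data_comb c f g = (\<lambda>v. c * fst f v + fst g v, \<lambda>v. c * snd f v + snd g v)"

lemma T_minus_data_comb:
  assumes "f \<in> data" "g \<in> data"
  shows "data_comb c f g \<in> data"
    "cmod z = 1 \<Longrightarrow> T_minus_data (data_comb c f g) (z, \<omega>) = c * T_minus_data f (z, \<omega>) + T_minus_data g (z, \<omega>)"
proof -
  obtain S S' where S: "supports S f" "supports S' g" using data_supports assms by blast
  have U: "supports (S \<union> S') f" "supports (S \<union> S') g" "supports (S \<union> S') (data_comb c f g)"
    using S by (auto simp: supports_def data_comb_def)
  show "data_comb c f g \<in> data" by (rule supports_data[OF U(3)])
  assume z: "cmod z = 1"
  have "symbol (data_comb c f g) z = (\<lambda>w. c * symbol f z w + symbol g z w)"
    by (rule ext) (simp add: symbol_def data_comb_def algebra_simps)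
  then show "T_minus_data (data_comb c f g) (z, \<omega>) = c * T_minus_data f (z, \<omega>) + T_minus_data g (z, \<omega>)"
    unfolding T_minus_data_eq[OF U(1) z] T_minus_data_eq[OF U(2) z] T_minus_data_eq[OF U(3) z]
    by (simp add: kernel_sum_add kernel_sum_scale algebra_simps)
qed


section \<open>Density of the range\<close>

text \<open>Values off the circle and off the boundary are left free, so that the set depends on functions on the
  product space only.\<close>
definition T_range :: "(complex \<times> 'v bdry \<Rightarrow> complex) set" where
  "T_range = {F \<in> L2_space circle_bdry. \<exists>f\<in>data. \<forall>z \<omega>. cmod z = 1 \<longrightarrow> \<omega> \<in> \<Omega> \<longrightarrow>
     F (z, \<omega>) = T_minus_data f (z, \<omega>)}"

lemma L2_space_product_cong:
  assumes "\<And>z \<omega>. cmod z = 1 \<Longrightarrow> \<omega> \<in> \<Omega> \<Longrightarrow> F (z, \<omega>) = G (z, \<omega>)"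
  shows "F \<in> L2_space circle_bdry \<longleftrightarrow> G \<in> L2_space circle_bdry"
proof -
  have e: "x \<in> space circle_bdry \<Longrightarrow> F x = G x" for x
    using assms by (auto simp: space_pair_measure)
  have "F \<in> borel_measurable circle_bdry \<longleftrightarrow> G \<in> borel_measurable circle_bdry"
    using e by (intro measurable_cong)
  moreover have "integrable circle_bdry (\<lambda>x. (cmod (F x))\<^sup>2) \<longleftrightarrow> integrable circle_bdry (\<lambda>x. (cmod (G x))\<^sup>2)"
    using e by (intro Bochner_Integration.integrable_cong) auto
  ultimately show ?thesis by (simp add: L2_space_def)
qed

lemma T_range_cong:
  assumes "F \<in> T_range" "\<And>z \<omega>. cmod z = 1 \<Longrightarrow> \<omega> \<in> \<Omega> \<Longrightarrow> G (z, \<omega>) = F (z, \<omega>)"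
  shows "G \<in> T_range"
  using assms(1) L2_space_product_cong[of G F, OF assms(2)] assms(2) unfolding T_range_def by simp

lemma T_range_comb:
  assumes "F \<in> T_range" "G \<in> T_range"
  shows "(\<lambda>x. c * F x + G x) \<in> T_range"
proof -
  obtain f g where f: "f \<in> data" "\<And>z \<omega>. cmod z = 1 \<Longrightarrow> \<omega> \<in> \<Omega> \<Longrightarrow> F (z, \<omega>) = T_minus_data f (z, \<omega>)"
    and g: "g \<in> data" "\<And>z \<omega>. cmod z = 1 \<Longrightarrow> \<omega> \<in> \<Omega> \<Longrightarrow> G (z, \<omega>) = T_minus_data g (z, \<omega>)"
    using assms unfolding T_range_def by blast
  have "(\<lambda>x. c * F x + G x) \<in> L2_space circle_bdry"
    using assms by (intro L2_add L2_cmult) (auto simp: T_range_def)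
  then show ?thesis unfolding T_range_def using f(2) g(2) T_minus_data_comb[OF f(1) g(1)]
    by (intro CollectI conjI bexI[of _ "data_comb c f g"]) auto
qed

lemma T_range_data:
  assumes "f \<in> data" "\<And>z \<omega>. cmod z = 1 \<Longrightarrow> \<omega> \<in> \<Omega> \<Longrightarrow> F (z, \<omega>) = T_minus_data f (z, \<omega>)"
  shows "F \<in> T_range"
  using assms T_minus_L2[OF assms(1)] L2_space_product_cong[of F "T_minus_data f", OF assms(2)]
  unfolding T_range_def by blast

lemma T_range_zero: "(\<lambda>_. 0) \<in> T_range"
proof (rule T_range_data[of "(\<lambda>_. 0, \<lambda>_. 0)"])
  have s: "supports {} ((\<lambda>_. 0, \<lambda>_. 0) :: 'v data)" by (simp add: supports_def)
  then show "(\<lambda>_. 0, \<lambda>_. 0) \<in> data" by (rule supports_data)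
  show "0 = T_minus_data (\<lambda>_. 0, \<lambda>_. 0) (z, \<omega>)" if "cmod z = 1" for z \<omega>
    using T_minus_data_eq[OF s that] by (simp add: kernel_sum_def)
qed

interpretation R: L2_subspace "circle_bdry" T_range
proof
  show "T_range \<subseteq> L2_space circle_bdry" by (auto simp: T_range_def)
  show "(\<lambda>x. f x + g x) \<in> T_range" if "f \<in> T_range" "g \<in> T_range" for f g
    using T_range_comb[OF that, of 1] by simp
  show "(\<lambda>x. c * f x) \<in> T_range" if "f \<in> T_range" for f c
    using T_range_comb[OF that T_range_zero, of c] by simp
qed (rule T_range_zero)

lemma T_range_mult:
  assumes "F \<in> T_range"
  shows "(\<lambda>(z, \<omega>). z * F (z, \<omega>)) \<in> T_range" "(\<lambda>(z, \<omega>). inverse z * F (z, \<omega>)) \<in> T_range"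
proof -
  obtain f where f: "f \<in> data" "\<And>z \<omega>. cmod z = 1 \<Longrightarrow> \<omega> \<in> \<Omega> \<Longrightarrow> F (z, \<omega>) = T_minus_data f (z, \<omega>)"
    using assms unfolding T_range_def by blast
  show "(\<lambda>(z, \<omega>). z * F (z, \<omega>)) \<in> T_range"
    by (rule T_range_data[OF T_minus_wave_step(1)[OF f(1), of 1]])
      (simp add: T_minus_wave_step(2)[OF f(1)] f(2) field_simps)
  show "(\<lambda>(z, \<omega>). inverse z * F (z, \<omega>)) \<in> T_range"
    by (rule T_range_data[OF T_minus_wave_step(1)[OF f(1), of "-1"]])
      (simp add: T_minus_wave_step(2)[OF f(1)] f(2) field_simps)
qed

lemma T_range_inverse_power: "F \<in> T_range \<Longrightarrow> (\<lambda>(z, \<omega>). inverse z ^ n * F (z, \<omega>)) \<in> T_range"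
proof (induction n)
  case (Suc n)
  show ?case
    by (rule T_range_cong[OF T_range_mult(2)[OF Suc.IH[OF Suc.prems]]]) simp
qed simp

lemma T_range_kernel: "(\<lambda>(z, \<omega>). kappa z * poisson_kernel (a_of z) w \<omega>) \<in> T_range"
proof (rule T_range_data)
  define f where "f = ((\<lambda>_. 0, \<lambda>v. if v = w then 1 else 0) :: 'v data)"
  have s: "supports {w} f" by (auto simp: supports_def f_def)
  then show "f \<in> data" by (rule supports_data)
  show "(\<lambda>(z, \<omega>). kappa z * poisson_kernel (a_of z) w \<omega>) (z, \<omega>) = T_minus_data f (z, \<omega>)" if "cmod z = 1" for z \<omega>
    unfolding T_minus_data_eq[OF s that] by (simp add: kernel_sum_def symbol_def f_def)
qed

text \<open>Away from \<open>org\<close>, the combination of two kernels that isolates the indicator carries the factor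
  \<open>1 - inverse (a_of z) ^ 2\<close>, which cancels the denominator of \<open>kappa\<close>. The numerator \<open>z - inverse z\<close> survives,
  and powers of \<open>z\<close> are removed by multiplication. At \<open>org\<close> the kernel is the indicator already, and one
  multiplies by the denominator.\<close>
lemma T_range_cyl: "(\<lambda>(z, \<omega>). (z - inverse z) * indicator (cyl w) \<omega>) \<in> T_range"
proof (cases "w = org")
  case True
  define e where "e = (\<lambda>(z, \<omega>). kappa z * poisson_kernel (a_of z) org \<omega>)"
  have e: "e \<in> T_range" unfolding e_def by (rule T_range_kernel)
  show ?thesis
  proof (rule T_range_cong[OF T_range_comb[OF T_range_mult(2)[OF e] T_range_mult(1)[OF e], of "- 1 / of_nat q"]])
    fix z :: complex and \<omega> assume z: "cmod z = 1"
    have "(z - inverse z / of_nat q) * kappa z = z - inverse z"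
      using circle_factor_nz(1)[OF z] by (simp add: kappa_def)
    then have "(z - inverse z / of_nat q) * kappa z * indicator \<Omega> \<omega> = (z - inverse z) * indicator \<Omega> \<omega>" by simp
    then show "(\<lambda>(z, \<omega>). (z - inverse z) * indicator (cyl w) \<omega>) (z, \<omega>) =
       - 1 / of_nat q * (\<lambda>(z, \<omega>). inverse z * e (z, \<omega>)) (z, \<omega>) + (\<lambda>(z, \<omega>). z * e (z, \<omega>)) (z, \<omega>)"
      unfolding True by (simp add: e_def poisson_kernel_org left_diff_distrib mult.assoc)
  qed
next
  case False
  define s where "s = (of_real (sqrt q) :: complex)"
  have s: "s \<noteq> 0" "s * s = of_nat q" using q_sqrt by (simp_all add: s_def)
  define L where "L = level w"
  define e1 where "e1 = (\<lambda>(z, \<omega>). kappa z * poisson_kernel (a_of z) w \<omega>)"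
  define e2 where "e2 = (\<lambda>(z, \<omega>). kappa z * poisson_kernel (a_of z) (parent w) \<omega>)"
  have e: "e1 \<in> T_range" "e2 \<in> T_range" unfolding e1_def e2_def by (rule T_range_kernel)+
  define G where "G x = (- 1 / s) * (\<lambda>(z, \<omega>). inverse z * e2 (z, \<omega>)) x + e1 x" for x
  have G: "G \<in> T_range" unfolding G_def[abs_def] by (rule T_range_comb[OF T_range_mult(2)[OF e(2)] e(1)])
  have "(\<lambda>x. (1 / s ^ L) * (\<lambda>(z, \<omega>). z * (\<lambda>(z, \<omega>). inverse z ^ L * G (z, \<omega>)) (z, \<omega>)) x) \<in> T_range"
    by (intro R.V_scale T_range_mult(1) T_range_inverse_power G)
  then show ?thesis
  proof (rule T_range_cong)
    fix z :: complex and \<omega> assume z: "cmod z = 1"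
    then have z0: "z \<noteq> 0" by auto
    define Q where "Q = 1 - (inverse z)\<^sup>2 / of_nat q"
    have Q: "Q \<noteq> 0" using circle_denom(2)[OF z] by (simp add: Q_def)
    have kQ: "kappa z * Q = inverse z * (z - inverse z)"
    proof -
      have "z - inverse z / of_nat q = z * Q" using z0 by (simp add: Q_def power2_eq_square right_diff_distrib)
      then show ?thesis unfolding kappa_def using Q z0 by (simp add: divide_simps)
    qed
    have ia: "inverse (a_of z) = inverse z / s" by (simp add: s_def divide_inverse)
    have Q2: "1 - inverse (a_of z) ^ 2 = Q"
      unfolding ia Q_def s(2)[symmetric] by (simp add: power_divide power2_eq_square)
    have "G (z, \<omega>) = kappa z * (poisson_kernel (a_of z) w \<omega> - inverse (a_of z) * poisson_kernel (a_of z) (parent w) \<omega>)"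
      unfolding ia by (simp add: G_def e1_def e2_def algebra_simps)
    also have "\<dots> = kappa z * (a_of z ^ L * Q * indicator (cyl w) \<omega>)"
      using fun_cong[OF poisson_kernel_parent[OF False a_nz[OF z0]], of \<omega>] unfolding Q2 L_def by simp
    also have "\<dots> = a_of z ^ L * (inverse z * (z - inverse z)) * indicator (cyl w) \<omega>"
      unfolding kQ[symmetric] by simp
    finally have G: "G (z, \<omega>) = s ^ L * z ^ L * (inverse z * (z - inverse z)) * indicator (cyl w) \<omega>"
      by (simp add: s_def power_mult_distrib)
    have "(1 / s ^ L) * (z * (inverse z ^ L * (s ^ L * z ^ L * (inverse z * (z - inverse z)) * indicator (cyl w) \<omega>))) =
        ((1 / s ^ L) * s ^ L) * (inverse z ^ L * z ^ L) * (z * inverse z) * (z - inverse z) * indicator (cyl w) \<omega>"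
      by (simp only: mult_ac)
    also have "\<dots> = (z - inverse z) * indicator (cyl w) \<omega>"
      using s(1) z0 by (simp flip: power_mult_distrib)
    finally show "(\<lambda>(z, \<omega>). (z - inverse z) * indicator (cyl w) \<omega>) (z, \<omega>) =
       (1 / s ^ L) * (\<lambda>(z, \<omega>). z * (\<lambda>(z, \<omega>). inverse z ^ L * G (z, \<omega>)) (z, \<omega>)) (z, \<omega>)"
      by (simp add: G)
  qed
qed

text \<open>The functions of the spectral parameter that can be approximated on a given cylinder.\<close>
definition approx :: "'v \<Rightarrow> (complex \<Rightarrow> complex) set" where
  "approx v = {F. (\<lambda>(z, \<omega>). F z * indicator (cyl v) \<omega>) \<in> R.cl}"

lemma approx_cong:
  assumes "F \<in> approx v" "\<And>z. cmod z = 1 \<Longrightarrow> G z = F z"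
  shows "G \<in> approx v"
  unfolding approx_def mem_Collect_eq
  by (rule R.cl_cong[OF assms(1)[unfolded approx_def mem_Collect_eq]])
    (auto simp: space_pair_measure assms(2))

lemma approx_add: "F \<in> approx v \<Longrightarrow> G \<in> approx v \<Longrightarrow> (\<lambda>z. F z + G z) \<in> approx v"
  unfolding approx_def mem_Collect_eq
  by (drule (1) R.cl_add) (simp add: case_prod_beta' distrib_right)

lemma approx_scale: "F \<in> approx v \<Longrightarrow> (\<lambda>z. c * F z) \<in> approx v"
  unfolding approx_def mem_Collect_eq
  by (drule R.cl_scale[of _ c]) (simp add: case_prod_beta' mult.assoc)

lemma approx_sum: "(\<And>i. i \<in> S \<Longrightarrow> F i \<in> approx v) \<Longrightarrow> (\<lambda>z. \<Sum>i\<in>S. F i z) \<in> approx v"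
proof (induction S rule: infinite_finite_induct)
  case (insert i S)
  then show ?case by (simp add: approx_add)
qed (use R.cl_zero in \<open>auto simp: approx_def case_prod_beta'\<close>)

text \<open>Multiplication by a function of modulus one is an isometry, so invariance passes to the closure.\<close>
lemma cl_mult_unimodular:
  assumes "G \<in> R.cl" "m \<in> borel_measurable circle_bdry"
    "\<And>x. x \<in> space circle_bdry \<Longrightarrow> cmod (m x) = 1"
    "\<And>F. F \<in> T_range \<Longrightarrow> (\<lambda>x. m x * F x) \<in> T_range"
  shows "(\<lambda>x. m x * G x) \<in> R.cl"
  unfolding L2_closure_def
proof safe
  show "(\<lambda>x. m x * G x) \<in> L2_space circle_bdry"
    by (rule L2_mult_bounded[OF R.cl_L2[OF assms(1)] assms(2), of 1]) (simp add: assms(3))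
  fix e :: real assume "e > 0"
  then obtain F where F: "F \<in> T_range" "L2_norm circle_bdry (\<lambda>x. F x - G x) < e"
    using assms(1) unfolding L2_closure_def by blast
  have "L2_norm circle_bdry (\<lambda>x. m x * F x - m x * G x) = L2_norm circle_bdry (\<lambda>x. F x - G x)"
    by (rule L2_norm_cong) (simp add: norm_mult assms(3) flip: right_diff_distrib)
  then show "\<exists>f\<in>T_range. L2_norm circle_bdry (\<lambda>x. f x - m x * G x) < e"
    using F assms(4) by (intro bexI[of _ "\<lambda>x. m x * F x"]) auto
qed

lemma approx_mult:
  assumes "F \<in> approx v"
  shows "(\<lambda>z. z * F z) \<in> approx v" "(\<lambda>z. inverse z * F z) \<in> approx v"
proof -
  have m: "(\<lambda>(z, \<omega>). z) \<in> borel_measurable circle_bdry" "(\<lambda>(z, \<omega>). inverse z) \<in> borel_measurable circle_bdry"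
    using bounded_measurable_circle[of "\<lambda>z. z"] bounded_measurable_circle[of inverse] continuous_on_circle_inverse
    by (auto simp: bounded_measurable_def)
  have 1: "(\<lambda>x. (\<lambda>(z, \<omega>). z) x * (\<lambda>(z, \<omega>). F z * indicator (cyl v) \<omega>) x) \<in> R.cl"
    by (rule cl_mult_unimodular[OF _ m(1)])
      (use assms T_range_mult(1) in \<open>auto simp: approx_def space_pair_measure case_prod_beta'\<close>)
  then show "(\<lambda>z. z * F z) \<in> approx v" by (simp add: approx_def case_prod_beta' mult.assoc)
  have 2: "(\<lambda>x. (\<lambda>(z, \<omega>). inverse z) x * (\<lambda>(z, \<omega>). F z * indicator (cyl v) \<omega>) x) \<in> R.cl"
    by (rule cl_mult_unimodular[OF _ m(2)])
      (use assms T_range_mult(2) in \<open>auto simp: approx_def space_pair_measure case_prod_beta' norm_inverse\<close>)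
  then show "(\<lambda>z. inverse z * F z) \<in> approx v" by (simp add: approx_def case_prod_beta' mult.assoc)
qed

lemma approx_power: "F \<in> approx v \<Longrightarrow> (\<lambda>z. z ^ n * F z) \<in> approx v"
  by (induction n) (use approx_mult(1) in \<open>auto simp: mult.assoc\<close>)

lemma L2_norm_tensor_le:
  assumes "continuous_on (sphere 0 1) F"
  shows "(L2_norm circle_bdry (\<lambda>(z, \<omega>). F z * indicator (cyl v) \<omega>))\<^sup>2 \<le> (\<integral>z. (cmod (F z))\<^sup>2 \<partial>circle)"
proof -
  have "bounded_measurable (\<lambda>x. (\<lambda>(z, \<omega>). F z) x * (\<lambda>(z, \<omega>). indicator (cyl v) \<omega>) x)"
    by (intro bounded_measurable_mult bounded_measurable_circle bounded_measurable_cyl assms)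
  from bounded_measurable_L2[OF this]
  have L: "(\<lambda>(z, \<omega>). F z * indicator (cyl v) \<omega>) \<in> L2_space circle_bdry" by (simp add: case_prod_beta')
  note p = L2_norm_product[OF L]
  have i: "integrable circle (\<lambda>z. (cmod (F z))\<^sup>2)"
  proof -
    have "integrable circle (\<lambda>z. complex_of_real ((cmod (F z))\<^sup>2))"
      by (intro circle_continuous_integrable continuous_intros assms)
    then show ?thesis by (simp only: complex_of_real_integrable_eq)
  qed
  have "(L2_norm \<nu> (\<lambda>\<omega>. F z * indicator (cyl v) \<omega>))\<^sup>2 \<le> (cmod (F z))\<^sup>2" for z
  proof -
    have "(L2_norm \<nu> (indicator (cyl v)))\<^sup>2 = (\<integral>\<omega>. indicator (cyl v) \<omega> \<partial>\<nu>)"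
      unfolding L2_norm_squared by (intro Bochner_Integration.integral_cong) (auto simp: indicator_def)
    also have "\<dots> \<le> 1" by simp
    finally have "(L2_norm \<nu> (indicator (cyl v)))\<^sup>2 \<le> 1" .
    then show ?thesis by (simp add: L2_norm_cmult power_mult_distrib mult_left_le)
  qed
  then show ?thesis unfolding p(1) using p(2) i by (intro integral_mono) simp_all
qed

text \<open>The zeros of \<open>z - inverse z\<close> form a null set, so they are no obstacle in mean square. Explicitly,
  \<open>1 - z ^ (2 * k)\<close> is a multiple of \<open>z - inverse z\<close> by a Laurent polynomial, and by orthogonality of the
  powers the means \<open>M n\<close> of \<open>n + 1\<close> powers have norm \<open>sqrt (2 * pi / (n + 1))\<close>.\<close>
lemma one_approx: "(\<lambda>_. 1) \<in> approx v"
proof -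
  have base: "(\<lambda>z. z - inverse z) \<in> approx v"
    unfolding approx_def using R.V_cl[OF T_range_cyl[of v]] by simp
  have step: "(\<lambda>z. z ^ (2 * k + 1) * (z - inverse z)) \<in> approx v" for k by (rule approx_power[OF base])
  have A: "(\<lambda>z. 1 - z ^ (2 * k)) \<in> approx v" for k
  proof (induction k)
    case 0
    have "(\<lambda>z. 0 * (z - inverse z)) \<in> approx v" by (rule approx_scale[OF base])
    then show ?case by simp
  next
    case (Suc k)
    show ?case
    proof (rule approx_cong[OF approx_add[OF Suc approx_scale[OF step[of k], of "-1"]]])
      fix z :: complex assume "cmod z = 1"
      then have "z \<noteq> 0" by auto
      then show "1 - z ^ (2 * Suc k) = 1 - z ^ (2 * k) + - 1 * (z ^ (2 * k + 1) * (z - inverse z))"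
        by (simp add: right_diff_distrib algebra_simps)
    qed
  qed
  define M where "M n z = (1 / of_nat (Suc n)) * (\<Sum>k<Suc n. z ^ (2 * Suc k))" for n and z :: complex
  have Mc: "continuous_on (sphere 0 1) (M n)" for n unfolding M_def[abs_def] by (intro continuous_intros)
  have Mi: "(\<integral>z. (cmod (M n z))\<^sup>2 \<partial>circle) = 2 * pi / real (Suc n)" for n
  proof -
    have "complex_of_real (\<integral>z. (cmod (M n z))\<^sup>2 \<partial>circle) = (\<integral>z. complex_of_real ((cmod (M n z))\<^sup>2) \<partial>circle)"
      by (simp del: of_real_power)
    also have "\<dots> = (\<integral>z. (1 / of_nat (Suc n))\<^sup>2 * (\<Sum>j<Suc n. \<Sum>k<Suc n. z powi (2 * int j - 2 * int k)) \<partial>circle)"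
    proof (intro Bochner_Integration.integral_cong refl)
      fix z assume "z \<in> space circle"
      then have z: "cmod z = 1" by simp
      note zz = circle_nonsingular[OF z]
      have t: "z ^ (2 * Suc j) * inverse z ^ (2 * Suc k) = z powi (2 * int j - 2 * int k)" for j k
      proof -
        have "z powi (2 * int j - 2 * int k) = z powi (int (2 * Suc j) - int (2 * Suc k))" by simp
        also have "\<dots> = z powi int (2 * Suc j) / z powi int (2 * Suc k)" using zz(1) by (intro power_int_diff) simp
        also have "\<dots> = z ^ (2 * Suc j) / z ^ (2 * Suc k)" by (simp only: power_int_of_nat)
        finally show ?thesis by (simp only: divide_inverse power_inverse)
      qed
      have "complex_of_real ((cmod (M n z))\<^sup>2) = M n z * cnj (M n z)" by (rule complex_norm_square)
      also have "cnj (M n z) = (1 / of_nat (Suc n)) * (\<Sum>k<Suc n. inverse z ^ (2 * Suc k))"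
        unfolding M_def by (simp only: complex_cnj_mult complex_cnj_divide complex_cnj_one complex_cnj_of_nat cnj_sum complex_cnj_power zz(3))
      also have "M n z * \<dots> = (1 / of_nat (Suc n))\<^sup>2 * ((\<Sum>j<Suc n. z ^ (2 * Suc j)) * (\<Sum>k<Suc n. inverse z ^ (2 * Suc k)))"
        unfolding M_def by (simp only: power2_eq_square mult_ac)
      also have "(\<Sum>j<Suc n. z ^ (2 * Suc j)) * (\<Sum>k<Suc n. inverse z ^ (2 * Suc k)) =
          (\<Sum>j<Suc n. \<Sum>k<Suc n. z powi (2 * int j - 2 * int k))"
        unfolding sum_product t ..
      finally show "complex_of_real ((cmod (M n z))\<^sup>2) =
          (1 / of_nat (Suc n))\<^sup>2 * (\<Sum>j<Suc n. \<Sum>k<Suc n. z powi (2 * int j - 2 * int k))" .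
    qed
    also have "\<dots> = (1 / of_nat (Suc n))\<^sup>2 * (\<Sum>j<Suc n. \<Sum>k<Suc n. \<integral>z. z powi (2 * int j - 2 * int k) \<partial>circle)"
    proof -
      have i: "integrable circle (\<lambda>z. z powi m)" for m
      proof (rule circle_continuous_integrable)
        show "continuous_on (sphere 0 1) (\<lambda>z :: complex. z powi m)"
          by (intro continuous_on_power_int continuous_on_id) auto
      qed
      show ?thesis using i by (simp add: Bochner_Integration.integral_sum del: sum.lessThan_Suc)
    qed
    also have "\<dots> = (1 / of_nat (Suc n))\<^sup>2 * (of_nat (Suc n) * of_real (2 * pi))"
    proof -
      have "(\<Sum>k<Suc n. \<integral>z. z powi (2 * int j - 2 * int k) \<partial>circle) = of_real (2 * pi)" if "j < Suc n" for j
      proof -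
        have "(\<Sum>k<Suc n. \<integral>z. z powi (2 * int j - 2 * int k) \<partial>circle) = (\<Sum>k<Suc n. if k = j then of_real (2 * pi) else 0)"
          unfolding integral_circle_powi by (intro sum.cong) auto
        then show ?thesis using that by (simp del: sum.lessThan_Suc)
      qed
      then have "(\<Sum>j<Suc n. \<Sum>k<Suc n. \<integral>z. z powi (2 * int j - 2 * int k) \<partial>circle) = (\<Sum>j<Suc n. of_real (2 * pi))"
        by (intro sum.cong refl) simp
      then show ?thesis by (simp del: sum.lessThan_Suc of_nat_Suc)
    qed
    also have "\<dots> = complex_of_real (2 * pi / real (Suc n))"
      by (simp add: power2_eq_square field_simps del: of_nat_Suc)
    finally show ?thesis by (simp only: of_real_eq_iff)
  qed
  show ?thesis
    unfolding approx_def mem_Collect_eq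
  proof (rule R.cl_limit_seq[where f = "\<lambda>n (z, \<omega>). (1 - M n z) * indicator (cyl v) \<omega>"])
    have "bounded_measurable (\<lambda>(z, \<omega>). indicator (cyl v) \<omega>)" by (rule bounded_measurable_cyl)
    then show "(\<lambda>(z, \<omega>). 1 * indicator (cyl v) \<omega>) \<in> L2_space circle_bdry"
      by (simp add: bounded_measurable_L2)
    show "(\<lambda>(z, \<omega>). (1 - M n z) * indicator (cyl v) \<omega>) \<in> R.cl" for n
    proof -
      have "(\<lambda>z. (1 / of_nat (Suc n)) * (\<Sum>k<Suc n. 1 - z ^ (2 * Suc k))) \<in> approx v"
        by (intro approx_scale approx_sum A)
      moreover have "(\<lambda>z. (1 / of_nat (Suc n)) * (\<Sum>k<Suc n. 1 - z ^ (2 * Suc k))) = (\<lambda>z. 1 - M n z)"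
      proof
        fix z :: complex
        have "(\<Sum>k<Suc n. 1 - z ^ (2 * Suc k)) = of_nat (Suc n) - (\<Sum>k<Suc n. z ^ (2 * Suc k))"
          unfolding sum_subtractf by simp
        then show "(1 / of_nat (Suc n)) * (\<Sum>k<Suc n. 1 - z ^ (2 * Suc k)) = 1 - M n z" unfolding M_def
          by (simp add: right_diff_distrib del: sum.lessThan_Suc of_nat_Suc)
      qed
      ultimately show ?thesis by (simp only: approx_def mem_Collect_eq)
    qed
    have le: "L2_norm circle_bdry (\<lambda>x. (\<lambda>(z, \<omega>). (1 - M n z) * indicator (cyl v) \<omega>) x - (\<lambda>(z, \<omega>). 1 * indicator (cyl v) \<omega>) x)
        \<le> sqrt (2 * pi / real (Suc n))" for n
    proof -
      have "L2_norm circle_bdry (\<lambda>x. (\<lambda>(z, \<omega>). (1 - M n z) * indicator (cyl v) \<omega>) x - (\<lambda>(z, \<omega>). 1 * indicator (cyl v) \<omega>) x)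
        = L2_norm circle_bdry (\<lambda>(z, \<omega>). M n z * indicator (cyl v) \<omega>)"
        by (rule L2_norm_cong) (auto simp: indicator_def)
      moreover have "(L2_norm circle_bdry (\<lambda>(z, \<omega>). M n z * indicator (cyl v) \<omega>))\<^sup>2 \<le> 2 * pi / real (Suc n)"
        using L2_norm_tensor_le[OF Mc[of n], of v] unfolding Mi .
      ultimately show ?thesis by (simp only: real_le_rsqrt)
    qed
    have "(\<lambda>n. 2 * pi / real (Suc n)) \<longlonglongrightarrow> 0"
      using tendsto_mult_right_zero[OF LIMSEQ_inverse_real_of_nat, of "2 * pi"] by (simp add: divide_inverse)
    then have "(\<lambda>n. sqrt (2 * pi / real (Suc n))) \<longlonglongrightarrow> sqrt 0" by (rule tendsto_real_sqrt)
    then have "(\<lambda>n. sqrt (2 * pi / real (Suc n))) \<longlonglongrightarrow> 0" by simp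
    then show "(\<lambda>n. L2_norm circle_bdry (\<lambda>x. (\<lambda>(z, \<omega>). (1 - M n z) * indicator (cyl v) \<omega>) x - (\<lambda>(z, \<omega>). 1 * indicator (cyl v) \<omega>) x)) \<longlonglongrightarrow> 0"
      by (rule Lim_null_comparison[rotated]) (use le in \<open>auto intro!: always_eventually\<close>)
  qed
qed

text \<open>On the circle a real linear function is a combination of \<open>z\<close> and \<open>inverse z = cnj z\<close>.\<close>
lemma polynomial_approx:
  assumes "real_polynomial_function p" "F \<in> approx v"
  shows "(\<lambda>z. of_real (p z) * F z) \<in> approx v"
  using assms
proof (induction arbitrary: F rule: real_polynomial_function.induct)
  case (linear f)
  \<comment> \<open>\<open>x * f 1 + y * f \<i>\<close> written in terms of \<open>z = x + \<i> * y\<close> and its conjugate.\<close>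
  define c where "c = (of_real (f 1) - \<i> * of_real (f \<i>)) / 2"
  define d where "d = (of_real (f 1) + \<i> * of_real (f \<i>)) / 2"
  have "(\<lambda>z. c * (z * F z) + d * (inverse z * F z)) \<in> approx v"
    by (intro approx_add approx_scale approx_mult linear)
  then show ?case
  proof (rule approx_cong)
    fix z :: complex assume z: "cmod z = 1"
    have "f z = Re z * f 1 + Im z * f \<i>"
    proof -
      have "z = Re z *\<^sub>R 1 + Im z *\<^sub>R \<i>" by (simp add: complex_eq_iff)
      then have "f z = f (Re z *\<^sub>R 1 + Im z *\<^sub>R \<i>)" by simp
      also have "\<dots> = Re z * f 1 + Im z * f \<i>"
        using linear(1) by (simp add: linear_add linear_scale bounded_linear.linear)
      finally show ?thesis .
    qed
    then have "complex_of_real (f z) = c * z + d * inverse z"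
      unfolding circle_nonsingular(3)[OF z] c_def d_def by (simp add: complex_eq_iff field_simps)
    then show "complex_of_real (f z) * F z = c * (z * F z) + d * (inverse z * F z)"
      by (simp add: algebra_simps)
  qed
next
  case (const c)
  then show ?case by (rule approx_scale)
next
  case (add f g)
  have "(\<lambda>z. of_real (f z) * F z + of_real (g z) * F z) \<in> approx v"
    by (intro approx_add add)
  then show ?case by (simp add: distrib_right)
next
  case (mult f g)
  have "(\<lambda>z. of_real (f z) * (of_real (g z) * F z)) \<in> approx v" by (intro mult)
  then show ?case by (simp add: mult.assoc)
qed

lemma continuous_approx:
  assumes "continuous_on UNIV (f :: complex \<Rightarrow> real)"
  shows "(\<lambda>z. of_real (f z)) \<in> approx v"
proof -
  have c: "continuous_on (sphere 0 1) f" using assms continuous_on_subset by blast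
  have "\<exists>p. real_polynomial_function p \<and> (\<forall>z. cmod z = 1 \<longrightarrow> \<bar>f z - p z\<bar> < 1 / real (Suc n))" for n
  proof -
    have "0 < 1 / real (Suc n)" by simp
    from Stone_Weierstrass_real_polynomial_function[OF compact_sphere c this]
    obtain p where "real_polynomial_function p" "\<And>z. z \<in> sphere 0 1 \<Longrightarrow> \<bar>f z - p z\<bar> < 1 / real (Suc n)" by blast
    then show ?thesis by (intro exI[of _ p]) simp
  qed
  then obtain p where p: "\<And>n. real_polynomial_function (p n)"
    "\<And>n z. cmod z = 1 \<Longrightarrow> \<bar>f z - p n z\<bar> < 1 / real (Suc n)" by metis
  have "compact (f ` sphere 0 1)" using c by (intro compact_continuous_image) auto
  then have "bounded (f ` sphere 0 1)" by (rule compact_imp_bounded)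
  then obtain B where "\<And>y. y \<in> f ` sphere 0 1 \<Longrightarrow> norm y \<le> B" unfolding bounded_iff by blast
  then have B: "\<bar>f z\<bar> \<le> B" if "cmod z = 1" for z using that by simp
  show ?thesis
    unfolding approx_def mem_Collect_eq
  proof (rule R.cl_dominated[where f = "\<lambda>n (z, \<omega>). of_real (p n z) * indicator (cyl v) \<omega>" and w = "\<lambda>_. B + 1"])
    show "(\<lambda>(z, \<omega>). complex_of_real (p n z) * indicator (cyl v) \<omega>) \<in> R.cl" for n
      using polynomial_approx[OF p(1)[of n] one_approx] by (simp add: approx_def)
    have "bounded_measurable (\<lambda>x. (\<lambda>(z, \<omega>). complex_of_real (f z)) x * (\<lambda>(z, \<omega>). indicator (cyl v) \<omega>) x)"
      by (intro bounded_measurable_mult bounded_measurable_cyl bounded_measurable_circle continuous_intros c)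
    then show "(\<lambda>(z, \<omega>). complex_of_real (f z) * indicator (cyl v) \<omega>) \<in> borel_measurable circle_bdry"
      by (simp add: bounded_measurable_def case_prod_beta')
    show "integrable circle_bdry (\<lambda>_. (B + 1)\<^sup>2)" by simp
    fix x assume "x \<in> space circle_bdry"
    then obtain z \<omega> where x: "x = (z, \<omega>)" "cmod z = 1" by (auto simp: space_pair_measure)
    show "cmod (case x of (z, \<omega>) \<Rightarrow> complex_of_real (p n z) * indicator (cyl v) \<omega>) \<le> B + 1" for n
    proof -
      have "1 / real (Suc n) \<le> 1" by simp
      then have "\<bar>p n z\<bar> \<le> B + 1" using p(2)[OF x(2), of n] B[OF x(2)] by linarith
      then show ?thesis using x by (auto simp: norm_mult indicator_def)
    qed
    have "(\<lambda>n. p n z) \<longlonglongrightarrow> f z"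
    proof (rule LIM_zero_cancel, rule Lim_null_comparison)
      show "\<forall>\<^sub>F n in sequentially. norm (p n z - f z) \<le> 1 / real (Suc n)"
        using p(2)[OF x(2)] by (intro always_eventually allI) (simp add: abs_minus_commute less_imp_le)
      show "(\<lambda>n. 1 / real (Suc n)) \<longlonglongrightarrow> 0"
        using LIMSEQ_inverse_real_of_nat by (simp add: divide_inverse)
    qed
    then show "(\<lambda>n. case x of (z, \<omega>) \<Rightarrow> complex_of_real (p n z) * indicator (cyl v) \<omega>) \<longlonglongrightarrow>
       (case x of (z, \<omega>) \<Rightarrow> complex_of_real (f z) * indicator (cyl v) \<omega>)"
      unfolding x prod.case by (intro tendsto_intros)
  qed
qed

text \<open>The functions \<open>min 1 (n * infdist z (- U))\<close> increase to the indicator of \<open>U\<close>. The complement must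
  not be empty, as \<open>infdist\<close> to the empty set is 0.\<close>
lemma open_approx:
  assumes "open U"
  shows "indicator U \<in> approx v"
proof (cases "U = UNIV")
  case True
  then show ?thesis using one_approx by (simp add: indicator_def[abs_def])
next
  case False
  define f where "f n z = min 1 (real n * infdist z (- U))" for n z
  have fc: "continuous_on UNIV (f n)" for n
    unfolding f_def[abs_def] by (intro continuous_intros continuous_on_infdist)
  show ?thesis
    unfolding approx_def mem_Collect_eq
  proof (rule R.cl_dominated[where f = "\<lambda>n (z, \<omega>). of_real (f n z) * indicator (cyl v) \<omega>" and w = "\<lambda>_. 1"])
    show "(\<lambda>(z, \<omega>). complex_of_real (f n z) * indicator (cyl v) \<omega>) \<in> R.cl" for n
      using continuous_approx[OF fc[of n]] by (simp add: approx_def)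
    have iU: "(indicator U :: complex \<Rightarrow> complex) \<in> borel_measurable circle"
      by (rule circle_measurable_borel) (intro borel_measurable_indicator borel_open assms)
    have iv: "(indicator (cyl v) :: 'v bdry \<Rightarrow> complex) \<in> borel_measurable \<nu>" by measurable
    have "(\<lambda>x. indicator U (fst x) * indicator (cyl v) (snd x) :: complex) \<in> borel_measurable circle_bdry"
      by (intro borel_measurable_times measurable_compose[OF measurable_fst iU] measurable_compose[OF measurable_snd iv])
    then show "(\<lambda>(z, \<omega>). indicator U z * indicator (cyl v) \<omega> :: complex) \<in> borel_measurable circle_bdry"
      by (simp only: case_prod_beta')
    show "integrable circle_bdry (\<lambda>_. 1\<^sup>2)" by simp
    fix x :: "complex \<times> 'v bdry"
    obtain z \<omega> where x: "x = (z, \<omega>)" by (cases x)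
    show "cmod (case x of (z, \<omega>) \<Rightarrow> complex_of_real (f n z) * indicator (cyl v) \<omega>) \<le> 1" for n
    proof -
      have "0 \<le> f n z" "f n z \<le> 1" by (simp_all add: f_def infdist_nonneg)
      then show ?thesis unfolding x by (auto simp: norm_mult indicator_def)
    qed
    have "(\<lambda>n. f n z) \<longlonglongrightarrow> indicator U z"
    proof (cases "z \<in> U")
      case True
      have pos: "infdist z (- U) > 0"
      proof -
        have "- U \<noteq> {}" "z \<notin> - U" using False True by auto
        then have "infdist z (- U) \<noteq> 0" using in_closed_iff_infdist_zero[OF closed_Compl[OF assms]] by blast
        then show ?thesis using infdist_nonneg[of z "- U"] by linarith
      qed
      then obtain N where N: "1 < real N * infdist z (- U)" using spec[OF reals_Archimedean3[OF pos], of 1] by blast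
      have "f n z = 1" if "n \<ge> N" for n
      proof -
        have "real N * infdist z (- U) \<le> real n * infdist z (- U)"
          using that infdist_nonneg by (intro mult_right_mono) auto
        then show ?thesis using N by (simp add: f_def)
      qed
      then have "(\<lambda>n. f n z) \<longlonglongrightarrow> 1"
        by (intro tendsto_eventually) (auto simp: eventually_at_top_linorder)
      then show ?thesis using True by simp
    next
      case z: False
      then have "f n z = 0" for n by (simp add: f_def)
      then show ?thesis using z by simp
    qed
    then have "(\<lambda>n. complex_of_real (f n z)) \<longlonglongrightarrow> of_real (indicator U z)" by (rule tendsto_of_real)
    then have "(\<lambda>n. complex_of_real (f n z)) \<longlonglongrightarrow> indicator U z" by (cases "z \<in> U") simp_all
    then show "(\<lambda>n. case x of (z, \<omega>) \<Rightarrow> complex_of_real (f n z) * indicator (cyl v) \<omega>) \<longlonglongrightarrow>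
       (case x of (z, \<omega>) \<Rightarrow> indicator U z * indicator (cyl v) \<omega>)"
      unfolding x prod.case by (rule tendsto_mult[OF _ tendsto_const])
  qed
qed

text \<open>There are countably many cylinders, so open sets are countable unions of them.\<close>
lemma sets_nu_cyl: "sets \<nu> = sigma_sets \<Omega> (range cyl)"
proof
  have op: "U \<in> sigma_sets \<Omega> (range cyl)" if U: "openin bdry_top U" for U
  proof -
    have "U = \<Union> (cyl ` {v. cyl v \<subseteq> U})"
    proof
      show "U \<subseteq> \<Union> (cyl ` {v. cyl v \<subseteq> U})"
      proof
        fix \<omega> assume w: "\<omega> \<in> U"
        obtain n where "cyl (ray \<omega> n) \<subseteq> U" using openin_bdry_cyl[OF U w] by blast
        moreover have "\<omega> \<in> \<Omega>" using openin_subset[OF U] w by auto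
        ultimately show "\<omega> \<in> \<Union> (cyl ` {v. cyl v \<subseteq> U})" using cyl_ray by blast
      qed
    qed auto
    moreover have "\<Union> (cyl ` {v. cyl v \<subseteq> U}) \<in> sigma_sets \<Omega> (range cyl)"
    proof -
      interpret s: sigma_algebra \<Omega> "sigma_sets \<Omega> (range cyl)"
        by (rule sigma_algebra_sigma_sets) (use cyl_subset in auto)
      have "countable {v. cyl v \<subseteq> U}" by (rule countable_subset[OF subset_UNIV countable_vertices])
      then show ?thesis by (intro s.countable_UN'') auto
    qed
    ultimately show ?thesis by simp
  qed
  have P: "{U. openin bdry_top U} \<subseteq> Pow \<Omega>" using openin_subset[of bdry_top] by auto
  then have "sets \<nu> = sigma_sets \<Omega> {U. openin bdry_top U}" unfolding sets_nu by (simp add: sets_measure_of)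
  moreover have "sigma_sets \<Omega> {U. openin bdry_top U} \<subseteq> sigma_sets \<Omega> (range cyl)"
    by (rule sigma_sets_mono) (use op in auto)
  ultimately show "sets \<nu> \<subseteq> sigma_sets \<Omega> (range cyl)" by simp
  show "sigma_sets \<Omega> (range cyl) \<subseteq> sets \<nu>"
  proof -
    have "range cyl \<subseteq> sets \<nu>" using cyl_sets by blast
    from sets.sigma_sets_subset[OF this] show ?thesis by simp
  qed
qed

lemma sets_circle_open: "sets circle = sigma_sets (sphere 0 1) ((\<lambda>U. sphere 0 1 \<inter> U) ` {U. open U})"
proof -
  have "sets (borel :: complex measure) = sigma_sets UNIV {U. open U}"
    by (simp add: borel_def sets_measure_of)
  then have "sets circle = (\<inter>) (sphere 0 1) ` sigma_sets UNIV {U. open U}"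
    unfolding sets_circle sets_restrict_space by simp
  also have "\<dots> = sigma_sets (sphere 0 1) ((\<inter>) (sphere 0 1) ` {U. open U})"
    by (rule sigma_sets_Int) (use sphere_sets in \<open>auto simp: borel_def sets_measure_of\<close>)
  finally show ?thesis .
qed

text \<open>Products of relatively open sets with cylinders generate the \<open>\<sigma>\<close>-algebra and are closed under
  intersection, since two cylinders are nested or disjoint.\<close>
theorem T_range_dense: "L2_space circle_bdry \<subseteq> L2_closure circle_bdry T_range"
proof (rule R.cl_eq_L2)
  define Ea where "Ea = (\<lambda>U. sphere 0 1 \<inter> U) ` {U :: complex set. open U}"
  define G where "G = {a \<times> b | a b. a \<in> Ea \<and> b \<in> range cyl}"
  show "finite_measure circle_bdry" by (rule prod.finite_measure_axioms)
  have Ei: "a \<inter> a' \<in> Ea" if ab: "a \<in> Ea" "a' \<in> Ea" for a a'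
  proof -
    obtain U U' where U: "a = sphere 0 1 \<inter> U" "a' = sphere 0 1 \<inter> U'" "open U" "open U'"
      using ab unfolding Ea_def by auto
    have "a \<inter> a' = sphere 0 1 \<inter> (U \<inter> U')" using U by blast
    then show ?thesis using U(3,4) unfolding Ea_def by blast
  qed
  have Ee: "{} \<in> Ea" unfolding Ea_def by (rule image_eqI[of _ _ "{}"]) auto
  show "Int_stable G"
  proof (rule Int_stableI)
    fix A B assume "A \<in> G" "B \<in> G"
    then obtain a v b w where A: "A = a \<times> cyl v" "a \<in> Ea" and B: "B = b \<times> cyl w" "b \<in> Ea"
      unfolding G_def by auto
    have AB: "A \<inter> B = (a \<inter> b) \<times> (cyl v \<inter> cyl w)" using A B by blast
    consider "below w v" | "below v w" | "\<not> below w v" "\<not> below v w" by blast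
    then show "A \<inter> B \<in> G"
    proof cases
      case 1
      then have "cyl v \<inter> cyl w = cyl v" using cyl_mono by blast
      then show ?thesis unfolding AB G_def using Ei[OF A(2) B(2)] by blast
    next
      case 2
      then have "cyl v \<inter> cyl w = cyl w" using cyl_mono by blast
      then show ?thesis unfolding AB G_def using Ei[OF A(2) B(2)] by blast
    next
      case 3
      then have "A \<inter> B = {} \<times> cyl v" unfolding AB using cyl_disjoint[of w v] by auto
      then show ?thesis unfolding G_def using Ee by blast
    qed
  qed
  show GP: "G \<subseteq> Pow (space circle_bdry)"
    unfolding G_def Ea_def space_pair_measure using cyl_subset by auto
  have S: "sphere 0 1 \<in> Ea" unfolding Ea_def by (rule image_eqI[of _ _ UNIV]) auto
  have "sets circle_bdry = sets (sigma (space circle \<times> space \<nu>) G)"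
    unfolding G_def
  proof (rule sets_pair_eq[where Ca = "{sphere 0 1}" and Cb = "{\<Omega>}"])
    show "Ea \<subseteq> Pow (space circle)" by (auto simp: Ea_def)
    show "sets circle = sigma_sets (space circle) Ea" unfolding Ea_def using sets_circle_open by simp
    show "range cyl \<subseteq> Pow (space \<nu>)" using cyl_subset by auto
    show "sets \<nu> = sigma_sets (space \<nu>) (range cyl)" using sets_nu_cyl by simp
    show "{\<Omega>} \<subseteq> range cyl" by (metis cyl_org empty_subsetI insert_subset rangeI)
  qed (use S in auto)
  then show "sets circle_bdry = sigma_sets (space circle_bdry) G"
    using GP by (simp add: space_pair_measure sets_measure_of)
  have ind: "indicator ((sphere 0 1 \<inter> U) \<times> cyl v) \<in> R.cl" if "open U" for U v
  proof -
    have "(\<lambda>(z, \<omega>). indicator U z * indicator (cyl v) \<omega>) \<in> R.cl"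
      using open_approx[OF that, of v] by (simp add: approx_def)
    then show ?thesis
      by (rule R.cl_cong) (auto simp: space_pair_measure indicator_def)
  qed
  show "indicator A \<in> R.cl" if A: "A \<in> G" for A
  proof -
    obtain a v where a: "A = a \<times> cyl v" "a \<in> Ea" using A unfolding G_def by auto
    obtain U where "a = sphere 0 1 \<inter> U" "open U" using a(2) unfolding Ea_def by auto
    then show ?thesis unfolding a(1) using ind by simp
  qed
  show "indicator (space circle_bdry) \<in> R.cl"
    using ind[of UNIV org] by (simp add: space_pair_measure)
qed

end


section \<open>The completion of the data\<close>

context tree_boundary
begin

lemma energy_norm_T_minus:
  assumes "f \<in> data"
  shows "energy_norm f = L2_norm circle_bdry (T_minus_data f) / sqrt energy_const"
proof -
  have "(L2_norm circle_bdry (T_minus_data f))\<^sup>2 = Re (of_real energy_const * energy f f)"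
    using arg_cong[OF T_minus_isometry[OF assms], of Re] by (simp only: Re_complex_of_real)
  then have "Re (energy f f) = (L2_norm circle_bdry (T_minus_data f))\<^sup>2 / energy_const"
    using energy_const_pos by simp
  then show ?thesis by (simp add: energy_norm_def real_sqrt_divide)
qed

lemma data_diff_comb: "data_diff f g = data_comb (-1) g f"
  by (simp add: data_diff_def data_comb_def)

lemma energy_norm_diff:
  assumes "f \<in> data" "g \<in> data"
  shows "energy_norm (data_diff f g) = L2_norm circle_bdry (\<lambda>x. T_minus_data f x - T_minus_data g x) / sqrt energy_const"
proof -
  have "L2_norm circle_bdry (T_minus_data (data_diff f g)) = L2_norm circle_bdry (\<lambda>x. T_minus_data f x - T_minus_data g x)"
  proof (rule L2_norm_cong)
    fix x assume "x \<in> space circle_bdry"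
    then obtain z \<omega> where "x = (z, \<omega>)" "cmod z = 1" by (auto simp: space_pair_measure)
    then show "cmod (T_minus_data (data_diff f g) x) = cmod (T_minus_data f x - T_minus_data g x)"
      unfolding data_diff_comb using T_minus_data_comb(2)[OF assms(2,1), of z "-1" \<omega>] by simp
  qed
  then show ?thesis
    using energy_norm_T_minus[of "data_diff f g"] T_minus_data_comb(1)[OF assms(2,1)]
    by (simp add: data_diff_comb)
qed

text \<open>By density and the isometry, the elements of \<open>\<H>\<close> are exactly the following sets, one for each
  element of the target of \<open>T_minus\<close>.\<close>
definition data_class :: "(complex \<times> 'v bdry \<Rightarrow> complex) \<Rightarrow> (nat \<Rightarrow> 'v data) set" where
  "data_class g = {Y. (\<forall>n. Y n \<in> data) \<and> L2_tendsto circle_bdry (\<lambda>n. T_minus_data (Y n)) g}"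

lemma data_classD:
  assumes "Y \<in> data_class g"
  shows "Y n \<in> data" "L2_tendsto circle_bdry (\<lambda>n. T_minus_data (Y n)) g"
  using assms by (auto simp: data_class_def)

lemma cauchy_data_iff: "X \<in> cauchy_data \<longleftrightarrow> (\<exists>g. X \<in> data_class g)"
proof
  assume X: "X \<in> cauchy_data"
  then have d: "X n \<in> data" for n by (simp add: cauchy_data_def)
  obtain g where "L2_tendsto circle_bdry (\<lambda>n. T_minus_data (X n)) g"
  proof (rule L2_complete[of "\<lambda>n. T_minus_data (X n)" circle_bdry])
    show "T_minus_data (X n) \<in> L2_space circle_bdry" for n by (rule T_minus_L2[OF d])
    fix e :: real assume "e > 0"
    then have "e / sqrt energy_const > 0" using energy_const_pos by simp
    then obtain N where "\<forall>m\<ge>N. \<forall>n\<ge>N. energy_norm (data_diff (X m) (X n)) < e / sqrt energy_const"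
      using X unfolding cauchy_data_def by blast
    then show "\<exists>N. \<forall>m\<ge>N. \<forall>n\<ge>N. L2_norm circle_bdry (\<lambda>x. T_minus_data (X m) x - T_minus_data (X n) x) < e"
      using energy_const_pos by (intro exI[of _ N]) (simp add: energy_norm_diff[OF d d] divide_less_cancel)
  qed blast
  then show "\<exists>g. X \<in> data_class g" using d by (auto simp: data_class_def)
next
  assume "\<exists>g. X \<in> data_class g"
  then obtain g where X: "X \<in> data_class g" by blast
  note d = data_classD(1)[OF X]
  show "X \<in> cauchy_data"
    unfolding cauchy_data_def
  proof (intro CollectI conjI allI impI d)
    fix e :: real assume e: "e > 0"
    define c where "c = sqrt energy_const"
    have c: "c > 0" using energy_const_pos by (simp add: c_def)
    obtain N where "\<forall>m\<ge>N. \<forall>n\<ge>N. L2_norm circle_bdry (\<lambda>x. T_minus_data (X m) x - T_minus_data (X n) x) < e * c"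
      using L2_tendsto_Cauchy[OF data_classD(2)[OF X], of "e * c"] e c by auto
    then show "\<exists>N. \<forall>m\<ge>N. \<forall>n\<ge>N. energy_norm (data_diff (X m) (X n)) < e"
      using c unfolding energy_norm_diff[OF d d] c_def[symmetric]
      by (intro exI[of _ N]) (simp add: pos_divide_less_eq)
  qed
qed

lemma null_rel_class:
  assumes "X \<in> data_class g"
  shows "null_rel `` {X} = data_class g"
proof -
  note d = data_classD(1)[OF assms]
  have c: "sqrt energy_const \<noteq> 0" using energy_const_pos by simp
  have lim: "(\<lambda>n. energy_norm (data_diff (X n) (Y n))) \<longlonglongrightarrow> 0 \<longleftrightarrow>
      (\<lambda>n. L2_norm circle_bdry (\<lambda>x. T_minus_data (X n) x - T_minus_data (Y n) x)) \<longlonglongrightarrow> 0"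
    if Y: "\<And>n. Y n \<in> data" for Y
  proof -
    define N where "N n = L2_norm circle_bdry (\<lambda>x. T_minus_data (X n) x - T_minus_data (Y n) x)" for n
    have e: "energy_norm (data_diff (X n) (Y n)) = N n / sqrt energy_const" for n
      unfolding N_def by (rule energy_norm_diff[OF d Y])
    have "N \<longlonglongrightarrow> 0" if "(\<lambda>n. N n / sqrt energy_const) \<longlonglongrightarrow> 0"
      using tendsto_mult_left_zero[OF that, of "sqrt energy_const"] c by simp
    moreover have "(\<lambda>n. N n / sqrt energy_const) \<longlonglongrightarrow> 0" if "N \<longlonglongrightarrow> 0"
      using tendsto_divide_zero[OF that] .
    ultimately show ?thesis unfolding e N_def[symmetric] by blast
  qed
  have "Y \<in> null_rel `` {X} \<longleftrightarrow> Y \<in> data_class g" for Y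
  proof
    assume "Y \<in> null_rel `` {X}"
    then have Y: "Y \<in> cauchy_data" "(\<lambda>n. energy_norm (data_diff (X n) (Y n))) \<longlonglongrightarrow> 0"
      by (auto simp: null_rel_def)
    then have dY: "Y n \<in> data" for n by (simp add: cauchy_data_def)
    have "L2_tendsto circle_bdry (\<lambda>n. T_minus_data (Y n)) g"
      by (rule L2_tendsto_shadow[OF data_classD(2)[OF assms] T_minus_L2[OF dY]])
        (rule iffD1[OF lim[OF dY] Y(2)])
    then show "Y \<in> data_class g" using dY by (simp add: data_class_def)
  next
    assume Y: "Y \<in> data_class g"
    have "X \<in> cauchy_data" "Y \<in> cauchy_data" unfolding cauchy_data_iff using assms Y by blast+
    moreover have "(\<lambda>n. energy_norm (data_diff (X n) (Y n))) \<longlonglongrightarrow> 0"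
      unfolding lim[OF data_classD(1)[OF Y]]
      by (rule L2_tendsto_diff[OF data_classD(2)[OF assms] data_classD(2)[OF Y]])
    ultimately show "Y \<in> null_rel `` {X}" by (simp add: null_rel_def)
  qed
  then show ?thesis by blast
qed

lemma data_class_nonempty:
  assumes "g \<in> L2_space circle_bdry"
  obtains Y where "Y \<in> data_class g"
proof -
  have "\<exists>f\<in>data. L2_norm circle_bdry (\<lambda>x. T_minus_data f x - g x) < 1 / real (Suc n)" for n
  proof -
    have "g \<in> L2_closure circle_bdry T_range" using T_range_dense assms by blast
    moreover have "1 / real (Suc n) > 0" by simp
    ultimately obtain F where F: "F \<in> T_range" "L2_norm circle_bdry (\<lambda>x. F x - g x) < 1 / real (Suc n)"
      unfolding L2_closure_def by blast
    then obtain f where f: "f \<in> data" "\<And>z \<omega>. cmod z = 1 \<Longrightarrow> \<omega> \<in> \<Omega> \<Longrightarrow> F (z, \<omega>) = T_minus_data f (z, \<omega>)"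
      unfolding T_range_def by blast
    have "L2_norm circle_bdry (\<lambda>x. T_minus_data f x - g x) = L2_norm circle_bdry (\<lambda>x. F x - g x)"
      by (rule L2_norm_cong) (auto simp: space_pair_measure f(2))
    then show ?thesis using F(2) f(1) by (intro bexI[of _ f]) auto
  qed
  then obtain Y where Y: "\<And>n. Y n \<in> data" "\<And>n. L2_norm circle_bdry (\<lambda>x. T_minus_data (Y n) x - g x) < 1 / real (Suc n)"
    by metis
  have "(\<lambda>n. L2_norm circle_bdry (\<lambda>x. T_minus_data (Y n) x - g x)) \<longlonglongrightarrow> 0"
  proof (rule Lim_null_comparison)
    show "\<forall>\<^sub>F n in sequentially. norm (L2_norm circle_bdry (\<lambda>x. T_minus_data (Y n) x - g x)) \<le> 1 / real (Suc n)"
      using Y(2) by (intro always_eventually allI) (simp add: less_imp_le)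
    show "(\<lambda>n. 1 / real (Suc n)) \<longlonglongrightarrow> 0"
      using LIMSEQ_inverse_real_of_nat by (simp add: divide_inverse)
  qed
  then have "Y \<in> data_class g"
    using Y(1) T_minus_L2 assms by (simp add: data_class_def L2_tendsto_def)
  then show thesis using that by blast
qed

lemma H_eq: "\<H> = data_class ` L2_space circle_bdry"
proof
  show "\<H> \<subseteq> data_class ` L2_space circle_bdry"
  proof
    fix x assume "x \<in> \<H>"
    then obtain X where X: "X \<in> cauchy_data" "x = null_rel `` {X}"
      unfolding \<H>_def by (rule quotientE)
    then obtain g where g: "X \<in> data_class g" unfolding cauchy_data_iff by blast
    then have "x = data_class g" "g \<in> L2_space circle_bdry"
      using null_rel_class[OF g] X(2) data_classD(2)[OF g] by (auto simp: L2_tendsto_def)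
    then show "x \<in> data_class ` L2_space circle_bdry" by blast
  qed
  show "data_class ` L2_space circle_bdry \<subseteq> \<H>"
  proof
    fix x assume "x \<in> data_class ` L2_space circle_bdry"
    then obtain g where g: "g \<in> L2_space circle_bdry" "x = data_class g" by blast
    obtain Y where Y: "Y \<in> data_class g" using data_class_nonempty[OF g(1)] .
    then have "Y \<in> cauchy_data" unfolding cauchy_data_iff by blast
    then show "x \<in> \<H>" using quotientI[of Y cauchy_data null_rel] null_rel_class[OF Y]
      unfolding \<H>_def g(2) by simp
  qed
qed

lemma data_class_cong:
  assumes "g \<in> L2_space circle_bdry" "h \<in> L2_space circle_bdry" "AE x in circle_bdry. g x = h x"
  shows "data_class g = data_class h"
proof -
  have s: "AE x in circle_bdry. h x = g x" using assms(3) by eventually_elim simp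
  show ?thesis unfolding data_class_def
    using L2_tendsto_limit_cong[OF _ assms(2) s] L2_tendsto_limit_cong[OF _ assms(1,3)] by blast
qed

text \<open>A continuous extension is a single class as soon as the images of all sequences representing \<open>y\<close>
  have a common limit. Were \<open>y\<close> empty, every function would be such a limit.\<close>
lemma extend_class:
  assumes "y \<noteq> {}" "\<And>Y. Y \<in> y \<Longrightarrow> L2_tendsto circle_bdry (\<lambda>n. T (Y n)) k"
  shows "extend T y = L2_class circle_bdry k"
proof -
  obtain Y where Y: "Y \<in> y" using assms(1) by blast
  show ?thesis
  proof
    show "extend T y \<subseteq> L2_class circle_bdry k"
    proof
      fix g assume "g \<in> extend T y"
      then have g: "g \<in> L2_space circle_bdry" "L2_tendsto circle_bdry (\<lambda>n. T (Y n)) g" using Y by (auto simp: extend_def)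
      then show "g \<in> L2_class circle_bdry k" using L2_tendsto_unique[OF g(2) assms(2)[OF Y]] by (simp add: L2_class_def)
    qed
    show "L2_class circle_bdry k \<subseteq> extend T y"
    proof
      fix g assume "g \<in> L2_class circle_bdry k"
      then have g: "g \<in> L2_space circle_bdry" "AE x in circle_bdry. g x = k x" by (auto simp: L2_class_def)
      show "g \<in> extend T y" unfolding extend_def
        using g(1) L2_tendsto_limit_cong[OF assms(2) g] by blast
    qed
  qed
qed

lemma T_minus_class:
  assumes "g \<in> L2_space circle_bdry"
  shows "T_minus (data_class g) = L2_class circle_bdry g"
  unfolding T_minus_def
proof (rule extend_class)
  show "data_class g \<noteq> {}" using data_class_nonempty[OF assms] by blast
qed (rule data_classD)

text \<open>Since the intertwining operator is isometric and the scalar factor unimodular, \<open>T_plus\<close> inherits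
  its continuity from \<open>T_minus\<close>.\<close>
lemma T_plus_diff_norm:
  assumes "f \<in> data" "g \<in> data"
  shows "L2_norm circle_bdry (\<lambda>x. T_plus_data f x - T_plus_data g x) = L2_norm circle_bdry (\<lambda>x. T_minus_data f x - T_minus_data g x)"
proof -
  have "(L2_norm circle_bdry (\<lambda>x. T_plus_data f x - T_plus_data g x))\<^sup>2 = (L2_norm circle_bdry (\<lambda>x. T_minus_data f x - T_minus_data g x))\<^sup>2"
    unfolding L2_norm_product(1)[OF L2_diff[OF T_plus_L2[OF assms(1)] T_plus_L2[OF assms(2)]]]
      L2_norm_product(1)[OF L2_diff[OF T_minus_L2[OF assms(1)] T_minus_L2[OF assms(2)]]]
  proof (intro Bochner_Integration.integral_cong refl)
    fix z assume "z \<in> space circle"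
    then have z: "cmod z = 1" by simp
    define u where "u = (z - inverse z / of_nat q) / (inverse z - z / of_nat q)"
    have u: "cmod u = 1" using circle_factor_nz[OF z] by (simp add: u_def norm_divide)
    define F where "F = (\<lambda>\<omega>. T_minus_data f (z, \<omega>))"
    define G where "G = (\<lambda>\<omega>. T_minus_data g (z, \<omega>))"
    have FG: "F \<in> K" "G \<in> K" using T_minus_fibre_K assms z by (auto simp: F_def G_def)
    have "(\<lambda>\<omega>. T_plus_data f (z, \<omega>) - T_plus_data g (z, \<omega>)) = (\<lambda>\<omega>. u * intertwiner z (\<lambda>\<omega>. F \<omega> - G \<omega>) \<omega>)"
      unfolding intertwiner_diff[OF z FG] T_plus_T_minus_fibre[OF assms(1) z] T_plus_T_minus_fibre[OF assms(2) z]
        u_def[symmetric] F_def[symmetric] G_def[symmetric] by (simp add: right_diff_distrib)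
    then have "L2_norm \<nu> (\<lambda>\<omega>. T_plus_data f (z, \<omega>) - T_plus_data g (z, \<omega>)) = L2_norm \<nu> (\<lambda>\<omega>. F \<omega> - G \<omega>)"
      using L2_norm_intertwiner[OF z K_diff[OF FG]] by (simp add: L2_norm_cmult u)
    then show "(L2_norm \<nu> (\<lambda>\<omega>. T_plus_data f (z, \<omega>) - T_plus_data g (z, \<omega>)))\<^sup>2 =
        (L2_norm \<nu> (\<lambda>\<omega>. T_minus_data f (z, \<omega>) - T_minus_data g (z, \<omega>)))\<^sup>2"
      by (simp add: F_def G_def)
  qed
  then show ?thesis by simp
qed

lemma T_plus_limit:
  assumes "g \<in> L2_space circle_bdry"
  obtains k where "\<And>Y. Y \<in> data_class g \<Longrightarrow> L2_tendsto circle_bdry (\<lambda>n. T_plus_data (Y n)) k"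
proof -
  obtain X where X: "X \<in> data_class g" using data_class_nonempty[OF assms] .
  note dX = data_classD(1)[OF X]
  obtain k where k: "L2_tendsto circle_bdry (\<lambda>n. T_plus_data (X n)) k"
  proof (rule L2_complete[of "\<lambda>n. T_plus_data (X n)" circle_bdry])
    show "T_plus_data (X n) \<in> L2_space circle_bdry" for n by (rule T_plus_L2[OF dX])
    show "\<exists>N. \<forall>m\<ge>N. \<forall>n\<ge>N. L2_norm circle_bdry (\<lambda>x. T_plus_data (X m) x - T_plus_data (X n) x) < e"
      if "e > 0" for e
      unfolding T_plus_diff_norm[OF dX dX] by (rule L2_tendsto_Cauchy[OF data_classD(2)[OF X] that])
  qed blast
  show thesis
  proof (rule that)
    fix Y assume Y: "Y \<in> data_class g"
    note dY = data_classD(1)[OF Y]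
    show "L2_tendsto circle_bdry (\<lambda>n. T_plus_data (Y n)) k"
    proof (rule L2_tendsto_shadow[OF k T_plus_L2[OF dY]])
      show "(\<lambda>n. L2_norm circle_bdry (\<lambda>x. T_plus_data (X n) x - T_plus_data (Y n) x)) \<longlonglongrightarrow> 0"
        unfolding T_plus_diff_norm[OF dX dY]
        by (rule L2_tendsto_diff[OF data_classD(2)[OF X] data_classD(2)[OF Y]])
    qed
  qed
qed


section \<open>The fibres of the scattering operator\<close>

lemma AE_fibre_summable:
  assumes "\<And>n. F n \<in> L2_space circle_bdry" "\<And>n. (L2_norm circle_bdry (F n))\<^sup>2 \<le> (1 / 2) ^ n"
  shows "AE z in circle. summable (\<lambda>n. (L2_norm \<nu> (\<lambda>\<omega>. F n (z, \<omega>)))\<^sup>2)"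
proof (rule AE_summable)
  show "integrable circle (\<lambda>z. (L2_norm \<nu> (\<lambda>\<omega>. F n (z, \<omega>)))\<^sup>2)" for n
    by (rule L2_norm_product(2)[OF assms(1)])
  show "summable (\<lambda>n. \<integral>z. (L2_norm \<nu> (\<lambda>\<omega>. F n (z, \<omega>)))\<^sup>2 \<partial>circle)"
    unfolding L2_norm_product(1)[OF assms(1), symmetric]
  proof (rule summable_comparison_test')
    show "summable (\<lambda>n. (1 / 2 :: real) ^ n)" by (rule summable_geometric) simp
    show "norm ((L2_norm circle_bdry (F n))\<^sup>2) \<le> (1 / 2) ^ n" for n using assms(2) by simp
  qed
qed simp

text \<open>Along a fast subsequence, convergence in the product space is convergence in almost every fibre.
  There the two representations differ by the intertwining operator, so its continuity identifies
  the limits.\<close>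
lemma scattering_fibre:
  assumes "g \<in> L2_space circle_bdry" "\<And>Y. Y \<in> data_class g \<Longrightarrow> L2_tendsto circle_bdry (\<lambda>n. T_plus_data (Y n)) k"
  shows "AE z in circle. \<exists>\<psi>\<in>intertwiner_L2 z (L2_class \<nu> (\<lambda>\<omega>. g (z, \<omega>))).
    AE \<omega> in \<nu>. k (z, \<omega>) = (z - inverse z / of_nat q) / (inverse z - z / of_nat q) * \<psi> \<omega>"
proof -
  obtain Y where Y: "Y \<in> data_class g" using data_class_nonempty[OF assms(1)] .
  note dY = data_classD(1)[OF Y] and gY = data_classD(2)[OF Y]
  have kY: "L2_tendsto circle_bdry (\<lambda>n. T_plus_data (Y n)) k" by (rule assms(2)[OF Y])
  then have kL: "k \<in> L2_space circle_bdry" by (simp add: L2_tendsto_def)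
  \<comment> \<open>One sequence controlling both approximations, so that one subsequence serves both.\<close>
  define A where "A n = (L2_norm circle_bdry (\<lambda>x. T_minus_data (Y n) x - g x))\<^sup>2 + (L2_norm circle_bdry (\<lambda>x. T_plus_data (Y n) x - k x))\<^sup>2" for n
  have "A \<longlonglongrightarrow> 0\<^sup>2 + 0\<^sup>2" unfolding A_def[abs_def]
    by (intro tendsto_add tendsto_power) (use gY kY in \<open>auto simp: L2_tendsto_def\<close>)
  then have A0: "A \<longlonglongrightarrow> 0" by simp
  obtain r :: "nat \<Rightarrow> nat" where r: "\<And>n. \<bar>A (r n)\<bar> < (1 / 2) ^ n"
    using fast_subsequence[OF A0, of "\<lambda>n. (1 / 2) ^ n"] by auto
  define D where "D n = (\<lambda>x. T_minus_data (Y (r n)) x - g x)" for n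
  define D' where "D' n = (\<lambda>x. T_plus_data (Y (r n)) x - k x)" for n
  have DL: "D n \<in> L2_space circle_bdry" "D' n \<in> L2_space circle_bdry" for n
    unfolding D_def D'_def by (intro L2_diff T_minus_L2 T_plus_L2 dY assms(1) kL)+
  have small: "(L2_norm circle_bdry (D n))\<^sup>2 \<le> (1 / 2) ^ n" "(L2_norm circle_bdry (D' n))\<^sup>2 \<le> (1 / 2) ^ n" for n
  proof -
    have "A (r n) = (L2_norm circle_bdry (D n))\<^sup>2 + (L2_norm circle_bdry (D' n))\<^sup>2" by (simp add: A_def D_def D'_def)
    then have "(L2_norm circle_bdry (D n))\<^sup>2 + (L2_norm circle_bdry (D' n))\<^sup>2 < (1 / 2) ^ n" using r[of n] by linarith
    moreover have "(L2_norm circle_bdry (D n))\<^sup>2 \<ge> 0" "(L2_norm circle_bdry (D' n))\<^sup>2 \<ge> 0" by simp_all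
    ultimately show "(L2_norm circle_bdry (D n))\<^sup>2 \<le> (1 / 2) ^ n" "(L2_norm circle_bdry (D' n))\<^sup>2 \<le> (1 / 2) ^ n" by linarith+
  qed
  have sq0: "X \<longlonglongrightarrow> 0" if "summable (\<lambda>n. (X n)\<^sup>2)" for X :: "nat \<Rightarrow> real"
  proof -
    have "(\<lambda>n. (X n)\<^sup>2) \<longlonglongrightarrow> 0" using that by (rule summable_LIMSEQ_zero)
    then have "(\<lambda>n. sqrt ((X n)\<^sup>2)) \<longlonglongrightarrow> sqrt 0" by (rule tendsto_real_sqrt)
    then have "(\<lambda>n. \<bar>X n\<bar>) \<longlonglongrightarrow> 0" by simp
    then show ?thesis by (simp only: tendsto_rabs_zero_iff)
  qed
  show ?thesis
    using AE_fibre_summable[OF DL(1) small(1)] AE_fibre_summable[OF DL(2) small(2)]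
      L2_norm_product(3)[OF assms(1)] L2_norm_product(3)[OF kL] AE_space[of circle]
  proof eventually_elim
    case (elim z)
    then have z: "cmod z = 1" by simp
    define u where "u = (z - inverse z / of_nat q) / (inverse z - z / of_nat q)"
    have u: "cmod u = 1" using circle_factor_nz[OF z] by (simp add: u_def norm_divide)
    then have u0: "u \<noteq> 0" by auto
    define W where "W n = (\<lambda>\<omega>. T_minus_data (Y (r n)) (z, \<omega>))" for n
    have WK: "W n \<in> K" for n unfolding W_def by (rule T_minus_fibre_K[OF dY z])
    have W: "L2_tendsto \<nu> W (\<lambda>\<omega>. g (z, \<omega>))"
      unfolding L2_tendsto_def using sq0[OF elim(1)] elim(3) K_L2[OF WK] by (simp add: D_def W_def)
    define \<psi> where "\<psi> \<omega> = inverse u * k (z, \<omega>)" for \<omega>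
    have \<psi>L: "\<psi> \<in> L2_space \<nu>" unfolding \<psi>_def[abs_def] by (rule L2_cmult[OF elim(4)])
    have IW: "L2_tendsto \<nu> (\<lambda>n. intertwiner z (W n)) \<psi>"
    proof -
      have "intertwiner z (W n) \<omega> - \<psi> \<omega> = inverse u * D' n (z, \<omega>)" for n \<omega>
        unfolding D'_def \<psi>_def W_def T_plus_T_minus_fibre[OF dY z, of "r n"] u_def[symmetric]
        using u0 by (simp add: right_diff_distrib)
      then have "L2_norm \<nu> (\<lambda>\<omega>. intertwiner z (W n) \<omega> - \<psi> \<omega>) = L2_norm \<nu> (\<lambda>\<omega>. D' n (z, \<omega>))" for n
        by (simp add: L2_norm_cmult norm_inverse u)
      then show ?thesis
        unfolding L2_tendsto_def using sq0[OF elim(2)] \<psi>L K_L2[OF intertwiner_K[OF z WK]] by simp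
    qed
    have "\<psi> \<in> intertwiner_L2 z (L2_class \<nu> (\<lambda>\<omega>. g (z, \<omega>)))"
      unfolding intertwiner_L2_def
    proof (intro CollectI conjI allI impI \<psi>L)
      fix X assume XK: "\<forall>n. X n \<in> K" and "\<forall>\<phi>\<in>L2_class \<nu> (\<lambda>\<omega>. g (z, \<omega>)). L2_tendsto \<nu> X \<phi>"
      then have X: "L2_tendsto \<nu> X (\<lambda>\<omega>. g (z, \<omega>))" using L2_class_self[OF elim(3)] by blast
      note XK' = XK[rule_format]
      show "L2_tendsto \<nu> (\<lambda>n. intertwiner z (X n)) \<psi>"
      proof (rule L2_tendsto_shadow[OF IW K_L2[OF intertwiner_K[OF z XK']]])
        show "(\<lambda>n. L2_norm \<nu> (\<lambda>\<omega>. intertwiner z (W n) \<omega> - intertwiner z (X n) \<omega>)) \<longlonglongrightarrow> 0"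
          unfolding intertwiner_diff[OF z WK XK', symmetric] L2_norm_intertwiner[OF z K_diff[OF WK XK']]
          by (rule L2_tendsto_diff[OF W X])
      qed
    qed
    moreover have "AE \<omega> in \<nu>. k (z, \<omega>) = u * \<psi> \<omega>" using u0 by (simp add: \<psi>_def)
    ultimately show ?case unfolding u_def by blast
  qed
qed


section \<open>Inversion of the spectral parameter\<close>

text \<open>The substitution leading from \<open>T_minus\<close> to \<open>T_minus_check\<close>. It is an involution and preserves the
  product measure.\<close>
definition twist :: "(complex \<times> 'v bdry \<Rightarrow> complex) \<Rightarrow> complex \<times> 'v bdry \<Rightarrow> complex" where
  "twist g = (\<lambda>(z, \<omega>). g (inverse z, \<omega>))"

lemma twist_twist [simp]: "twist (twist g) = g"
  by (simp add: twist_def fun_eq_iff)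

lemma distr_twist: "distr circle_bdry circle_bdry (\<lambda>(z, \<omega>). (inverse z, \<omega>)) = circle_bdry"
proof -
  have "distr circle circle inverse \<Otimes>\<^sub>M distr \<nu> \<nu> (\<lambda>\<omega>. \<omega>) = distr circle_bdry circle_bdry (\<lambda>(z, \<omega>). (inverse z, \<omega>))"
    by (rule pair_measure_distr) (auto simp: distr_id2 sigma_finite_measure_axioms)
  then show ?thesis by (simp add: distr_circle_inverse distr_id2)
qed

lemma twist_measurable: "(\<lambda>(z, \<omega>). (inverse z, \<omega>)) \<in> measurable circle_bdry circle_bdry"
  by measurable

lemma twist_L2:
  assumes "g \<in> L2_space circle_bdry"
  shows "twist g \<in> L2_space circle_bdry"
proof -
  have t: "twist g = g \<circ> (\<lambda>(z, \<omega>). (inverse z, \<omega>))" by (auto simp: twist_def)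
  have "twist g \<in> borel_measurable circle_bdry"
    unfolding t by (rule measurable_comp[OF twist_measurable L2_spaceD(1)[OF assms]])
  moreover have "integrable circle_bdry (\<lambda>x. (cmod (twist g x))\<^sup>2)"
    using integrable_distr[OF twist_measurable, of "\<lambda>x. (cmod (g x))\<^sup>2"] L2_spaceD(2)[OF assms]
    unfolding distr_twist by (simp add: twist_def case_prod_beta')
  ultimately show ?thesis by (simp add: L2_space_def)
qed

lemma twist_AE:
  assumes "AE x in circle_bdry. g x = h x"
  shows "AE x in circle_bdry. twist g x = twist h x"
proof -
  have "AE x in distr circle_bdry circle_bdry (\<lambda>(z, \<omega>). (inverse z, \<omega>)). g x = h x" using assms unfolding distr_twist .
  from AE_distrD[OF twist_measurable this] show ?thesis by (simp add: twist_def case_prod_beta')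
qed

lemma twist_class: "twist ` L2_class circle_bdry g = L2_class circle_bdry (twist g)"
proof -
  have sub: "twist ` L2_class circle_bdry g \<subseteq> L2_class circle_bdry (twist g)" for g
  proof
    fix h assume "h \<in> twist ` L2_class circle_bdry g"
    then obtain k where "h = twist k" "k \<in> L2_space circle_bdry" "AE x in circle_bdry. k x = g x"
      by (auto simp: L2_class_def)
    then show "h \<in> L2_class circle_bdry (twist g)"
      using twist_L2[of k] twist_AE[of k g] by (simp add: L2_class_def)
  qed
  have "L2_class circle_bdry (twist g) \<subseteq> twist ` L2_class circle_bdry g"
  proof
    fix h assume "h \<in> L2_class circle_bdry (twist g)"
    then have "twist h \<in> L2_class circle_bdry (twist (twist g))" using sub[of "twist g"] by blast
    then have "twist h \<in> L2_class circle_bdry g" by simp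
    then show "h \<in> twist ` L2_class circle_bdry g" by (metis image_eqI twist_twist)
  qed
  then show ?thesis using sub by blast
qed

lemma T_minus_check_class: "g \<in> L2_space circle_bdry \<Longrightarrow> T_minus_check (data_class g) = L2_class circle_bdry (twist g)"
  unfolding T_minus_check_def twist_class[symmetric]
  by (simp add: T_minus_class twist_def[abs_def])

text \<open>Injectivity is the description of \<open>\<H>\<close> by classes; surjectivity is where the density enters.\<close>
theorem T_minus_check_bij: "bij_betw T_minus_check \<H> (L2 circle_bdry)"
  unfolding bij_betw_def
proof
  show "inj_on T_minus_check \<H>"
  proof (rule inj_onI)
    fix x y assume "x \<in> \<H>" "y \<in> \<H>" and e: "T_minus_check x = T_minus_check y"
    then obtain g h where g: "g \<in> L2_space circle_bdry" "x = data_class g" and h: "h \<in> L2_space circle_bdry" "y = data_class h"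
      unfolding H_eq by blast
    have "L2_class circle_bdry (twist g) = L2_class circle_bdry (twist h)"
      using e unfolding g(2) h(2) T_minus_check_class[OF g(1)] T_minus_check_class[OF h(1)] .
    then have "AE x in circle_bdry. twist g x = twist h x"
      using L2_class_eq_iff[OF twist_L2[OF g(1)] twist_L2[OF h(1)]] by blast
    from twist_AE[OF this] have "AE x in circle_bdry. g x = h x" by simp
    then show "x = y" unfolding g(2) h(2) by (rule data_class_cong[OF g(1) h(1)])
  qed
  show "T_minus_check ` \<H> = L2 circle_bdry"
  proof
    show "T_minus_check ` \<H> \<subseteq> L2 circle_bdry"
      unfolding H_eq L2_def using T_minus_check_class twist_L2 by auto
    show "L2 circle_bdry \<subseteq> T_minus_check ` \<H>"
    proof
      fix y assume "y \<in> L2 circle_bdry"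
      then obtain h where h: "h \<in> L2_space circle_bdry" "y = L2_class circle_bdry h" unfolding L2_def by blast
      have "y = T_minus_check (data_class (twist h))"
        using T_minus_check_class[OF twist_L2[OF h(1)]] h(2) by simp
      then show "y \<in> T_minus_check ` \<H>" unfolding H_eq using twist_L2[OF h(1)] by blast
    qed
  qed
qed

lemma T_minus_check_inv:
  assumes "h \<in> L2_space circle_bdry"
  shows "the_inv_into \<H> T_minus_check (L2_class circle_bdry h) = data_class (twist h)"
proof (rule the_inv_into_f_eq)
  show "inj_on T_minus_check \<H>" using T_minus_check_bij by (simp add: bij_betw_def)
  show "T_minus_check (data_class (twist h)) = L2_class circle_bdry h"
    using T_minus_check_class[OF twist_L2[OF assms]] by simp
  show "data_class (twist h) \<in> \<H>" unfolding H_eq using twist_L2[OF assms] by blast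
qed

text \<open>The statement on fibres, transported by the inversion: this interchanges \<open>z\<close> and \<open>inverse z\<close> both in
  the scalar factor and in the index of the intertwining operator.\<close>
lemma scattering_multiplier:
  assumes "h \<in> L2_space circle_bdry"
  shows "\<exists>k\<in>L2_space circle_bdry. T_plus_check (the_inv_into \<H> T_minus_check (L2_class circle_bdry h)) = L2_class circle_bdry k \<and>
    (AE z in circle. \<exists>\<psi>\<in>intertwiner_L2 (inverse z) (L2_class \<nu> (\<lambda>\<omega>. h (z, \<omega>))).
      AE \<omega> in \<nu>. k (z, \<omega>) = (inverse z - z / of_nat q) / (z - inverse z / of_nat q) * \<psi> \<omega>)"
proof -
  define g where "g = twist h"
  have g: "g \<in> L2_space circle_bdry" unfolding g_def by (rule twist_L2[OF assms])
  obtain k where k: "\<And>Y. Y \<in> data_class g \<Longrightarrow> L2_tendsto circle_bdry (\<lambda>n. T_plus_data (Y n)) k"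
    using T_plus_limit[OF g] by blast
  obtain Y where Y: "Y \<in> data_class g" using data_class_nonempty[OF g] .
  have kL: "k \<in> L2_space circle_bdry" using k[OF Y] by (simp add: L2_tendsto_def)
  have "T_plus (data_class g) = L2_class circle_bdry k"
    unfolding T_plus_def by (rule extend_class[OF _ k]) (use Y in auto)
  then have "T_plus_check (data_class g) = L2_class circle_bdry (twist k)"
    unfolding T_plus_check_def twist_class[symmetric] by (simp add: twist_def[abs_def])
  then have 1: "T_plus_check (the_inv_into \<H> T_minus_check (L2_class circle_bdry h)) = L2_class circle_bdry (twist k)"
    unfolding T_minus_check_inv[OF assms] g_def .
  have "AE z in distr circle circle inverse. \<exists>\<psi>\<in>intertwiner_L2 z (L2_class \<nu> (\<lambda>\<omega>. g (z, \<omega>))).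
    AE \<omega> in \<nu>. k (z, \<omega>) = (z - inverse z / of_nat q) / (inverse z - z / of_nat q) * \<psi> \<omega>"
    unfolding distr_circle_inverse by (rule scattering_fibre[OF g k])
  from AE_distrD[OF inverse_measurable_circle this]
  have "AE z in circle. \<exists>\<psi>\<in>intertwiner_L2 (inverse z) (L2_class \<nu> (\<lambda>\<omega>. h (z, \<omega>))).
      AE \<omega> in \<nu>. twist k (z, \<omega>) = (inverse z - z / of_nat q) / (z - inverse z / of_nat q) * \<psi> \<omega>"
    by (simp add: g_def twist_def)
  then show ?thesis using 1 twist_L2[OF kL] by blast
qed

text \<open>Formal: on \<open>ell2\<close> the Fourier transform is \<open>T_minus_check\<close> after the inverse of \<open>W_minus\<close>, so it is
  injective, and its inverse at the class of \<open>h\<close> is \<open>W_minus\<close> of the element \<open>x\<close> that \<open>T_minus_check\<close> maps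
  there; the scattering operator maps \<open>W_minus x\<close> to \<open>W_plus x\<close>.\<close>
lemma scattering_fourier:
  assumes "h \<in> L2_space circle_bdry" "outgoing_rep W_plus" "incoming_rep W_minus"
  shows "fourier (scattering W_plus W_minus (the_inv_into ell2 fourier (L2_class circle_bdry h))) =
    T_plus_check (the_inv_into \<H> T_minus_check (L2_class circle_bdry h))"
proof -
  define x where "x = the_inv_into \<H> T_minus_check (L2_class circle_bdry h)"
  have inj: "inj_on T_minus_check \<H>" and img: "L2_class circle_bdry h \<in> T_minus_check ` \<H>"
    using T_minus_check_bij assms(1) by (auto simp: bij_betw_def L2_def)
  have x: "x \<in> \<H>" "T_minus_check x = L2_class circle_bdry h"
    unfolding x_def using the_inv_into_into[OF inj img order_refl] f_the_inv_into_f[OF inj img] by auto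
  have W: "bij_betw W_minus \<H> ell2" "\<And>x. x \<in> \<H> \<Longrightarrow> T_minus_check x = fourier (W_minus x)"
    using assms(3) by (auto simp: incoming_rep_def)
  have "the_inv_into ell2 fourier (L2_class circle_bdry h) = W_minus x"
  proof (rule the_inv_into_f_eq)
    show "inj_on fourier ell2"
    proof (rule inj_onI)
      fix a b assume ab: "a \<in> ell2" "b \<in> ell2" "fourier a = fourier b"
      then obtain y y' where y: "y \<in> \<H>" "a = W_minus y" "y' \<in> \<H>" "b = W_minus y'"
        using W(1) unfolding bij_betw_def by blast
      then have "T_minus_check y = T_minus_check y'" using W(2) ab(3) by simp
      then show "a = b" using inj_onD[OF inj] y by blast
    qed
    show "fourier (W_minus x) = L2_class circle_bdry h" using W(2)[OF x(1)] x(2) by simp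
    show "W_minus x \<in> ell2" using W(1) x(1) by (auto simp: bij_betw_def)
  qed
  moreover have "the_inv_into \<H> W_minus (W_minus x) = x"
    using W(1) x(1) the_inv_into_f_f by (metis bij_betw_def)
  ultimately show ?thesis
    using assms(2) x(1) unfolding scattering_def x_def[symmetric] by (simp add: outgoing_rep_def)
qed

end

theorem proposition3p16:
  fixes E :: "'v \<Rightarrow> 'v \<Rightarrow> bool" and q :: nat and org :: 'v and \<nu> :: "'v bdry measure"
    and h :: "complex \<times> 'v bdry \<Rightarrow> complex"
  assumes "tree_boundary E q org \<nu>"
    and "h \<in> L2_space (circle \<Otimes>\<^sub>M \<nu>)"
  shows
    "bij_betw (tree_boundary.T_minus_check E q org \<nu>)
       (regular_tree.\<H> E q) (L2 (circle \<Otimes>\<^sub>M \<nu>)) \<and>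
     (\<exists>k \<in> L2_space (circle \<Otimes>\<^sub>M \<nu>).
        tree_boundary.T_plus_check E q org \<nu>
          (the_inv_into (regular_tree.\<H> E q) (tree_boundary.T_minus_check E q org \<nu>)
            (L2_class (circle \<Otimes>\<^sub>M \<nu>) h))
        = L2_class (circle \<Otimes>\<^sub>M \<nu>) k \<and>
        (AE z in circle.
           \<exists>\<psi> \<in> tree_boundary.intertwiner_L2 E q org \<nu> (inverse z) (L2_class \<nu> (\<lambda>\<omega>. h (z, \<omega>))).
             AE \<omega> in \<nu>. k (z, \<omega>) =
               (inverse z - z / of_nat q) / (z - inverse z / of_nat q) * \<psi> \<omega>)) \<and>
     (\<forall>W_plus W_minus.
        tree_boundary.outgoing_rep E q org \<nu> W_plus \<longrightarrow>
        tree_boundary.incoming_rep E q org \<nu> W_minus \<longrightarrow>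
        tree_boundary.fourier \<nu>
          (tree_boundary.scattering E q W_plus W_minus
            (the_inv_into (tree_boundary.ell2 \<nu>) (tree_boundary.fourier \<nu>)
              (L2_class (circle \<Otimes>\<^sub>M \<nu>) h)))
        = tree_boundary.T_plus_check E q org \<nu>
          (the_inv_into (regular_tree.\<H> E q) (tree_boundary.T_minus_check E q org \<nu>)
            (L2_class (circle \<Otimes>\<^sub>M \<nu>) h)))"
proof -
  interpret tree_boundary E q org \<nu> by (rule assms(1))
  show ?thesis
    using T_minus_check_bij scattering_multiplier[OF assms(2)] scattering_fourier[OF assms(2)] by blast
qed

end
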